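(* Let $f,g,h,k\in L^2(P)$. Then the Wigner transforms satisfy $$\langle W(f,h),W(g,k)\rangle_{L^2(P\times\widehat P,S_2)}=\langle f,g\rangle_{L^2(P)}\,\overline{\langle h,k\rangle_{L^2(P)}}.$$
   Context: The affine Poincar\'e group is $P=\{(b,a,\vartheta):b\in\mathbb R^2,\ a>0,\ \vartheta\in\mathbb R\}$ with product $(b,a,\vartheta)*(b',a',\vartheta')=(b+a\Lambda_\vartheta b',\,aa',\,\vartheta+\vartheta')$, where $\Lambda_\vartheta=\begin{pmatrix}\cosh\vartheta&\sinh\vartheta\\ \sinh\vartheta&\cosh\vartheta\end{pmatrix}$. Its left Haar measure is $d\mu(b,a,\vartheta)=\frac{db\,da\,d\vartheta}{a^3}$; $L^2(P)$ is taken with respect to $\mu$. Every $\xi=(b,a,\vartheta)\in P$ has the square root $\xi^{1/2}=\Big(\frac{b+\sqrt a\,\Lambda_{-\vartheta/2}b}{1+a+2\sqrt a\cosh(\vartheta/2)},\sqrt a,\frac\vartheta2\Big)$, satisfying $\xi^{1/2}*\xi^{1/2}=\xi$. $\langle x;y\rangle=x_1y_1-x_2y_2$ is the Minkowski form on $\mathbb R^2$. The four cones are $C_1^1=\{x_1^2>x_2^2,\ x_1>0\}$, $C_2^1=\{x_1^2>x_2^2,\ x_1<0\}$, $C_1^2=\{x_1^2<x_2^2,\ x_2>0\}$, $C_2^2=\{x_1^2<x_2^2,\ x_2<0\}$ in $\mathbb R^2$. For $i,j=1,2$, $\pi_i^j$ is the unitary representation of $P$ on $L^2(C_i^j)$ given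 by $(\pi_i^j(b,a,\vartheta)\varphi)(x)=a\,e^{i\langle x;b\rangle}\varphi(a\Lambda_{-\vartheta}x)$, and $\widehat P=\{\pi_i^j:i,j=1,2\}$. The Duflo--Moore operators are the unbounded operators $(D_i^j\varphi)(x)=\frac1{2\pi}|\langle x;x\rangle|^{1/2}\varphi(x)$ on $L^2(C_i^j)$. For $F\in L^1(P)\cap L^2(P)$ the group Fourier transform is the Hilbert--Schmidt operator $(\widehat F(\pi_i^j)\varphi)(x)=\int_P F(\xi)\,(\pi_i^j(\xi)D_i^j\varphi)(x)\,d\mu(\xi)$ on $L^2(C_i^j)$, extended by continuity to $F\in L^2(P)$. The Wigner transform of $f,g\in L^2(P)$ is the operator-valued function on $P\times\widehat P$ $$(W(f,g)(w,\pi_i^j)\varphi)(x)=\int_P f(\xi^{1/2}*w)\,\overline{g(w^{-1}*\xi^{1/2})}\,(\pi_i^j(\xi)D_i^j\varphi)(x)\,d\mu(\xi),\quad w\in P,\ \varphi\in L^2(C_i^j),$$ i.e. $W(f,g)(w,\pi_i^j)$ is the group Fourier transform at $\pi_i^j$ of $\xi\mapsto f(\xi^{1/2}*w)\overline{g(w^{-1}*\xi^{1/2})}$. $S_2(C_i^j)$ denotes the Hilbert--Schmidt operators on $L^2(C_i^j)$. $L^2(P\times\widehat P,S_2)$ is the space of functions $F$ with $F(b,a,\vartheta,\pi_i^j)\in S_2(C_i^j)$ and $\int_P\|F(b,a,\vartheta,\pi_i^j)\|_{S_2(C_i^j)}^2d\mu<\infty$ for $i,j=1,2$, with inner product $\langle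 F,G\rangle=\int_P\sum_{i,j=1}^2\mathrm{Tr}[F(b,a,\vartheta,\pi_i^j)G(b,a,\vartheta,\pi_i^j)^*]\,d\mu(b,a,\vartheta)$. *)

theory Defs
  imports "HOL-Analysis.Analysis" "HOL-Algebra.Group"
begin

section \<open>L2 spaces and Hilbert-Schmidt operators\<close>

text \<open>Elements of the L2 space of a measure are represented by measurable functions; functions
  that agree almost everywhere represent the same element. An operator is a map on representatives,
  and all laws about its values are required almost everywhere only.\<close>

definition L2 :: "'a measure \<Rightarrow> ('a \<Rightarrow> complex) set" where
  "L2 M = {f \<in> borel_measurable M. integrable M (\<lambda>x. (cmod (f x))\<^sup>2)}"

definition l2_inner :: "'a measure \<Rightarrow> ('a \<Rightarrow> complex) \<Rightarrow> ('a \<Rightarrow> complex) \<Rightarrow> complex" where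
  "l2_inner M f g = (LINT x|M. f x * cnj (g x))"

definition l2_norm :: "'a measure \<Rightarrow> ('a \<Rightarrow> complex) \<Rightarrow> real" where
  "l2_norm M f = sqrt (LINT x|M. (cmod (f x))\<^sup>2)"

text \<open>Bases are sequences: the spaces to which this is applied are separable and
  infinite-dimensional.\<close>

definition is_onb :: "'a measure \<Rightarrow> (nat \<Rightarrow> 'a \<Rightarrow> complex) \<Rightarrow> bool" where
  "is_onb M e \<longleftrightarrow>
     (\<forall>n. e n \<in> L2 M) \<and>
     (\<forall>m n. l2_inner M (e m) (e n) = (if m = n then 1 else 0)) \<and>
     (\<forall>f\<in>L2 M. (\<forall>n. l2_inner M f (e n) = 0) \<longrightarrow> (AE x in M. f x = 0))"

definition onb :: "'a measure \<Rightarrow> nat \<Rightarrow> 'a \<Rightarrow> complex" where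
  "onb M = (SOME e. is_onb M e)"

type_synonym 'a l2op = "('a \<Rightarrow> complex) \<Rightarrow> 'a \<Rightarrow> complex"

text \<open>Compatibility with almost everywhere equality follows from linearity and boundedness.\<close>

definition bounded_op :: "'a measure \<Rightarrow> 'a l2op \<Rightarrow> bool" where
  "bounded_op M T \<longleftrightarrow>
     (\<forall>f\<in>L2 M. T f \<in> L2 M) \<and>
     (\<forall>f\<in>L2 M. \<forall>g\<in>L2 M. AE x in M. T (\<lambda>y. f y + g y) x = T f x + T g x) \<and>
     (\<forall>c. \<forall>f\<in>L2 M. AE x in M. T (\<lambda>y. c * f y) x = c * T f x) \<and>
     (\<exists>K. \<forall>f\<in>L2 M. l2_norm M (T f) \<le> K * l2_norm M f)"

text \<open>The next three notions do not depend on the choice of the orthonormal basis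
  (for the trace: on trace class operators, such as the product of two Hilbert-Schmidt operators).\<close>

definition hs_op :: "'a measure \<Rightarrow> 'a l2op \<Rightarrow> bool" where
  "hs_op M T \<longleftrightarrow> bounded_op M T \<and> summable (\<lambda>n. (l2_norm M (T (onb M n)))\<^sup>2)"

definition hs_norm :: "'a measure \<Rightarrow> 'a l2op \<Rightarrow> real" where
  "hs_norm M T = sqrt (\<Sum>n. (l2_norm M (T (onb M n)))\<^sup>2)"

definition op_trace :: "'a measure \<Rightarrow> 'a l2op \<Rightarrow> complex" where
  "op_trace M T = (\<Sum>n. l2_inner M (T (onb M n)) (onb M n))"

definition op_adjoint :: "'a measure \<Rightarrow> 'a l2op \<Rightarrow> 'a l2op" where
  "op_adjoint M T g = (SOME u. u \<in> L2 M \<and> (\<forall>f\<in>L2 M. l2_inner M (T f) g = l2_inner M f u))"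

section \<open>The affine Poincare group\<close>

type_synonym poincare = "(real^2) \<times> real \<times> real"

definition boost :: "real \<Rightarrow> real^2^2" where
  "boost t = vector [vector [cosh t, sinh t], vector [sinh t, cosh t]]"

definition Poincare :: "poincare monoid" where
  "Poincare =
     \<lparr>carrier = {(b, a, t). a > 0},
      mult = (\<lambda>(b, a, t) (b', a', t'). (b + a *\<^sub>R (boost t *v b'), a * a', t + t')),
      one = (0, 1, 0)\<rparr>"

definition haar :: "poincare measure" where
  "haar = density (restrict_space lborel (carrier Poincare)) (\<lambda>(b, a, t). ennreal (1 / a ^ 3))"

definition psqrt :: "poincare \<Rightarrow> poincare" where
  "psqrt = (\<lambda>(b, a, t).
     ((1 / (1 + a + 2 * sqrt a * cosh (t / 2))) *\<^sub>R (b + sqrt a *\<^sub>R (boost (- t / 2) *v b)),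
      sqrt a, t / 2))"

lemma boost_mult: "boost s *v (boost t *v x) = boost (s + t) *v x"
  by (simp add: vec_eq_iff forall_2 boost_def matrix_vector_mult_def sum_2 cosh_add sinh_add
      algebra_simps)

lemma boost_0 [simp]: "boost 0 *v x = x"
  by (simp add: vec_eq_iff forall_2 boost_def matrix_vector_mult_def sum_2)

lemma group_Poincare: "group Poincare"
proof (rule groupI)
  fix x assume "x \<in> carrier Poincare"
  then obtain b a t where x: "x = (b, a, t)" "a > 0"
    by (auto simp: Poincare_def)
  show "\<exists>y\<in>carrier Poincare. y \<otimes>\<^bsub>Poincare\<^esub> x = \<one>\<^bsub>Poincare\<^esub>"
    using x by (intro bexI[of _ "(- ((1 / a) *\<^sub>R (boost (- t) *v b)), 1 / a, - t)"])
      (auto simp: Poincare_def)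
qed (auto simp: Poincare_def boost_mult matrix_vector_right_distrib matrix_vector_mult_scaleR
      scaleR_add_right algebra_simps)

lemma inv_Poincare:
  assumes "a > 0"
  shows "inv\<^bsub>Poincare\<^esub> (b, a, t) = (- ((1 / a) *\<^sub>R (boost (- t) *v b)), 1 / a, - t)"
  by (rule group.inv_equality[OF group_Poincare]) (use assms in \<open>auto simp: Poincare_def\<close>)

lemma psqrt_mult:
  assumes "x \<in> carrier Poincare"
  shows "psqrt x \<otimes>\<^bsub>Poincare\<^esub> psqrt x = x"
proof -
  obtain b a t where x: "x = (b, a, t)" and a: "a > 0"
    using assms by (auto simp: Poincare_def)
  define s where "s = sqrt a"
  have s: "s > 0" "a = s * s"
    using a by (auto simp: s_def)
  define d where "d = 1 + a + 2 * s * cosh (t / 2)"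
  have "d > 0"
    using a s(1) cosh_real_pos[of "t / 2"] by (simp add: d_def add_pos_pos)
  have "b + s *\<^sub>R (boost (- t / 2) *v b) + s *\<^sub>R (boost (t / 2) *v (b + s *\<^sub>R (boost (- t / 2) *v b)))
      = b + (s * s) *\<^sub>R b + s *\<^sub>R (boost (- t / 2) *v b + boost (t / 2) *v b)"
    by (simp add: matrix_vector_right_distrib matrix_vector_mult_scaleR boost_mult algebra_simps)
  also have "boost (- t / 2) *v b + boost (t / 2) *v b = (2 * cosh (t / 2)) *\<^sub>R b"
    by (simp add: vec_eq_iff forall_2 boost_def matrix_vector_mult_def sum_2 algebra_simps)
  also have "b + (s * s) *\<^sub>R b + s *\<^sub>R (2 * cosh (t / 2)) *\<^sub>R b = d *\<^sub>R b"
    by (simp add: d_def s(2) algebra_simps)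
  finally have "(1 / d) *\<^sub>R (b + s *\<^sub>R (boost (- t / 2) *v b)) +
      s *\<^sub>R (boost (t / 2) *v ((1 / d) *\<^sub>R (b + s *\<^sub>R (boost (- t / 2) *v b)))) = b"
    using \<open>d > 0\<close>
    by (metis (no_types, lifting) less_irrefl matrix_vector_mult_scaleR nonzero_divide_eq_eq
        scaleR_add_right scaleR_left_commute scaleR_one scaleR_scaleR)
  then show ?thesis
    using s by (simp add: x Poincare_def psqrt_def d_def flip: s_def)
qed

section \<open>Representations and the group Fourier transform\<close>

definition mink :: "real^2 \<Rightarrow> real^2 \<Rightarrow> real" where
  "mink x y = x $ 1 * y $ 1 - x $ 2 * y $ 2"

text \<open>The lower index \<open>i\<close> and the upper index \<open>j\<close> range over \<open>{1, 2}\<close>.\<close>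

definition cone :: "nat \<Rightarrow> nat \<Rightarrow> (real^2) set" where
  "cone i j =
    (if j = 1
     then {x. (x $ 1)\<^sup>2 > (x $ 2)\<^sup>2 \<and> (if i = 1 then x $ 1 > 0 else x $ 1 < 0)}
     else {x. (x $ 1)\<^sup>2 < (x $ 2)\<^sup>2 \<and> (if i = 1 then x $ 2 > 0 else x $ 2 < 0)})"

abbreviation cone_measure :: "nat \<Rightarrow> nat \<Rightarrow> (real^2) measure" where
  "cone_measure i j \<equiv> restrict_space lborel (cone i j)"

text \<open>The representations and the Duflo-Moore operators of the four cones are given by the same
  formulas; only the space \<open>L2 (cone_measure i j)\<close> on which they act differs.\<close>

definition rep :: "poincare \<Rightarrow> (real^2) l2op" where
  "rep = (\<lambda>(b, a, t) \<phi> x.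
     complex_of_real a * exp (\<i> * complex_of_real (mink x b)) * \<phi> (a *\<^sub>R (boost (- t) *v x)))"

definition duflo_moore :: "(real^2) l2op" where
  "duflo_moore \<phi> x = complex_of_real (1 / (2 * pi) * sqrt \<bar>mink x x\<bar>) * \<phi> x"

text \<open>The transform of \<open>F\<close> in L1 and L2. The Duflo-Moore operator is unbounded, and for \<open>\<phi>\<close> outside
  its domain the integral can diverge for all \<open>x\<close> in a set of positive measure. So the integral
  formula is imposed on the domain, which is dense and hence determines the Hilbert-Schmidt
  operator.\<close>

definition is_fourier_L1_L2 :: "nat \<Rightarrow> nat \<Rightarrow> (poincare \<Rightarrow> complex) \<Rightarrow> (real^2) l2op \<Rightarrow> bool" where
  "is_fourier_L1_L2 i j F T \<longleftrightarrow>
     hs_op (cone_measure i j) T \<and>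
     (\<forall>\<phi>. \<phi> \<in> L2 (cone_measure i j) \<and> duflo_moore \<phi> \<in> L2 (cone_measure i j) \<longrightarrow>
       (AE x in cone_measure i j. T \<phi> x = (LINT \<xi>|haar. F \<xi> * rep \<xi> (duflo_moore \<phi>) x)))"

definition fourier_L1_L2 :: "nat \<Rightarrow> nat \<Rightarrow> (poincare \<Rightarrow> complex) \<Rightarrow> (real^2) l2op" where
  "fourier_L1_L2 i j F = (SOME T. is_fourier_L1_L2 i j F T)"

text \<open>Extension by continuity to L2.\<close>

definition is_fourier :: "nat \<Rightarrow> nat \<Rightarrow> (poincare \<Rightarrow> complex) \<Rightarrow> (real^2) l2op \<Rightarrow> bool" where
  "is_fourier i j F T \<longleftrightarrow>
     hs_op (cone_measure i j) T \<and>
     (\<forall>Fs. (\<forall>n::nat. integrable haar (Fs n) \<and> Fs n \<in> L2 haar) \<and>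
           (\<lambda>n. l2_norm haar (\<lambda>\<xi>. Fs n \<xi> - F \<xi>)) \<longlonglongrightarrow> 0 \<longrightarrow>
       (\<lambda>n. hs_norm (cone_measure i j) (\<lambda>\<phi> x. fourier_L1_L2 i j (Fs n) \<phi> x - T \<phi> x)) \<longlonglongrightarrow> 0)"

text \<open>The value 0 outside L2 is needed below: the function transformed in the definition of the
  Wigner transform at \<open>w\<close> is in L2 only for almost every \<open>w\<close>.\<close>

definition fourier :: "nat \<Rightarrow> nat \<Rightarrow> (poincare \<Rightarrow> complex) \<Rightarrow> (real^2) l2op" where
  "fourier i j F = (if F \<in> L2 haar then SOME T. is_fourier i j F T else (\<lambda>\<phi> x. 0))"

section \<open>Wigner transform\<close>

text \<open>A function on the product of the group with its dual takes a group element and the two indices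
  of a representation.\<close>

type_synonym op_field = "poincare \<Rightarrow> nat \<Rightarrow> nat \<Rightarrow> (real^2) l2op"

definition wigner :: "(poincare \<Rightarrow> complex) \<Rightarrow> (poincare \<Rightarrow> complex) \<Rightarrow> op_field" where
  "wigner f g w i j = fourier i j
     (\<lambda>\<xi>. f (psqrt \<xi> \<otimes>\<^bsub>Poincare\<^esub> w) * cnj (g (inv\<^bsub>Poincare\<^esub> w \<otimes>\<^bsub>Poincare\<^esub> psqrt \<xi>)))"

text \<open>Measurability of an operator field is understood weakly.\<close>

definition L2_field :: "op_field set" where
  "L2_field = {F. \<forall>i\<in>{1, 2}. \<forall>j\<in>{1, 2}.
     (\<forall>w\<in>carrier Poincare. hs_op (cone_measure i j) (F w i j)) \<and>
     (\<forall>\<phi>\<in>L2 (cone_measure i j). \<forall>\<psi>\<in>L2 (cone_measure i j).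
        (\<lambda>w. l2_inner (cone_measure i j) (F w i j \<phi>) \<psi>) \<in> borel_measurable haar) \<and>
     integrable haar (\<lambda>w. (hs_norm (cone_measure i j) (F w i j))\<^sup>2)}"

definition field_inner :: "op_field \<Rightarrow> op_field \<Rightarrow> complex" where
  "field_inner F G = (LINT w|haar. (\<Sum>i\<in>{1, 2}. \<Sum>j\<in>{1, 2}.
     op_trace (cone_measure i j) (F w i j \<circ> op_adjoint (cone_measure i j) (G w i j))))"

end

theory Submission
  imports Defs "HOL-Probability.Characteristic_Functions"
begin

text \<open>For fixed \<open>w\<close> the Wigner transform of \<open>f\<close> and \<open>h\<close> is the group Fourier transform of the function
\<open>\<xi> \<mapsto> f (\<xi>\<^sup>1\<^sup>/\<^sup>2 w) cnj (h (w\<^sup>-\<^sup>1 \<xi>\<^sup>1\<^sup>/\<^sup>2))\<close>,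
here called \<open>wigner_integrand f h w\<close>. Two facts give the orthogonality relation.

The first is that the Fourier transform of the group is an isometry: for \<open>F\<close> and \<open>G\<close> in L2 of the group the
traces of \<open>F^(\<pi>) G^(\<pi>)*\<close> over the four representations \<open>\<pi>\<close> sum to the inner product of \<open>F\<close> and \<open>G\<close>.
Write the group as the plane of translations \<open>b\<close> times the pairs of a scale \<open>a\<close> and a rapidity \<open>t\<close>. On a
cone the transform of an integrable \<open>F\<close> is the integral operator with kernel \<open>fkernel F\<close>: for
fixed \<open>x\<close>, the map that sends \<open>(a, t)\<close> to the point at which the representation evaluates its
argument is a bijection onto the cone, and substituting this point for \<open>(a, t)\<close> turns the defining
integral into an integral over the cone (\<open>nn_integral_orbit\<close>, \<open>kernel_op_fkernel\<close>). In light-cone coordinates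
the substitution is a rescaling of the two axes. Its Jacobian is exactly compensated by the Duflo-Moore
operator, so the squared norm of the kernel over one cone is the integral of the squared plane Fourier
transform of \<open>F\<close> in \<open>b\<close>, divided by \<open>(2 \<pi>)\<^sup>2\<close>, over the frequencies in the cone and all \<open>(a, t)\<close>. The
four cones fill the plane up to a null set, so the Plancherel theorem of the plane (\<open>plancherel\<close>)
finishes the argument (\<open>fkernel_nn_sum\<close>, \<open>fourier_kernel_inner_sum\<close>). The trace of a product of
Hilbert-Schmidt operators is the inner product of their kernels (\<open>op_trace_has_kernel\<close>).

The second is that the substitution \<open>u = \<xi>\<^sup>1\<^sup>/\<^sup>2 w\<close>, \<open>v = w\<^sup>-\<^sup>1 \<xi>\<^sup>1\<^sup>/\<^sup>2\<close> preserves the product of the Haar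
measures in \<open>w\<close> and \<open>\<xi>\<close> (\<open>nn_integral_wigner_coords\<close>), by left invariance. Hence the
inner product of two Wigner integrands, integrated over \<open>w\<close>, separates into the inner product of \<open>f\<close> and
\<open>g\<close> in \<open>u\<close> and the conjugate of that of \<open>h\<close> and \<open>k\<close> in \<open>v\<close> (\<open>l2_inner_wigner_integrand\<close>).

The Fourier transform and the orthonormal basis behind norms and traces are given by choices among
objects determined up to null sets. So the orthonormal bases have to be constructed
(\<open>onb_exists_open\<close>), the chosen transform has to be shown to have the expected kernel
(\<open>has_kernel_fourier\<close>), and measurability in \<open>w\<close> has to be derived from explicit
approximations (\<open>borel_measurable_fourier_kernel_pairing\<close>). The Plancherel theorem of the plane is
proved with Gaussian weights, which turn the pairing of two transforms into a pairing with Gaussian averages;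
an orthonormal basis of functions for which the formula is known then gives the general case.\<close>

section \<open>Square integrable functions\<close>

lemma borel_measurable_cnj [measurable (raw)]:
  "f \<in> borel_measurable M \<Longrightarrow> (\<lambda>x. cnj (f x)) \<in> borel_measurable M"
  by (rule measurable_compose[OF _ borel_measurable_continuous_onI]) (auto intro: continuous_intros)

lemma L2_measurable [measurable_dest]: "f \<in> L2 M \<Longrightarrow> f \<in> borel_measurable M"
  by (simp add: L2_def)

lemma L2_square_integrable: "f \<in> L2 M \<Longrightarrow> integrable M (\<lambda>x. (cmod (f x))\<^sup>2)"
  by (simp add: L2_def)

lemma L2_iff_nn_integral:
  "f \<in> L2 M \<longleftrightarrow> f \<in> borel_measurable M \<and> (\<integral>\<^sup>+x. ennreal ((cmod (f x))\<^sup>2) \<partial>M) < \<infinity>"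
  by (auto simp: L2_def integrable_iff_bounded)

lemma l2_norm_nonneg [simp]: "l2_norm M f \<ge> 0"
  by (simp add: l2_norm_def)

lemma l2_norm_square: "(l2_norm M f)\<^sup>2 = (LINT x|M. (cmod (f x))\<^sup>2)"
  by (simp add: l2_norm_def)

lemma nn_integral_square_L2:
  "f \<in> L2 M \<Longrightarrow> (\<integral>\<^sup>+x. ennreal ((cmod (f x))\<^sup>2) \<partial>M) = ennreal ((l2_norm M f)\<^sup>2)"
  unfolding l2_norm_square by (intro nn_integral_eq_integral L2_square_integrable) auto

lemma L2_bound:
  assumes "g \<in> L2 M" "f \<in> borel_measurable M" "AE x in M. cmod (f x) \<le> C * cmod (g x)"
  shows "f \<in> L2 M"
proof -
  have "integrable M (\<lambda>x. (cmod (f x))\<^sup>2)"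
  proof (rule Bochner_Integration.integrable_bound)
    show "integrable M (\<lambda>x. C\<^sup>2 * (cmod (g x))\<^sup>2)"
      using L2_square_integrable[OF assms(1)] by simp
    show "(\<lambda>x. (cmod (f x))\<^sup>2) \<in> borel_measurable M"
      using assms(2) by measurable
    show "AE x in M. norm ((cmod (f x))\<^sup>2) \<le> norm (C\<^sup>2 * (cmod (g x))\<^sup>2)"
      using assms(3)
    proof eventually_elim
      case (elim x)
      then have "(cmod (f x))\<^sup>2 \<le> (C * cmod (g x))\<^sup>2" by (intro power_mono) auto
      then show ?case by (simp add: power_mult_distrib)
    qed
  qed
  with assms(2) show ?thesis by (simp add: L2_def)
qed

lemma L2_zero [simp]: "(\<lambda>x. 0) \<in> L2 M"
  by (simp add: L2_def)

lemma L2_cmult [intro]: "f \<in> L2 M \<Longrightarrow> (\<lambda>x. c * f x) \<in> L2 M"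
  by (rule L2_bound[of f _ _ "cmod c"]) (auto simp: norm_mult dest: L2_measurable)

lemma L2_cnj [intro]: "f \<in> L2 M \<Longrightarrow> (\<lambda>x. cnj (f x)) \<in> L2 M"
  by (auto simp: L2_def)

lemma square_norm_add_le: "(cmod (a + b))\<^sup>2 \<le> 2 * (cmod a)\<^sup>2 + 2 * (cmod b)\<^sup>2"
proof -
  have "(cmod (a + b))\<^sup>2 \<le> (cmod a + cmod b)\<^sup>2"
    by (intro power_mono norm_triangle_ineq) auto
  also have "\<dots> \<le> 2 * (cmod a)\<^sup>2 + 2 * (cmod b)\<^sup>2"
    using sum_squares_bound[of "cmod a" "cmod b"] by (simp add: power2_sum)
  finally show ?thesis .
qed

lemma L2_add [intro]:
  assumes "f \<in> L2 M" "g \<in> L2 M"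
  shows "(\<lambda>x. f x + g x) \<in> L2 M"
proof -
  have [measurable]: "f \<in> borel_measurable M" "g \<in> borel_measurable M"
    using assms by (auto dest: L2_measurable)
  have "integrable M (\<lambda>x. (cmod (f x + g x))\<^sup>2)"
    by (rule Bochner_Integration.integrable_bound[of _ "\<lambda>x. 2 * (cmod (f x))\<^sup>2 + 2 * (cmod (g x))\<^sup>2"])
      (use assms in \<open>auto simp: L2_square_integrable intro!: square_norm_add_le AE_I2\<close>)
  then show ?thesis by (simp add: L2_def)
qed

lemma L2_diff [intro]:
  assumes "f \<in> L2 M" "g \<in> L2 M"
  shows "(\<lambda>x. f x - g x) \<in> L2 M"
  using L2_add[OF assms(1) L2_cmult[OF assms(2), of "-1"]] by simp

lemma L2_sum [intro]:
  "(\<And>i. i \<in> I \<Longrightarrow> f i \<in> L2 M) \<Longrightarrow> (\<lambda>x. \<Sum>i\<in>I. f i x) \<in> L2 M"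
  by (induction I rule: infinite_finite_induct) auto

lemma L2_inner_integrable:
  assumes "f \<in> L2 M" "g \<in> L2 M"
  shows "integrable M (\<lambda>x. f x * cnj (g x))"
proof (rule Bochner_Integration.integrable_bound)
  have [measurable]: "f \<in> borel_measurable M" "g \<in> borel_measurable M"
    using assms by (auto dest: L2_measurable)
  show "integrable M (\<lambda>x. (cmod (f x))\<^sup>2 + (cmod (g x))\<^sup>2)"
    using assms by (auto simp: L2_square_integrable)
  show "(\<lambda>x. f x * cnj (g x)) \<in> borel_measurable M" by measurable
  have "cmod a * cmod b \<le> (cmod a)\<^sup>2 + (cmod b)\<^sup>2" for a b
    using sum_squares_bound[of "cmod a" "cmod b"] mult_nonneg_nonneg[OF norm_ge_zero norm_ge_zero, of a b]
    by linarith
  then show "AE x in M. norm (f x * cnj (g x)) \<le> norm ((cmod (f x))\<^sup>2 + (cmod (g x))\<^sup>2)"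
    by (simp add: norm_mult)
qed

lemma L2_mult_integrable:
  assumes "f \<in> L2 M" "g \<in> L2 M"
  shows "integrable M (\<lambda>x. f x * g x)"
  using L2_inner_integrable[OF assms(1) L2_cnj[OF assms(2)]] by simp

lemma l2_inner_cong_AE:
  assumes "AE x in M. f x = f' x" "AE x in M. g x = g' x"
    and "f \<in> L2 M" "f' \<in> L2 M" "g \<in> L2 M" "g' \<in> L2 M"
  shows "l2_inner M f g = l2_inner M f' g'"
proof -
  have [measurable]: "f \<in> borel_measurable M" "g \<in> borel_measurable M"
      "f' \<in> borel_measurable M" "g' \<in> borel_measurable M"
    using assms by (auto dest: L2_measurable)
  show ?thesis
    unfolding l2_inner_def using assms(1,2) by (intro integral_cong_AE) auto
qed

lemma l2_norm_cong_AE: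
  assumes "AE x in M. f x = f' x" and "f \<in> borel_measurable M" "f' \<in> borel_measurable M"
  shows "l2_norm M f = l2_norm M f'"
  unfolding l2_norm_def using assms by (intro arg_cong[where f = sqrt] integral_cong_AE) auto

lemma l2_inner_add_left:
  "f \<in> L2 M \<Longrightarrow> g \<in> L2 M \<Longrightarrow> h \<in> L2 M \<Longrightarrow>
    l2_inner M (\<lambda>x. f x + g x) h = l2_inner M f h + l2_inner M g h"
  by (simp add: l2_inner_def ring_distribs L2_inner_integrable)

lemma l2_inner_diff_left:
  "f \<in> L2 M \<Longrightarrow> g \<in> L2 M \<Longrightarrow> h \<in> L2 M \<Longrightarrow>
    l2_inner M (\<lambda>x. f x - g x) h = l2_inner M f h - l2_inner M g h"
  by (simp add: l2_inner_def ring_distribs left_diff_distrib L2_inner_integrable)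

lemma l2_inner_cmult_left: "l2_inner M (\<lambda>x. c * f x) h = c * l2_inner M f h"
  by (simp add: l2_inner_def mult.assoc)

lemma l2_inner_commute: "l2_inner M f g = cnj (l2_inner M g f)"
  unfolding l2_inner_def Bochner_Integration.integral_cnj[symmetric] by (simp add: mult.commute)

lemma l2_inner_add_right:
  "f \<in> L2 M \<Longrightarrow> g \<in> L2 M \<Longrightarrow> h \<in> L2 M \<Longrightarrow>
    l2_inner M h (\<lambda>x. f x + g x) = l2_inner M h f + l2_inner M h g"
  by (simp add: l2_inner_def ring_distribs L2_inner_integrable)

lemma l2_inner_diff_right:
  "f \<in> L2 M \<Longrightarrow> g \<in> L2 M \<Longrightarrow> h \<in> L2 M \<Longrightarrow>
    l2_inner M h (\<lambda>x. f x - g x) = l2_inner M h f - l2_inner M h g"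
  by (simp add: l2_inner_def right_diff_distrib L2_inner_integrable)

lemma l2_inner_cmult_right: "l2_inner M h (\<lambda>x. c * f x) = cnj c * l2_inner M h f"
  by (subst (1 2) l2_inner_commute) (simp add: l2_inner_cmult_left)

lemma l2_inner_zero [simp]: "l2_inner M (\<lambda>x. 0) h = 0" "l2_inner M h (\<lambda>x. 0) = 0"
  by (simp_all add: l2_inner_def)

lemma l2_inner_sum_left:
  assumes "finite I" "\<And>i. i \<in> I \<Longrightarrow> f i \<in> L2 M" "h \<in> L2 M"
  shows "l2_inner M (\<lambda>x. \<Sum>i\<in>I. f i x) h = (\<Sum>i\<in>I. l2_inner M (f i) h)"
  using assms by (induction I) (simp_all add: l2_inner_add_left L2_sum)

lemma l2_inner_self: "l2_inner M f f = complex_of_real ((l2_norm M f)\<^sup>2)"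
  unfolding l2_inner_def l2_norm_square
  by (simp add: complex_norm_square[symmetric] flip: integral_complex_of_real)

lemma l2_norm_zero [simp]: "l2_norm M (\<lambda>x. 0) = 0"
  by (simp add: l2_norm_def)

lemma l2_norm_cmult: "l2_norm M (\<lambda>x. c * f x) = cmod c * l2_norm M f"
  by (simp add: l2_norm_def norm_mult power_mult_distrib real_sqrt_mult)

lemma l2_norm_minus_commute: "l2_norm M (\<lambda>x. f x - g x) = l2_norm M (\<lambda>x. g x - f x)"
  by (simp add: l2_norm_def norm_minus_commute)

lemma l2_norm_eq_0_iff:
  assumes "f \<in> L2 M"
  shows "l2_norm M f = 0 \<longleftrightarrow> (AE x in M. f x = 0)"
  using integral_nonneg_eq_0_iff_AE[OF L2_square_integrable[OF assms]] by (simp add: l2_norm_def)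

lemma l2_norm_add_square:
  assumes "f \<in> L2 M" "g \<in> L2 M"
  shows "(l2_norm M (\<lambda>x. f x + g x))\<^sup>2 = (l2_norm M f)\<^sup>2 + (l2_norm M g)\<^sup>2 + 2 * Re (l2_inner M f g)"
proof -
  have "complex_of_real ((l2_norm M (\<lambda>x. f x + g x))\<^sup>2) =
      l2_inner M f f + l2_inner M g g + (l2_inner M f g + cnj (l2_inner M f g))"
    unfolding l2_inner_self[symmetric] using assms
    by (simp add: l2_inner_add_left l2_inner_add_right L2_add flip: l2_inner_commute)
  also have "\<dots> = complex_of_real ((l2_norm M f)\<^sup>2 + (l2_norm M g)\<^sup>2 + 2 * Re (l2_inner M f g))"
    by (simp add: l2_inner_self complex_add_cnj)
  finally show ?thesis by (simp only: of_real_eq_iff)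
qed

lemma l2_cauchy_schwarz:
  assumes "f \<in> L2 M" "g \<in> L2 M"
  shows "cmod (l2_inner M f g) \<le> l2_norm M f * l2_norm M g"
proof (cases "l2_norm M g = 0")
  case True
  then have "l2_inner M f g = l2_inner M f (\<lambda>x. 0)"
    using assms l2_norm_eq_0_iff[of g M] by (intro l2_inner_cong_AE) auto
  with True show ?thesis by simp
next
  case False
  define c where "c = l2_inner M f g / of_real ((l2_norm M g)\<^sup>2)"
  have "0 \<le> (l2_norm M (\<lambda>x. f x + (- c) * g x))\<^sup>2" by simp
  also have "\<dots> = (l2_norm M f)\<^sup>2 + (cmod c * l2_norm M g)\<^sup>2 - 2 * Re (cnj c * l2_inner M f g)"
    using l2_norm_add_square[OF assms(1) L2_cmult[OF assms(2), of "- c"]]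
    unfolding l2_norm_cmult l2_inner_cmult_right by simp
  also have "cnj c * l2_inner M f g = of_real ((cmod (l2_inner M f g))\<^sup>2 / (l2_norm M g)\<^sup>2)"
    by (simp add: c_def complex_norm_square[symmetric] mult.commute)
  also have "(cmod c * l2_norm M g)\<^sup>2 = (cmod (l2_inner M f g))\<^sup>2 / (l2_norm M g)\<^sup>2"
    using False by (simp add: c_def norm_divide norm_mult power_divide power2_eq_square field_simps)
  finally have "(cmod (l2_inner M f g))\<^sup>2 / (l2_norm M g)\<^sup>2 \<le> (l2_norm M f)\<^sup>2"
    by simp
  then have "(cmod (l2_inner M f g))\<^sup>2 \<le> (l2_norm M f * l2_norm M g)\<^sup>2"
    using False by (simp add: field_simps power_mult_distrib)
  then show ?thesis by (rule power2_le_imp_le) simp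
qed

lemma l2_norm_triangle:
  assumes "f \<in> L2 M" "g \<in> L2 M"
  shows "l2_norm M (\<lambda>x. f x + g x) \<le> l2_norm M f + l2_norm M g"
proof (rule power2_le_imp_le)
  have "Re (l2_inner M f g) \<le> l2_norm M f * l2_norm M g"
    using l2_cauchy_schwarz[OF assms] complex_Re_le_cmod order_trans by blast
  then show "(l2_norm M (\<lambda>x. f x + g x))\<^sup>2 \<le> (l2_norm M f + l2_norm M g)\<^sup>2"
    by (simp add: l2_norm_add_square[OF assms] power2_sum)
qed simp

lemma l2_norm_triangle_diff:
  assumes "f \<in> L2 M" "g \<in> L2 M" "h \<in> L2 M"
  shows "l2_norm M (\<lambda>x. f x - h x) \<le> l2_norm M (\<lambda>x. f x - g x) + l2_norm M (\<lambda>x. g x - h x)"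
  using l2_norm_triangle[OF L2_diff[OF assms(1,2)] L2_diff[OF assms(2,3)]] by simp

lemma tendsto_l2_inner:
  assumes "\<And>n. f n \<in> L2 M" "f' \<in> L2 M" "\<And>n. g n \<in> L2 M" "g' \<in> L2 M"
    and f: "(\<lambda>n. l2_norm M (\<lambda>x. f n x - f' x)) \<longlonglongrightarrow> 0"
    and g: "(\<lambda>n. l2_norm M (\<lambda>x. g n x - g' x)) \<longlonglongrightarrow> 0"
  shows "(\<lambda>n. l2_inner M (f n) (g n)) \<longlonglongrightarrow> l2_inner M f' g'"
proof -
  have "(\<lambda>n. l2_inner M (f n) (g n) - l2_inner M f' g') \<longlonglongrightarrow> 0"
  proof (rule Lim_null_comparison)
    let ?b = "\<lambda>n. l2_norm M (\<lambda>x. f n x - f' x) * (l2_norm M (\<lambda>x. g n x - g' x) + l2_norm M g')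
      + l2_norm M f' * l2_norm M (\<lambda>x. g n x - g' x)"
    show "\<forall>\<^sub>F n in sequentially. norm (l2_inner M (f n) (g n) - l2_inner M f' g') \<le> ?b n"
    proof (rule always_eventually, rule allI)
      fix n
      have "l2_inner M (f n) (g n) - l2_inner M f' g' =
          l2_inner M (\<lambda>x. f n x - f' x) (g n) + l2_inner M f' (\<lambda>x. g n x - g' x)"
        using assms by (simp add: l2_inner_diff_left l2_inner_diff_right)
      also have "cmod \<dots> \<le> l2_norm M (\<lambda>x. f n x - f' x) * l2_norm M (g n)
          + l2_norm M f' * l2_norm M (\<lambda>x. g n x - g' x)"
        using assms by (intro order_trans[OF norm_triangle_ineq] add_mono l2_cauchy_schwarz) auto
      also have "l2_norm M (g n) \<le> l2_norm M (\<lambda>x. g n x - g' x) + l2_norm M g'"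
        using l2_norm_triangle[OF L2_diff[OF assms(3,4)] assms(4)] by simp
      finally show "norm (l2_inner M (f n) (g n) - l2_inner M f' g') \<le> ?b n"
        by (simp add: mult_left_mono)
    qed
    have "?b \<longlonglongrightarrow> 0 * (0 + l2_norm M g') + l2_norm M f' * 0"
      by (intro tendsto_intros f g)
    then show "?b \<longlonglongrightarrow> 0" by simp
  qed
  then show ?thesis by (simp add: LIM_zero_iff)
qed

text \<open>Turns identities between norms into identities between inner products; the Plancherel
  formula and the Hilbert-Schmidt norm of a kernel operator are computed for norms and polarised with it.\<close>

lemma l2_polarization:
  assumes "f \<in> L2 M" "g \<in> L2 M"
  shows "l2_inner M f g = (\<Sum>c\<in>{1, -1, \<i>, -\<i>}. c * of_real ((l2_norm M (\<lambda>x. f x + c * g x))\<^sup>2)) / 4"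
proof -
  have *: "(l2_norm M (\<lambda>x. f x + c * g x))\<^sup>2 =
      (l2_norm M f)\<^sup>2 + (cmod c * l2_norm M g)\<^sup>2 + 2 * Re (cnj c * l2_inner M f g)" for c
    using assms by (subst l2_norm_add_square) (auto simp: l2_norm_cmult l2_inner_cmult_right)
  have "1 \<noteq> \<i>" "-1 \<noteq> \<i>" "1 \<noteq> - \<i>" "- 1 \<noteq> - \<i>" "\<i> \<noteq> - \<i>" "(1::complex) \<noteq> -1"
    by (auto simp: complex_eq_iff)
  then show ?thesis
    unfolding * by (simp add: complex_eq_iff)
qed

text \<open>A subsequence whose increments \<open>d k\<close> have norms at most \<open>(1/2) ^ k\<close> converges almost everywhere:
  the sum of the functions \<open>2 ^ k * |d k|\<^sup>2\<close> has a finite integral, and \<open>|d k|\<close> is at most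
  \<open>(1/2) ^ k + 2 ^ k * |d k|\<^sup>2\<close>. By Fatou's lemma the pointwise limit is the limit in norm.\<close>

lemma L2_complete:
  assumes u: "\<And>n. u n \<in> L2 M"
    and cauchy: "\<And>e. e > 0 \<Longrightarrow> \<exists>N. \<forall>m\<ge>N. \<forall>n\<ge>N. l2_norm M (\<lambda>x. u m x - u n x) < e"
  shows "\<exists>g\<in>L2 M. (\<lambda>n. l2_norm M (\<lambda>x. u n x - g x)) \<longlonglongrightarrow> 0"
proof -
  have [measurable]: "u n \<in> borel_measurable M" for n
    using u by (auto dest: L2_measurable)
  have "\<exists>N. \<forall>m\<ge>N. \<forall>n\<ge>N. l2_norm M (\<lambda>x. u m x - u n x) < (1/2) ^ k" for k
    by (rule cauchy) simp
  then obtain R where R: "\<And>k m n. m \<ge> R k \<Longrightarrow> n \<ge> R k \<Longrightarrow> l2_norm M (\<lambda>x. u m x - u n x) < (1/2) ^ k"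
    by metis
  define r where "r k = (\<Sum>i\<le>k. R i)" for k
  have r1: "r k \<ge> R k" for k
    unfolding r_def by (rule member_le_sum) auto
  have r2: "r (Suc k) \<ge> r k" for k
    by (simp add: r_def)
  define d where "d k x = u (r (Suc k)) x - u (r k) x" for k x
  have d [measurable]: "d k \<in> borel_measurable M" for k
    by (simp add: d_def[abs_def])
  have dL: "d k \<in> L2 M" for k
    unfolding d_def[abs_def] using u by auto
  have dn: "l2_norm M (d k) \<le> (1/2) ^ k" for k
    unfolding d_def using R[of k "r (Suc k)" "r k"] r1[of k] r2[of k] by simp
  have "(\<integral>\<^sup>+x. (\<Sum>k. ennreal (2 ^ k * (cmod (d k x))\<^sup>2)) \<partial>M) =
      (\<Sum>k. \<integral>\<^sup>+x. ennreal (2 ^ k * (cmod (d k x))\<^sup>2) \<partial>M)"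
    by (rule nn_integral_suminf) measurable
  also have "\<dots> = (\<Sum>k. ennreal (2 ^ k * (l2_norm M (d k))\<^sup>2))"
    by (simp add: ennreal_mult nn_integral_cmult nn_integral_square_L2[OF dL])
  also have "\<dots> \<le> (\<Sum>k. ennreal ((1/2) ^ k))"
  proof (intro suminf_le ennreal_leI)
    fix k
    have "2 ^ k * (l2_norm M (d k))\<^sup>2 \<le> 2 ^ k * ((1/2) ^ k)\<^sup>2"
      by (intro mult_left_mono power_mono dn) auto
    also have "\<dots> = (1/2) ^ k"
      by (simp add: power2_eq_square power_one_over)
    finally show "2 ^ k * (l2_norm M (d k))\<^sup>2 \<le> (1/2) ^ k" .
  qed auto
  also have "\<dots> < \<infinity>"
    by (subst suminf_ennreal2) (auto intro: summable_geometric)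
  finally have "AE x in M. (\<Sum>k. ennreal (2 ^ k * (cmod (d k x))\<^sup>2)) \<noteq> \<infinity>"
    by (intro nn_integral_noteq_infinite) auto
  then have conv: "AE x in M. convergent (\<lambda>k. u (r k) x)"
  proof eventually_elim
    case (elim x)
    then have s: "summable (\<lambda>k. 2 ^ k * (cmod (d k x))\<^sup>2)"
      by (intro summable_suminf_not_top) auto
    have "summable (\<lambda>k. d k x)"
    proof (rule summable_comparison_test')
      show "summable (\<lambda>k. (1/2) ^ k + 2 ^ k * (cmod (d k x))\<^sup>2)"
        by (intro summable_add s) (simp add: summable_geometric)
      fix k
      have "2 * (1 * (2 ^ k * cmod (d k x))) \<le> 1\<^sup>2 + (2 ^ k * cmod (d k x))\<^sup>2"
        using sum_squares_bound[of 1 "2 ^ k * cmod (d k x)"] by simp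
      then have "2 ^ k * cmod (d k x) \<le> 1 + 2 ^ k * (2 ^ k * (cmod (d k x))\<^sup>2)"
        using mult_nonneg_nonneg[of "2 ^ k" "cmod (d k x)"]
        by (simp add: power_mult_distrib power2_eq_square algebra_simps del: mult_nonneg_nonneg)
      then have "(1/2) ^ k * (2 ^ k * cmod (d k x)) \<le> (1/2)^k * (1 + 2 ^ k * (2 ^ k * (cmod (d k x))\<^sup>2))"
        by (intro mult_left_mono) auto
      then show "norm (d k x) \<le> (1/2) ^ k + 2 ^ k * (cmod (d k x))\<^sup>2"
        by (simp add: power_one_over field_simps)
    qed
    then have "convergent (\<lambda>n. \<Sum>k<n. d k x)"
      by (simp add: summable_iff_convergent)
    moreover have "(\<Sum>k<n. d k x) = u (r n) x - u (r 0) x" for n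
      unfolding d_def by (rule sum_lessThan_telescope)
    ultimately have "convergent (\<lambda>n. (u (r n) x - u (r 0) x) + u (r 0) x)"
      by (intro convergent_add convergent_const) simp
    then show ?case by simp
  qed
  define g where "g x = lim (\<lambda>k. u (r k) x)" for x
  have [measurable]: "g \<in> borel_measurable M"
    unfolding g_def[abs_def] by measurable
  have lim: "AE x in M. (\<lambda>k. u (r k) x) \<longlonglongrightarrow> g x"
    using conv by eventually_elim (simp add: g_def convergent_LIMSEQ_iff)
  have bound: "(\<integral>\<^sup>+x. ennreal ((cmod (u n x - g x))\<^sup>2) \<partial>M) \<le> ennreal (((1/2) ^ k)\<^sup>2)"
    if n: "n \<ge> R k" for n k
  proof -
    have "(\<integral>\<^sup>+x. ennreal ((cmod (u n x - g x))\<^sup>2) \<partial>M) =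
        (\<integral>\<^sup>+x. liminf (\<lambda>l. ennreal ((cmod (u n x - u (r l) x))\<^sup>2)) \<partial>M)"
    proof (intro nn_integral_cong_AE)
      show "AE x in M. ennreal ((cmod (u n x - g x))\<^sup>2) =
          liminf (\<lambda>l. ennreal ((cmod (u n x - u (r l) x))\<^sup>2))"
        using lim
      proof eventually_elim
        case (elim x)
        then have "(\<lambda>l. ennreal ((cmod (u n x - u (r l) x))\<^sup>2)) \<longlonglongrightarrow> ennreal ((cmod (u n x - g x))\<^sup>2)"
          by (intro tendsto_intros tendsto_ennrealI)
        then show ?case
          by (intro lim_imp_Liminf[symmetric]) auto
      qed
    qed
    also have "\<dots> \<le> liminf (\<lambda>l. \<integral>\<^sup>+x. ennreal ((cmod (u n x - u (r l) x))\<^sup>2) \<partial>M)"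
      by (intro nn_integral_liminf) measurable
    also have "\<dots> \<le> liminf (\<lambda>l. ennreal (((1/2) ^ k)\<^sup>2))"
    proof (intro Liminf_mono eventually_sequentiallyI)
      fix l assume l: "k \<le> l"
      have "r k \<le> r l"
        using l by (rule lift_Suc_mono_le[of r, OF r2])
      then have "l2_norm M (\<lambda>x. u n x - u (r l) x) < (1/2) ^ k"
        using r1[of k] n by (intro R) auto
      then show "(\<integral>\<^sup>+x. ennreal ((cmod (u n x - u (r l) x))\<^sup>2) \<partial>M) \<le> ennreal (((1/2) ^ k)\<^sup>2)"
        using nn_integral_square_L2[OF L2_diff[OF u[of n] u[of "r l"]]]
        by (auto intro!: ennreal_leI power_mono)
    qed
    also have "\<dots> = ennreal (((1/2) ^ k)\<^sup>2)"
      by (simp add: Liminf_const)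
    finally show ?thesis .
  qed
  have diffL: "(\<lambda>x. u n x - g x) \<in> L2 M" if "n \<ge> R k" for n k
    using bound[OF that] by (auto simp: L2_iff_nn_integral intro: le_less_trans)
  have "(\<lambda>x. u (R 0) x - (u (R 0) x - g x)) \<in> L2 M"
    by (intro L2_diff u diffL[of 0]) simp
  then have gL: "g \<in> L2 M" by simp
  have "l2_norm M (\<lambda>x. u n x - g x) \<le> (1/2) ^ k" if "n \<ge> R k" for n k
  proof (rule power2_le_imp_le)
    have "ennreal ((l2_norm M (\<lambda>x. u n x - g x))\<^sup>2) \<le> ennreal (((1/2) ^ k)\<^sup>2)"
      using bound[OF that] unfolding nn_integral_square_L2[OF diffL[OF that]] .
    then show "(l2_norm M (\<lambda>x. u n x - g x))\<^sup>2 \<le> ((1/2) ^ k)\<^sup>2"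
      by (subst (asm) ennreal_le_iff) auto
  qed auto
  note small = this
  have "(\<lambda>n. l2_norm M (\<lambda>x. u n x - g x)) \<longlonglongrightarrow> 0"
  proof (rule LIMSEQ_I)
    fix e :: real assume "e > 0"
    then obtain k where k: "(1/2) ^ k < e"
      using real_arch_pow_inv[of e "1/2"] by auto
    have "norm (l2_norm M (\<lambda>x. u n x - g x) - 0) < e" if "n \<ge> R k" for n
      using small[OF that] k by simp
    then show "\<exists>N. \<forall>n\<ge>N. norm (l2_norm M (\<lambda>x. u n x - g x) - 0) < e" by blast
  qed
  with gL show ?thesis by blast
qed

section \<open>Orthonormal bases\<close>

text \<open>For orthonormal \<open>e\<close> this is the orthogonal projection onto the span of the first \<open>N\<close> vectors.\<close>

definition expansion :: "'a measure \<Rightarrow> (nat \<Rightarrow> 'a \<Rightarrow> complex) \<Rightarrow> nat \<Rightarrow> ('a \<Rightarrow> complex) \<Rightarrow> 'a \<Rightarrow> complex" where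
  "expansion M e N f x = (\<Sum>n<N. l2_inner M f (e n) * e n x)"

lemma L2_expansion: "(\<And>n. n < N \<Longrightarrow> e n \<in> L2 M) \<Longrightarrow> expansion M e N f \<in> L2 M"
  unfolding expansion_def[abs_def] by (intro L2_sum L2_cmult) auto

lemma l2_inner_expansion_left:
  assumes "\<And>n. n < N \<Longrightarrow> e n \<in> L2 M" "g \<in> L2 M"
  shows "l2_inner M (expansion M e N f) g = (\<Sum>n<N. l2_inner M f (e n) * l2_inner M (e n) g)"
  unfolding expansion_def[abs_def] using assms
  by (subst l2_inner_sum_left) (auto simp: l2_inner_cmult_left)

lemma residual_orthogonal:
  assumes e: "\<And>n. n < N \<Longrightarrow> e n \<in> L2 M" and f: "f \<in> L2 M"
    and on: "\<And>m n. m < N \<Longrightarrow> n < N \<Longrightarrow> l2_inner M (e m) (e n) = (if m = n then 1 else 0)"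
    and k: "k < N"
  shows "l2_inner M (\<lambda>x. f x - expansion M e N f x) (e k) = 0"
proof -
  have "l2_inner M (expansion M e N f) (e k) = (\<Sum>n<N. l2_inner M f (e n) * (if n = k then 1 else 0))"
    by (subst l2_inner_expansion_left) (use e k on in \<open>auto intro!: sum.cong\<close>)
  also have "\<dots> = l2_inner M f (e k)"
    using k by (simp add: if_distrib cong: if_cong)
  finally show ?thesis
    using e k f by (simp add: l2_inner_diff_left L2_expansion)
qed

text \<open>Subtracting the component along the next vector \<open>e N\<close> reduces the squared norm by the square of
  the coefficient, which is the same for the residual as for \<open>f\<close> because \<open>e N\<close> is orthogonal to the
  earlier vectors.\<close>

lemma norm_residual:
  assumes "\<And>n. n < N \<Longrightarrow> e n \<in> L2 M" and f: "f \<in> L2 M"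
    and "\<And>m n. m < N \<Longrightarrow> n < N \<Longrightarrow> l2_inner M (e m) (e n) = (if m = n then 1 else 0)"
  shows "(l2_norm M (\<lambda>x. f x - expansion M e N f x))\<^sup>2 =
    (l2_norm M f)\<^sup>2 - (\<Sum>n<N. (cmod (l2_inner M f (e n)))\<^sup>2)"
  using assms(1,3)
proof (induction N)
  case 0
  then show ?case by (simp add: expansion_def)
next
  case (Suc N)
  let ?r = "\<lambda>x. f x - expansion M e N f x" and ?c = "l2_inner M f (e N)"
  have eN: "e N \<in> L2 M" and rL: "?r \<in> L2 M"
    using Suc.prems f by (auto intro!: L2_diff L2_expansion)
  have "l2_inner M (expansion M e N f) (e N) = 0"
    using Suc.prems by (subst l2_inner_expansion_left) auto
  then have r: "l2_inner M ?r (e N) = ?c"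
    using Suc.prems f by (subst l2_inner_diff_left) (auto intro!: L2_expansion)
  have "(l2_norm M (\<lambda>x. f x - expansion M e (Suc N) f x))\<^sup>2 =
      (l2_norm M (\<lambda>x. ?r x + (- ?c) * e N x))\<^sup>2"
    by (simp add: expansion_def algebra_simps)
  also have "\<dots> = (l2_norm M ?r)\<^sup>2 + (cmod ?c * l2_norm M (e N))\<^sup>2 - 2 * Re (cnj ?c * ?c)"
    using l2_norm_add_square[OF rL L2_cmult[OF eN, of "- ?c"]] r
    unfolding l2_norm_cmult l2_inner_cmult_right by simp
  also have "Re (cnj ?c * ?c) = (cmod ?c)\<^sup>2"
    by (simp add: cmod_power2 flip: power2_eq_square)
  also have "l2_norm M (e N) = 1"
  proof -
    have "(l2_norm M (e N))\<^sup>2 = 1"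
      using Suc.prems(2)[of N N] unfolding l2_inner_self by (metis lessI of_real_eq_1_iff)
    then show ?thesis by (metis l2_norm_nonneg power2_eq_1_iff one_neq_neg_one le_minus_one_simps(3))
  qed
  also have "(l2_norm M ?r)\<^sup>2 = (l2_norm M f)\<^sup>2 - (\<Sum>n<N. (cmod (l2_inner M f (e n)))\<^sup>2)"
    using Suc by auto
  finally show ?case by simp
qed

lemma bessel:
  fixes e :: "nat \<Rightarrow> 'a \<Rightarrow> complex"
  assumes "\<And>n. n < N \<Longrightarrow> e n \<in> L2 M" "f \<in> L2 M"
    and "\<And>m n. m < N \<Longrightarrow> n < N \<Longrightarrow> l2_inner M (e m) (e n) = (if m = n then 1 else 0)"
  shows "(\<Sum>n<N. (cmod (l2_inner M f (e n)))\<^sup>2) \<le> (l2_norm M f)\<^sup>2"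
  using norm_residual[where N = N, OF assms] zero_le_power2[of "l2_norm M (\<lambda>x. f x - expansion M e N f x)"] by linarith

text \<open>By Bessel's inequality the projections form a Cauchy sequence. Its limit differs from \<open>f\<close> by
  a function that is orthogonal to the whole basis, so the limit is \<open>f\<close>.\<close>

lemma expansion_converges:
  assumes onb: "is_onb M e" and f: "f \<in> L2 M"
  shows "(\<lambda>N. l2_norm M (\<lambda>x. f x - expansion M e N f x)) \<longlonglongrightarrow> 0"
proof -
  have e: "e n \<in> L2 M" and on: "l2_inner M (e m) (e n) = (if m = n then 1 else 0)" for m n
    using onb by (auto simp: is_onb_def)
  let ?s = "\<lambda>N. expansion M e N f" and ?c = "\<lambda>n. l2_inner M f (e n)"
  have sL: "?s N \<in> L2 M" for N
    using e by (intro L2_expansion)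
  have "summable (\<lambda>n. (cmod (?c n))\<^sup>2)"
    by (rule bounded_imp_summable[of _ "(l2_norm M f)\<^sup>2"])
      (auto simp only: zero_le_power2 lessThan_Suc_atMost[symmetric] intro!: bessel e f on)
  then have c: "Cauchy (\<lambda>N. \<Sum>n<N. (cmod (?c n))\<^sup>2)"
    by (simp add: summable_iff_convergent convergent_Cauchy)
  have diff: "(l2_norm M (\<lambda>x. ?s m x - ?s n x))\<^sup>2 = \<bar>(\<Sum>k<m. (cmod (?c k))\<^sup>2) - (\<Sum>k<n. (cmod (?c k))\<^sup>2)\<bar>"
    for m n
  proof -
    have *: "(l2_norm M (\<lambda>x. ?s m x - ?s n x))\<^sup>2 = (\<Sum>k<m. (cmod (?c k))\<^sup>2) - (\<Sum>k<n. (cmod (?c k))\<^sup>2)"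
      if "n \<le> m" for m n
    proof -
      have i: "l2_inner M (?s m) (e k) = ?c k" if "k < m" for k
        using residual_orthogonal[OF e f on that] e f sL by (simp add: l2_inner_diff_left)
      then have "expansion M e n (?s m) = ?s n"
        using \<open>n \<le> m\<close> by (auto simp: expansion_def fun_eq_iff)
      then have 1: "(l2_norm M (\<lambda>x. ?s m x - ?s n x))\<^sup>2 =
          (l2_norm M (?s m))\<^sup>2 - (\<Sum>k<n. (cmod (?c k))\<^sup>2)"
        using norm_residual[OF e sL[of m] on, of n] i \<open>n \<le> m\<close> by simp
      have "expansion M e m (?s m) = ?s m"
        using i by (auto simp: expansion_def fun_eq_iff)
      then have "(l2_norm M (?s m))\<^sup>2 = (\<Sum>k<m. (cmod (?c k))\<^sup>2)"
        using norm_residual[OF e sL[of m] on, of m] i by simp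
      with 1 show ?thesis by simp
    qed
    show ?thesis
    proof (cases "n \<le> m")
      case True
      then have "0 \<le> (\<Sum>k<m. (cmod (?c k))\<^sup>2) - (\<Sum>k<n. (cmod (?c k))\<^sup>2)"
        unfolding *[OF True, symmetric] by simp
      with *[OF True] show ?thesis by simp
    next
      case False
      then have "m \<le> n" by simp
      then have "0 \<le> (\<Sum>k<n. (cmod (?c k))\<^sup>2) - (\<Sum>k<m. (cmod (?c k))\<^sup>2)"
        using *[of m n] by (simp flip: *)
      with *[OF \<open>m \<le> n\<close>] show ?thesis
        using l2_norm_minus_commute[of M "?s m" "?s n"] by simp
    qed
  qed
  have "\<exists>N. \<forall>m\<ge>N. \<forall>n\<ge>N. l2_norm M (\<lambda>x. ?s m x - ?s n x) < \<epsilon>" if "\<epsilon> > 0" for \<epsilon>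
  proof -
    have "\<epsilon>\<^sup>2 > 0" using that by simp
    then obtain N where N: "\<And>m n. m \<ge> N \<Longrightarrow> n \<ge> N \<Longrightarrow>
        norm ((\<Sum>k<m. (cmod (?c k))\<^sup>2) - (\<Sum>k<n. (cmod (?c k))\<^sup>2)) < \<epsilon>\<^sup>2"
      using CauchyD[OF c] by meson
    have "l2_norm M (\<lambda>x. ?s m x - ?s n x) < \<epsilon>" if "m \<ge> N" "n \<ge> N" for m n
      using N[OF that] diff[of m n] \<open>\<epsilon> > 0\<close> by (intro power2_less_imp_less[of _ \<epsilon>]) auto
    then show ?thesis by blast
  qed
  from L2_complete[OF sL this] obtain g where g: "g \<in> L2 M"
    and lim: "(\<lambda>n. l2_norm M (\<lambda>x. ?s n x - g x)) \<longlonglongrightarrow> 0"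
    by blast
  have "l2_inner M (\<lambda>x. f x - g x) (e k) = 0" for k
  proof -
    have "(\<lambda>n. l2_inner M (?s n) (e k)) \<longlonglongrightarrow> l2_inner M g (e k)"
      by (rule tendsto_l2_inner[OF sL g e e lim]) simp
    moreover have "(\<lambda>n. l2_inner M (?s n) (e k)) \<longlonglongrightarrow> ?c k"
    proof (rule tendsto_eventually, rule eventually_sequentiallyI[of "Suc k"])
      fix n assume "Suc k \<le> n"
      then show "l2_inner M (?s n) (e k) = ?c k"
        using residual_orthogonal[OF e f on, of k n] e f sL by (simp add: l2_inner_diff_left)
    qed
    ultimately have "l2_inner M g (e k) = ?c k" by (rule LIMSEQ_unique)
    then show ?thesis using e f g by (simp add: l2_inner_diff_left)
  qed
  then have "AE x in M. f x - g x = 0"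
    using onb L2_diff[OF f g] unfolding is_onb_def by blast
  then have "l2_norm M (\<lambda>x. f x - ?s n x) = l2_norm M (\<lambda>x. ?s n x - g x)" for n
    using f g sL by (subst l2_norm_minus_commute) (intro l2_norm_cong_AE, auto)
  with lim show ?thesis by simp
qed

theorem parseval:
  assumes onb: "is_onb M e" and f: "f \<in> L2 M"
  shows "(\<lambda>n. (cmod (l2_inner M f (e n)))\<^sup>2) sums (l2_norm M f)\<^sup>2"
proof -
  have e: "e n \<in> L2 M" and on: "l2_inner M (e m) (e n) = (if m = n then 1 else 0)" for m n
    using onb by (auto simp: is_onb_def)
  have "(\<lambda>N. (l2_norm M f)\<^sup>2 - (l2_norm M (\<lambda>x. f x - expansion M e N f x))\<^sup>2) \<longlonglongrightarrow> (l2_norm M f)\<^sup>2 - 0\<^sup>2"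
    by (intro tendsto_intros expansion_converges onb f)
  then show ?thesis
    by (simp add: sums_def norm_residual[OF e f on])
qed

text \<open>Gram-Schmidt that skips linearly dependent vectors: the next basis vector is the
  normalised residual of the first \<open>v m\<close> whose residual does not vanish. Such an \<open>m\<close> always exists, because
  \<open>k\<close> orthonormal vectors that span all \<open>v n\<close> would contradict Bessel's inequality for the \<open>k + 1\<close>
  orthonormal vectors \<open>b 0, \<dots>, b k\<close>. Keeping the basis inside a given subspace \<open>V\<close> makes it
  possible to prove statements about all of L2 by verifying them on \<open>V\<close>.\<close>

theorem onb_exists:
  assumes V: "V \<subseteq> L2 M" "\<And>f g. f \<in> V \<Longrightarrow> g \<in> V \<Longrightarrow> (\<lambda>x. f x + g x) \<in> V"
      "\<And>c f. f \<in> V \<Longrightarrow> (\<lambda>x. c * f x) \<in> V"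
    and v: "\<And>n::nat. v n \<in> V"
    and total: "\<And>f. f \<in> L2 M \<Longrightarrow> (\<And>n. l2_inner M f (v n) = 0) \<Longrightarrow> AE x in M. f x = 0"
    and b: "\<And>n::nat. b n \<in> L2 M" "\<And>m n. l2_inner M (b m) (b n) = (if m = n then 1 else 0)"
  shows "\<exists>e. is_onb M e \<and> (\<forall>n. e n \<in> V)"
proof -
  let ?res = "\<lambda>e k f x. f x - expansion M e k f x"
  define P where "P e k r \<longleftrightarrow> r \<in> V \<and> l2_norm M r = 1 \<and> (\<forall>i<k. l2_inner M r (e i) = 0) \<and>
      (\<exists>m. r = (\<lambda>x. complex_of_real (1 / l2_norm M (?res e k (v m))) * ?res e k (v m) x) \<and>
        (\<forall>m'<m. l2_norm M (?res e k (v m')) = 0))" for e k r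
  have expV: "?res e k f \<in> V" if "f \<in> V" "\<And>n. n < k \<Longrightarrow> e n \<in> V" for e k f
    using that(2)
  proof (induction k)
    case 0
    then show ?case using that(1) by (simp add: expansion_def)
  next
    case (Suc k)
    have "(\<lambda>x. ?res e k f x + (- l2_inner M f (e k)) * e k x) \<in> V"
      by (intro V(2,3) Suc) auto
    then show ?case by (simp add: expansion_def algebra_simps)
  qed
  have orth: "l2_inner M (e m) (e n) = (if m = n then 1 else 0)"
    if P: "\<And>n. n < k \<Longrightarrow> P e n (e n)" and "m < k" "n < k" for e k m n
  proof -
    consider "m = n" | "m < n" | "n < m" by linarith
    then show ?thesis
    proof cases
      case 1
      then show ?thesis using P[OF \<open>m < k\<close>] by (simp add: P_def l2_inner_self)
    next
      case 2
      then have "l2_inner M (e n) (e m) = 0" using P[OF \<open>n < k\<close>] by (simp add: P_def)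
      then show ?thesis using 2 by (subst l2_inner_commute) simp
    next
      case 3
      then show ?thesis using P[OF \<open>m < k\<close>] by (simp add: P_def)
    qed
  qed
  have "\<exists>e. \<forall>k. P e k (e k)"
  proof (rule dependent_wellorder_choice)
    fix r :: "'a \<Rightarrow> complex" and e e' :: "nat \<Rightarrow> 'a \<Rightarrow> complex" and k
    assume "\<And>n. n < k \<Longrightarrow> e n = e' n"
    then have "expansion M e k f = expansion M e' k f" for f
      by (auto simp: expansion_def intro!: ext sum.cong)
    then show "P e k r = P e' k r"
      using \<open>\<And>n. n < k \<Longrightarrow> e n = e' n\<close> by (simp add: P_def)
  next
    fix k and e :: "nat \<Rightarrow> 'a \<Rightarrow> complex"
    assume Pe: "\<And>n. n < k \<Longrightarrow> P e n (e n)"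
    then have eV: "e n \<in> V" if "n < k" for n
      using that by (simp add: P_def)
    then have e: "e n \<in> L2 M" if "n < k" for n
      using that V(1) by auto
    have on: "l2_inner M (e m) (e n) = (if m = n then 1 else 0)" if "m < k" "n < k" for m n
      by (rule orth[OF Pe that])
    have vL: "v n \<in> L2 M" for n
      using v V(1) by auto
    have "\<exists>m. l2_norm M (?res e k (v m)) \<noteq> 0"
    proof (rule ccontr)
      assume "\<not> ?thesis"
      then have 0: "l2_norm M (?res e k (v m)) = 0" for m by auto
      have norm: "(\<Sum>n<k. (cmod (l2_inner M f (e n)))\<^sup>2) = (l2_norm M f)\<^sup>2" if f: "f \<in> L2 M" for f
      proof -
        have rL: "?res e k f \<in> L2 M"
          using f e by (intro L2_diff L2_expansion)
        have "AE x in M. ?res e k f x = 0"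
        proof (rule total[OF rL])
          fix m
          have "AE x in M. ?res e k (v m) x = 0"
            using 0[of m] vL e by (subst (asm) l2_norm_eq_0_iff) (auto intro!: L2_diff L2_expansion)
          then have "AE x in M. v m x = expansion M e k (v m) x"
            by eventually_elim simp
          then have "l2_inner M (?res e k f) (v m) = l2_inner M (?res e k f) (expansion M e k (v m))"
            using rL vL e by (intro l2_inner_cong_AE) (auto intro!: L2_expansion)
          also have "\<dots> = cnj (\<Sum>n<k. l2_inner M (v m) (e n) * cnj (l2_inner M (?res e k f) (e n)))"
            using e rL by (subst l2_inner_commute, subst l2_inner_expansion_left)
              (auto simp: l2_inner_commute[of M "e _"])
          also have "\<dots> = 0"
            using residual_orthogonal[OF e f on] by simp
          finally show "l2_inner M (?res e k f) (v m) = 0" .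
        qed
        then have "l2_norm M (?res e k f) = 0"
          using rL by (simp add: l2_norm_eq_0_iff)
        then show ?thesis
          using norm_residual[where N = k, OF e f on] by simp
      qed
      have b1: "(l2_norm M (b j))\<^sup>2 = 1" for j
        using b(2)[of j j] unfolding l2_inner_self by (metis of_real_eq_1_iff)
      have e1: "(l2_norm M (e i))\<^sup>2 = 1" if "i < k" for i
        using Pe[OF that] by (simp add: P_def)
      have "real (Suc k) = (\<Sum>j<Suc k. (l2_norm M (b j))\<^sup>2)"
        by (simp add: b1)
      also have "\<dots> = (\<Sum>j<Suc k. \<Sum>i<k. (cmod (l2_inner M (b j) (e i)))\<^sup>2)"
        by (intro sum.cong refl norm[symmetric] b)
      also have "\<dots> = (\<Sum>i<k. \<Sum>j<Suc k. (cmod (l2_inner M (e i) (b j)))\<^sup>2)"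
        by (subst sum.swap, subst l2_inner_commute) simp
      also have "\<dots> \<le> (\<Sum>i<k. (l2_norm M (e i))\<^sup>2)"
        by (intro sum_mono bessel b e) auto
      also have "\<dots> = real k" by (simp add: e1)
      finally show False by simp
    qed
    then obtain m where m: "l2_norm M (?res e k (v m)) \<noteq> 0"
        "\<And>m'. m' < m \<Longrightarrow> l2_norm M (?res e k (v m')) = 0"
      using exists_least_iff[of "\<lambda>m. l2_norm M (?res e k (v m)) \<noteq> 0"] by auto
    define r where "r x = complex_of_real (1 / l2_norm M (?res e k (v m))) * ?res e k (v m) x" for x
    have "P e k r"
      unfolding P_def
    proof (intro conjI allI impI exI[of _ m])
      show "r \<in> V"
        unfolding r_def[abs_def] by (intro V(3) expV v eV)
      show "l2_norm M r = 1"
        unfolding r_def[abs_def] l2_norm_cmult using m(1) by (simp add: norm_divide)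
      show "l2_inner M r (e i) = 0" if "i < k" for i
        unfolding r_def[abs_def] l2_inner_cmult_left
        using residual_orthogonal[where N = k, OF e vL on that] by simp
    qed (use m in \<open>auto simp: r_def[abs_def]\<close>)
    then show "\<exists>r. P e k r" by (rule exI[of _ r])
  qed
  then obtain e where Pe: "\<And>k. P e k (e k)" by blast
  have eV: "e n \<in> V" for n
    using Pe[of n] by (simp add: P_def)
  then have e: "e n \<in> L2 M" for n
    using V(1) by auto
  have on: "l2_inner M (e m) (e n) = (if m = n then 1 else 0)" for m n
    by (rule orth[of "Suc (max m n)"]) (auto simp: Pe)
  have vL: "v n \<in> L2 M" for n
    using v V(1) by auto
  \<comment> \<open>Residuals decrease, so once a vector is used up it stays in the span.\<close>
  have mono: "l2_norm M (?res e k' (v m)) = 0" if "l2_norm M (?res e k (v m)) = 0" "k \<le> k'" for k k' m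
  proof -
    have "(\<Sum>n<k. (cmod (l2_inner M (v m) (e n)))\<^sup>2) \<le> (\<Sum>n<k'. (cmod (l2_inner M (v m) (e n)))\<^sup>2)"
      using that(2) by (intro sum_mono2) auto
    then have "(l2_norm M (?res e k' (v m)))\<^sup>2 \<le> (l2_norm M (?res e k (v m)))\<^sup>2"
      by (simp add: norm_residual[OF e vL on])
    with that(1) show ?thesis by simp
  qed
  have used: "\<exists>k. l2_norm M (?res e k (v m)) = 0" for m
  proof (induction m rule: less_induct)
    case (less m)
    then obtain K where K: "\<And>m'. m' < m \<Longrightarrow> l2_norm M (?res e (K m') (v m')) = 0"
      by metis
    define k where "k = (\<Sum>m'<m. K m')"
    have k: "l2_norm M (?res e k (v m')) = 0" if "m' < m" for m'
      by (rule mono[OF K[OF that]]) (use that in \<open>auto simp: k_def intro!: member_le_sum\<close>)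
    obtain l where l: "e k = (\<lambda>x. complex_of_real (1 / l2_norm M (?res e k (v l))) * ?res e k (v l) x)"
      and l': "\<And>m'. m' < l \<Longrightarrow> l2_norm M (?res e k (v m')) = 0"
      using Pe[of k] by (auto simp: P_def)
    have e1: "l2_norm M (e k) = 1"
      using Pe[of k] by (simp add: P_def)
    have "l2_norm M (?res e k (v l)) \<noteq> 0"
    proof
      assume "l2_norm M (?res e k (v l)) = 0"
      then have "e k = (\<lambda>x. 0)" by (subst l) simp
      with e1 show False by simp
    qed
    then have "m \<le> l" using k by (meson not_le)
    show ?case
    proof (cases "m = l")
      case False
      with \<open>m \<le> l\<close> have "m < l" by simp
      then show ?thesis by (intro exI[of _ k] l')
    next
      case True
      let ?n = "l2_norm M (?res e k (v m))"
      have rL: "?res e k (v m) \<in> L2 M"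
        using vL e by (intro L2_diff L2_expansion)
      have "l2_inner M (expansion M e k (v m)) (e k) = 0"
        using e by (subst l2_inner_expansion_left) (auto simp: on)
      then have "l2_inner M (v m) (e k) = l2_inner M (?res e k (v m)) (e k)"
        using vL e by (simp add: l2_inner_diff_left L2_expansion)
      also have "\<dots> = complex_of_real (1 / ?n) * complex_of_real (?n\<^sup>2)"
        by (subst l, simp only: True[symmetric] l2_inner_cmult_right l2_inner_self)
           (simp add: True)
      finally have "cmod (l2_inner M (v m) (e k)) = ?n"
        by (simp add: power2_eq_square norm_mult norm_divide)
      then have "(l2_norm M (?res e (Suc k) (v m)))\<^sup>2 = 0"
        using norm_residual[where N = "Suc k", OF e vL[of m] on] norm_residual[where N = k, OF e vL[of m] on]
        by simp
      then show ?thesis by (intro exI[of _ "Suc k"]) simp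
    qed
  qed
  have "AE x in M. f x = 0" if f: "f \<in> L2 M" and f0: "\<And>n. l2_inner M f (e n) = 0" for f
  proof (rule total[OF f])
    fix m
    obtain k where "l2_norm M (?res e k (v m)) = 0" using used by blast
    then have "AE x in M. ?res e k (v m) x = 0"
      using vL e by (subst (asm) l2_norm_eq_0_iff) (auto intro!: L2_diff L2_expansion)
    then have "AE x in M. v m x = expansion M e k (v m) x"
      by eventually_elim simp
    then have "l2_inner M f (v m) = l2_inner M f (expansion M e k (v m))"
      using f vL e by (intro l2_inner_cong_AE) (auto intro!: L2_expansion)
    also have "\<dots> = cnj (\<Sum>n<k. l2_inner M (v m) (e n) * cnj (l2_inner M f (e n)))"
      using e f by (subst l2_inner_commute, subst l2_inner_expansion_left)
        (auto simp: l2_inner_commute[of M "e _"])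
    finally show "l2_inner M f (v m) = 0" by (simp add: f0)
  qed
  then have "is_onb M e"
    using e on by (simp add: is_onb_def)
  with eV show ?thesis by blast
qed

section \<open>Operators given by square integrable kernels\<close>

definition kernel_op :: "'a measure \<Rightarrow> ('a \<times> 'a \<Rightarrow> complex) \<Rightarrow> 'a l2op" where
  "kernel_op M K \<phi> x = (LINT y|M. K (x, y) * \<phi> y)"

definition adjoint_kernel :: "('a \<times> 'a \<Rightarrow> complex) \<Rightarrow> 'a \<times> 'a \<Rightarrow> complex" where
  "adjoint_kernel K = (\<lambda>(x, y). cnj (K (y, x)))"

text \<open>Operators obtained by a choice are known only through their values on L2, up to null sets. Their
  Hilbert-Schmidt norm, adjoint and trace depend on nothing else, so this relation determines them.\<close>

definition has_kernel :: "'a measure \<Rightarrow> 'a l2op \<Rightarrow> ('a \<times> 'a \<Rightarrow> complex) \<Rightarrow> bool" where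
  "has_kernel M T K \<longleftrightarrow> (\<forall>\<phi>\<in>L2 M. T \<phi> \<in> L2 M \<and> (AE x in M. T \<phi> x = kernel_op M K \<phi> x))"

lemma is_onb_L2: "is_onb M e \<Longrightarrow> e n \<in> L2 M"
  by (simp add: is_onb_def)

lemma is_onb_cnj:
  assumes "is_onb M e"
  shows "is_onb M (\<lambda>n x. cnj (e n x))"
proof -
  have *: "l2_inner M f (\<lambda>x. cnj (g x)) = cnj (l2_inner M (\<lambda>x. cnj (f x)) g)" for f g
    unfolding l2_inner_def Bochner_Integration.integral_cnj[symmetric] by simp
  show ?thesis
    unfolding is_onb_def
  proof (intro conjI allI ballI impI)
    fix f assume f: "f \<in> L2 M" "\<forall>n. l2_inner M f (\<lambda>x. cnj (e n x)) = 0"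
    then have "\<forall>n. l2_inner M (\<lambda>x. cnj (f x)) (e n) = 0"
      by (simp add: *)
    then have "AE x in M. cnj (f x) = 0"
      using assms L2_cnj[OF f(1)] unfolding is_onb_def by blast
    then show "AE x in M. f x = 0" by simp
  qed (use assms in \<open>auto simp: is_onb_def *\<close>)
qed

context
  fixes M :: "'a measure"
  assumes sf: "sigma_finite_measure M"
begin

interpretation pair_sigma_finite M M
  using sf by (simp add: pair_sigma_finite_def)

interpretation sigma_finite_measure M by (rule sf)

lemma nn_integral_sections:
  assumes [measurable]: "K \<in> borel_measurable (M \<Otimes>\<^sub>M M)"
  shows "(\<integral>\<^sup>+x. \<integral>\<^sup>+y. ennreal ((cmod (K (x, y)))\<^sup>2) \<partial>M \<partial>M) =
    (\<integral>\<^sup>+z. ennreal ((cmod (K z))\<^sup>2) \<partial>(M \<Otimes>\<^sub>M M))"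
  by (subst sigma_finite_measure.nn_integral_fst[OF sf, symmetric]) measurable

lemma AE_section_L2:
  assumes K: "K \<in> L2 (M \<Otimes>\<^sub>M M)"
  shows "AE x in M. (\<lambda>y. K (x, y)) \<in> L2 M"
proof -
  have [measurable]: "K \<in> borel_measurable (M \<Otimes>\<^sub>M M)" using K by (rule L2_measurable)
  have "(\<integral>\<^sup>+x. \<integral>\<^sup>+y. ennreal ((cmod (K (x, y)))\<^sup>2) \<partial>M \<partial>M) \<noteq> \<infinity>"
    using K by (simp add: nn_integral_sections nn_integral_square_L2)
  then have "AE x in M. (\<integral>\<^sup>+y. ennreal ((cmod (K (x, y)))\<^sup>2) \<partial>M) \<noteq> \<infinity>"
    by (intro nn_integral_noteq_infinite) measurable
  then show ?thesis
    using AE_space by eventually_elim (auto simp: L2_iff_nn_integral less_top)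
qed

lemma kernel_op_measurable:
  assumes "K \<in> borel_measurable (M \<Otimes>\<^sub>M M)" "\<phi> \<in> borel_measurable M"
  shows "kernel_op M K \<phi> \<in> borel_measurable M"
proof -
  have [measurable]: "K \<in> borel_measurable (M \<Otimes>\<^sub>M M)" "\<phi> \<in> borel_measurable M"
    by fact+
  show ?thesis unfolding kernel_op_def[abs_def] by measurable
qed

lemma kernel_op_eq_inner: "kernel_op M K \<phi> x = l2_inner M (\<lambda>y. K (x, y)) (\<lambda>y. cnj (\<phi> y))"
  by (simp add: kernel_op_def l2_inner_def)

text \<open>Cauchy-Schwarz in the second variable for almost every value of the first.\<close>

lemma kernel_op_L2:
  assumes K: "K \<in> L2 (M \<Otimes>\<^sub>M M)" and \<phi>: "\<phi> \<in> L2 M"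
  shows "kernel_op M K \<phi> \<in> L2 M"
    and "l2_norm M (kernel_op M K \<phi>) \<le> l2_norm (M \<Otimes>\<^sub>M M) K * l2_norm M \<phi>"
proof -
  have [measurable]: "K \<in> borel_measurable (M \<Otimes>\<^sub>M M)" using K by (rule L2_measurable)
  have m [measurable]: "kernel_op M K \<phi> \<in> borel_measurable M"
    using K \<phi> by (intro kernel_op_measurable L2_measurable)
  have "(\<integral>\<^sup>+x. ennreal ((cmod (kernel_op M K \<phi> x))\<^sup>2) \<partial>M) \<le>
     (\<integral>\<^sup>+x. (\<integral>\<^sup>+y. ennreal ((cmod (K (x, y)))\<^sup>2) \<partial>M) * ennreal ((l2_norm M \<phi>)\<^sup>2) \<partial>M)"
  proof (rule nn_integral_mono_AE)
    show "AE x in M. ennreal ((cmod (kernel_op M K \<phi> x))\<^sup>2) \<le>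
        (\<integral>\<^sup>+y. ennreal ((cmod (K (x, y)))\<^sup>2) \<partial>M) * ennreal ((l2_norm M \<phi>)\<^sup>2)"
      using AE_section_L2[OF K]
    proof eventually_elim
      case (elim x)
      have "cmod (kernel_op M K \<phi> x) \<le> l2_norm M (\<lambda>y. K (x, y)) * l2_norm M \<phi>"
        using l2_cauchy_schwarz[OF elim L2_cnj[OF \<phi>]]
        by (simp add: kernel_op_eq_inner l2_norm_def)
      then have "(cmod (kernel_op M K \<phi> x))\<^sup>2 \<le> (l2_norm M (\<lambda>y. K (x, y)) * l2_norm M \<phi>)\<^sup>2"
        by (intro power_mono) auto
      then show ?case
        unfolding nn_integral_square_L2[OF elim]
        by (simp add: power_mult_distrib flip: ennreal_mult)
    qed
  qed
  also have "\<dots> = (\<integral>\<^sup>+x. \<integral>\<^sup>+y. ennreal ((cmod (K (x, y)))\<^sup>2) \<partial>M \<partial>M) * ennreal ((l2_norm M \<phi>)\<^sup>2)"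
    by (rule nn_integral_multc) measurable
  also have "\<dots> = ennreal ((l2_norm (M \<Otimes>\<^sub>M M) K * l2_norm M \<phi>)\<^sup>2)"
    using K by (simp add: nn_integral_sections nn_integral_square_L2 power_mult_distrib ennreal_mult)
  finally have *: "(\<integral>\<^sup>+x. ennreal ((cmod (kernel_op M K \<phi> x))\<^sup>2) \<partial>M) \<le>
      ennreal ((l2_norm (M \<Otimes>\<^sub>M M) K * l2_norm M \<phi>)\<^sup>2)" .
  then show L: "kernel_op M K \<phi> \<in> L2 M"
    using m by (auto simp: L2_iff_nn_integral intro: le_less_trans)
  from * have "(l2_norm M (kernel_op M K \<phi>))\<^sup>2 \<le> (l2_norm (M \<Otimes>\<^sub>M M) K * l2_norm M \<phi>)\<^sup>2"
    unfolding nn_integral_square_L2[OF L] by (subst (asm) ennreal_le_iff) auto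
  then show "l2_norm M (kernel_op M K \<phi>) \<le> l2_norm (M \<Otimes>\<^sub>M M) K * l2_norm M \<phi>"
    by (rule power2_le_imp_le) simp
qed

lemma kernel_op_add:
  assumes "K \<in> L2 (M \<Otimes>\<^sub>M M)" "L \<in> L2 (M \<Otimes>\<^sub>M M)" "\<phi> \<in> L2 M"
  shows "AE x in M. kernel_op M (\<lambda>z. K z + c * L z) \<phi> x = kernel_op M K \<phi> x + c * kernel_op M L \<phi> x"
  using AE_section_L2[OF assms(1)] AE_section_L2[OF assms(2)]
proof eventually_elim
  case (elim x)
  from elim[THEN L2_mult_integrable[OF _ assms(3)]] show ?case
    by (simp add: kernel_op_def ring_distribs mult.assoc)
qed

lemma bounded_op_kernel:
  assumes K: "K \<in> L2 (M \<Otimes>\<^sub>M M)"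
  shows "bounded_op M (kernel_op M K)"
  unfolding bounded_op_def
proof (intro conjI ballI allI)
  fix f g assume f: "f \<in> L2 M" and g: "g \<in> L2 M"
  show "AE x in M. kernel_op M K (\<lambda>y. f y + g y) x = kernel_op M K f x + kernel_op M K g x"
    using AE_section_L2[OF K]
  proof eventually_elim
    case (elim x)
    with f g show ?case
      by (simp add: kernel_op_def distrib_left L2_mult_integrable)
  qed
next
  fix c f
  show "AE x in M. kernel_op M K (\<lambda>y. c * f y) x = c * kernel_op M K f x"
    by (simp add: kernel_op_def mult.left_commute)
next
  show "\<exists>C. \<forall>f\<in>L2 M. l2_norm M (kernel_op M K f) \<le> C * l2_norm M f"
    using kernel_op_L2(2)[OF K] by blast
qed (rule kernel_op_L2(1)[OF K])

text \<open>Parseval in the second variable, for the conjugate basis, and monotone convergence.\<close>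

lemma kernel_op_onb_sums:
  assumes K: "K \<in> L2 (M \<Otimes>\<^sub>M M)" and e: "is_onb M e"
  shows "(\<lambda>n. (l2_norm M (kernel_op M K (e n)))\<^sup>2) sums (l2_norm (M \<Otimes>\<^sub>M M) K)\<^sup>2"
proof -
  have [measurable]: "K \<in> borel_measurable (M \<Otimes>\<^sub>M M)" using K by (rule L2_measurable)
  have eL: "e n \<in> L2 M" for n by (rule is_onb_L2[OF e])
  have [measurable]: "kernel_op M K (e n) \<in> borel_measurable M" for n
    by (intro kernel_op_measurable L2_measurable K eL)
  have "(\<Sum>n. ennreal ((l2_norm M (kernel_op M K (e n)))\<^sup>2)) =
      (\<Sum>n. \<integral>\<^sup>+x. ennreal ((cmod (kernel_op M K (e n) x))\<^sup>2) \<partial>M)"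
    by (simp add: nn_integral_square_L2 kernel_op_L2(1)[OF K eL])
  also have "\<dots> = (\<integral>\<^sup>+x. (\<Sum>n. ennreal ((cmod (kernel_op M K (e n) x))\<^sup>2)) \<partial>M)"
    by (rule nn_integral_suminf[symmetric]) measurable
  also have "\<dots> = (\<integral>\<^sup>+x. \<integral>\<^sup>+y. ennreal ((cmod (K (x, y)))\<^sup>2) \<partial>M \<partial>M)"
  proof (intro nn_integral_cong_AE)
    show "AE x in M. (\<Sum>n. ennreal ((cmod (kernel_op M K (e n) x))\<^sup>2)) =
        (\<integral>\<^sup>+y. ennreal ((cmod (K (x, y)))\<^sup>2) \<partial>M)"
      using AE_section_L2[OF K]
    proof eventually_elim
      case (elim x)
      show ?case
        unfolding nn_integral_square_L2[OF elim] kernel_op_eq_inner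
        by (rule suminf_ennreal_eq) (auto intro!: parseval is_onb_cnj e elim)
    qed
  qed
  also have "\<dots> = ennreal ((l2_norm (M \<Otimes>\<^sub>M M) K)\<^sup>2)"
    using K by (simp add: nn_integral_sections nn_integral_square_L2)
  finally have *: "(\<Sum>n. ennreal ((l2_norm M (kernel_op M K (e n)))\<^sup>2)) = ennreal ((l2_norm (M \<Otimes>\<^sub>M M) K)\<^sup>2)" .
  then have "summable (\<lambda>n. (l2_norm M (kernel_op M K (e n)))\<^sup>2)"
    by (intro summable_suminf_not_top) auto
  then have "ennreal (\<Sum>n. (l2_norm M (kernel_op M K (e n)))\<^sup>2) = ennreal ((l2_norm (M \<Otimes>\<^sub>M M) K)\<^sup>2)"
    using * by (subst (asm) suminf_ennreal2) auto
  then have "(\<Sum>n. (l2_norm M (kernel_op M K (e n)))\<^sup>2) = (l2_norm (M \<Otimes>\<^sub>M M) K)\<^sup>2"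
    using \<open>summable _\<close> by (subst (asm) ennreal_inj) (auto intro: suminf_nonneg)
  with \<open>summable _\<close> show ?thesis
    by (metis summable_sums)
qed

lemma kernel_op_inner_sums:
  assumes K: "K \<in> L2 (M \<Otimes>\<^sub>M M)" and L: "L \<in> L2 (M \<Otimes>\<^sub>M M)" and e: "is_onb M e"
  shows "(\<lambda>n. l2_inner M (kernel_op M K (e n)) (kernel_op M L (e n))) sums l2_inner (M \<Otimes>\<^sub>M M) K L"
proof -
  have eL: "e n \<in> L2 M" for n by (rule is_onb_L2[OF e])
  have KL: "(\<lambda>z. K z + c * L z) \<in> L2 (M \<Otimes>\<^sub>M M)" for c
    using K L by auto
  have *: "l2_norm M (\<lambda>x. kernel_op M K (e n) x + c * kernel_op M L (e n) x) =
      l2_norm M (kernel_op M (\<lambda>z. K z + c * L z) (e n))" for c n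
    using kernel_op_add[OF K L eL[of n], of c]
    by (intro l2_norm_cong_AE) (auto intro!: L2_measurable kernel_op_L2 K L KL eL L2_add L2_cmult)
  show ?thesis
    unfolding l2_polarization[OF K L] l2_polarization[OF kernel_op_L2(1)[OF K eL] kernel_op_L2(1)[OF L eL]] *
    by (intro sums_divide sums_sum sums_mult sums_of_real kernel_op_onb_sums KL e)
qed

lemma L2_product:
  assumes "\<phi> \<in> L2 M" "\<psi> \<in> L2 M"
  shows "(\<lambda>(x, y). \<phi> x * \<psi> y) \<in> L2 (M \<Otimes>\<^sub>M M)"
proof -
  have [measurable]: "\<phi> \<in> borel_measurable M" "\<psi> \<in> borel_measurable M"
    using assms by (auto dest: L2_measurable)
  have "(\<integral>\<^sup>+z. ennreal ((cmod (case z of (x, y) \<Rightarrow> \<phi> x * \<psi> y))\<^sup>2) \<partial>(M \<Otimes>\<^sub>M M)) =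
      (\<integral>\<^sup>+x. \<integral>\<^sup>+y. ennreal ((cmod (\<phi> x))\<^sup>2) * ennreal ((cmod (\<psi> y))\<^sup>2) \<partial>M \<partial>M)"
    by (subst sigma_finite_measure.nn_integral_fst[OF sf, symmetric]) (auto simp: norm_mult power_mult_distrib ennreal_mult)
  also have "\<dots> = ennreal ((l2_norm M \<phi>)\<^sup>2) * ennreal ((l2_norm M \<psi>)\<^sup>2)"
    using assms by (simp add: nn_integral_cmult nn_integral_multc nn_integral_square_L2)
  also have "\<dots> < \<infinity>"
    by (simp add: ennreal_mult_less_top)
  finally show ?thesis
    by (simp add: L2_iff_nn_integral)
qed

lemma l2_inner_kernel_op:
  assumes K: "K \<in> L2 (M \<Otimes>\<^sub>M M)" and \<phi>: "\<phi> \<in> L2 M" and \<psi>: "\<psi> \<in> L2 M"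
  shows "l2_inner M (kernel_op M K \<phi>) \<psi> = l2_inner (M \<Otimes>\<^sub>M M) K (\<lambda>(x, y). \<psi> x * cnj (\<phi> y))"
proof -
  have P: "(\<lambda>(x, y). \<psi> x * cnj (\<phi> y)) \<in> L2 (M \<Otimes>\<^sub>M M)"
    using L2_product[OF \<psi> L2_cnj[OF \<phi>]] by simp
  let ?h = "\<lambda>z. K z * \<phi> (snd z) * cnj (\<psi> (fst z))"
  have h: "K z * cnj (case z of (x, y) \<Rightarrow> \<psi> x * cnj (\<phi> y)) = ?h z" for z
    by (simp add: case_prod_unfold mult_ac)
  have "l2_inner (M \<Otimes>\<^sub>M M) K (\<lambda>(x, y). \<psi> x * cnj (\<phi> y)) = integral\<^sup>L (M \<Otimes>\<^sub>M M) ?h"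
    by (simp only: l2_inner_def h)
  also have "\<dots> = (LINT x|M. LINT y|M. ?h (x, y))"
    using L2_inner_integrable[OF K P] by (intro integral_fst'[symmetric]) (simp only: h)
  also have "\<dots> = l2_inner M (kernel_op M K \<phi>) \<psi>"
    by (simp add: l2_inner_def kernel_op_def)
  finally show ?thesis ..
qed

lemma l2_inner_swap:
  "f \<in> L2 (M \<Otimes>\<^sub>M M) \<Longrightarrow> g \<in> L2 (M \<Otimes>\<^sub>M M) \<Longrightarrow>
    l2_inner (M \<Otimes>\<^sub>M M) (\<lambda>(x, y). f (y, x)) (\<lambda>(x, y). g (y, x)) = l2_inner (M \<Otimes>\<^sub>M M) f g"
  using integral_product_swap[of "\<lambda>z. f z * cnj (g z)"] L2_measurable[of f] L2_measurable[of g]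
  by (simp add: l2_inner_def case_prod_unfold)

lemma adjoint_kernel_L2:
  assumes "K \<in> L2 (M \<Otimes>\<^sub>M M)"
  shows "adjoint_kernel K \<in> L2 (M \<Otimes>\<^sub>M M)"
proof -
  have [measurable]: "K \<in> borel_measurable (M \<Otimes>\<^sub>M M)" using assms by (rule L2_measurable)
  have "integrable (M \<Otimes>\<^sub>M M) (\<lambda>(x, y). (cmod (K (y, x)))\<^sup>2)"
    using integrable_product_swap[OF L2_square_integrable[OF assms]] by simp
  then show ?thesis
    by (simp add: L2_def adjoint_kernel_def case_prod_unfold)
qed

lemma l2_inner_adjoint_kernel:
  assumes "K \<in> L2 (M \<Otimes>\<^sub>M M)" "L \<in> L2 (M \<Otimes>\<^sub>M M)"
  shows "l2_inner (M \<Otimes>\<^sub>M M) (adjoint_kernel K) (adjoint_kernel L) = l2_inner (M \<Otimes>\<^sub>M M) L K"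
proof -
  have "l2_inner (M \<Otimes>\<^sub>M M) (adjoint_kernel K) (adjoint_kernel L) =
      l2_inner (M \<Otimes>\<^sub>M M) (\<lambda>(x, y). L (y, x)) (\<lambda>(x, y). K (y, x))"
    by (simp add: l2_inner_def adjoint_kernel_def case_prod_beta mult.commute)
  then show ?thesis using l2_inner_swap[OF assms(2,1)] by simp
qed

lemma kernel_op_adjoint:
  assumes K: "K \<in> L2 (M \<Otimes>\<^sub>M M)" and \<phi>: "\<phi> \<in> L2 M" and \<psi>: "\<psi> \<in> L2 M"
  shows "l2_inner M (kernel_op M K \<phi>) \<psi> = l2_inner M \<phi> (kernel_op M (adjoint_kernel K) \<psi>)"
proof -
  have P: "(\<lambda>(x, y). \<phi> x * cnj (\<psi> y)) \<in> L2 (M \<Otimes>\<^sub>M M)"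
    using L2_product[OF \<phi> L2_cnj[OF \<psi>]] by simp
  have Q: "(\<lambda>(x, y). \<psi> x * cnj (\<phi> y)) = adjoint_kernel (\<lambda>(x, y). \<phi> x * cnj (\<psi> y))"
    by (auto simp: adjoint_kernel_def)
  have A: "adjoint_kernel (adjoint_kernel K) = K" by (auto simp: adjoint_kernel_def)
  have "l2_inner M \<phi> (kernel_op M (adjoint_kernel K) \<psi>) =
      cnj (l2_inner (M \<Otimes>\<^sub>M M) (adjoint_kernel K) (\<lambda>(x, y). \<phi> x * cnj (\<psi> y)))"
    by (subst l2_inner_commute) (simp add: l2_inner_kernel_op adjoint_kernel_L2 assms)
  also have "\<dots> = l2_inner (M \<Otimes>\<^sub>M M) (\<lambda>(x, y). \<phi> x * cnj (\<psi> y)) (adjoint_kernel K)"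
    by (simp flip: l2_inner_commute)
  also have "\<dots> = l2_inner (M \<Otimes>\<^sub>M M) K (\<lambda>(x, y). \<psi> x * cnj (\<phi> y))"
    unfolding Q using l2_inner_adjoint_kernel[OF adjoint_kernel_L2[OF K] P] by (simp add: A)
  finally show ?thesis by (simp add: l2_inner_kernel_op assms)
qed

lemma hs_op_kernel:
  assumes "K \<in> L2 (M \<Otimes>\<^sub>M M)" "is_onb M (onb M)"
  shows "hs_op M (kernel_op M K)"
  unfolding hs_op_def using bounded_op_kernel[OF assms(1)] sums_summable[OF kernel_op_onb_sums[OF assms]]
  by simp

lemma hs_norm_has_kernel:
  assumes K: "K \<in> L2 (M \<Otimes>\<^sub>M M)" and T: "has_kernel M T K" and e: "is_onb M (onb M)"
  shows "hs_norm M T = l2_norm (M \<Otimes>\<^sub>M M) K"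
proof -
  have "l2_norm M (T (onb M n)) = l2_norm M (kernel_op M K (onb M n))" for n
    using T is_onb_L2[OF e, of n] K
    by (intro l2_norm_cong_AE) (auto simp: has_kernel_def intro!: L2_measurable kernel_op_L2)
  then show ?thesis
    using kernel_op_onb_sums[OF K e] by (simp add: hs_norm_def sums_iff)
qed

lemma has_kernel_diff:
  assumes K: "K \<in> L2 (M \<Otimes>\<^sub>M M)" "has_kernel M T K" and L: "L \<in> L2 (M \<Otimes>\<^sub>M M)" "has_kernel M S L"
  shows "has_kernel M (\<lambda>\<phi> x. T \<phi> x - S \<phi> x) (\<lambda>z. K z - L z)"
  unfolding has_kernel_def
proof (intro ballI conjI)
  fix \<phi> assume \<phi>: "\<phi> \<in> L2 M"
  show "(\<lambda>x. T \<phi> x - S \<phi> x) \<in> L2 M"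
    using assms \<phi> by (auto simp: has_kernel_def)
  show "AE x in M. T \<phi> x - S \<phi> x = kernel_op M (\<lambda>z. K z - L z) \<phi> x"
  proof -
    have "AE x in M. T \<phi> x = kernel_op M K \<phi> x" "AE x in M. S \<phi> x = kernel_op M L \<phi> x"
      using K L \<phi> by (auto simp: has_kernel_def)
    with kernel_op_add[OF K(1) L(1) \<phi>, of "-1"] show ?thesis
      by eventually_elim simp
  qed
qed

text \<open>Two candidates for the value of the adjoint have the same inner product with every element of
  L2, in particular with their difference; so the choice is determined up to null sets.\<close>

lemma op_adjoint_has_kernel:
  assumes L: "L \<in> L2 (M \<Otimes>\<^sub>M M)" "has_kernel M S L" and \<psi>: "\<psi> \<in> L2 M"
  shows "op_adjoint M S \<psi> \<in> L2 M"
    and "AE x in M. op_adjoint M S \<psi> x = kernel_op M (adjoint_kernel L) \<psi> x"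
proof -
  let ?u = "kernel_op M (adjoint_kernel L) \<psi>"
  have u: "?u \<in> L2 M" by (intro kernel_op_L2 adjoint_kernel_L2 assms)
  have S: "l2_inner M (S \<phi>) \<psi> = l2_inner M \<phi> ?u" if "\<phi> \<in> L2 M" for \<phi>
    unfolding kernel_op_adjoint[OF L(1) that \<psi>, symmetric]
    using L that \<psi> by (intro l2_inner_cong_AE) (auto simp: has_kernel_def kernel_op_L2)
  have *: "op_adjoint M S \<psi> \<in> L2 M \<and> (\<forall>\<phi>\<in>L2 M. l2_inner M (S \<phi>) \<psi> = l2_inner M \<phi> (op_adjoint M S \<psi>))"
    unfolding op_adjoint_def by (rule someI[of _ ?u]) (use u S in auto)
  then show "op_adjoint M S \<psi> \<in> L2 M" ..
  let ?d = "\<lambda>x. op_adjoint M S \<psi> x - ?u x"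
  have d: "?d \<in> L2 M" using * u by auto
  have "l2_inner M ?d ?d = 0"
    using * S[OF d] u d by (simp add: l2_inner_diff_right)
  then have "AE x in M. ?d x = 0"
    using d by (simp add: l2_inner_self l2_norm_eq_0_iff)
  then show "AE x in M. op_adjoint M S \<psi> x = ?u x"
    by simp
qed

text \<open>The trace is the sum of the inner products of \<open>S\<^sup>* e n\<close> and \<open>T\<^sup>* e n\<close>, so it is the inner product of
  the adjoint kernels.\<close>

lemma op_trace_has_kernel:
  assumes K: "K \<in> L2 (M \<Otimes>\<^sub>M M)" "has_kernel M T K" and L: "L \<in> L2 (M \<Otimes>\<^sub>M M)" "has_kernel M S L"
    and e: "is_onb M (onb M)"
  shows "op_trace M (T \<circ> op_adjoint M S) = l2_inner (M \<Otimes>\<^sub>M M) K L"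
proof -
  have "l2_inner M (T (op_adjoint M S (onb M n))) (onb M n) =
      l2_inner M (kernel_op M (adjoint_kernel L) (onb M n)) (kernel_op M (adjoint_kernel K) (onb M n))" for n
  proof -
    have en: "onb M n \<in> L2 M" by (rule is_onb_L2[OF e])
    note adj = op_adjoint_has_kernel[OF L en]
    have "l2_inner M (T (op_adjoint M S (onb M n))) (onb M n) =
        l2_inner M (kernel_op M K (op_adjoint M S (onb M n))) (onb M n)"
      using K adj(1) en by (intro l2_inner_cong_AE) (auto simp: has_kernel_def kernel_op_L2)
    also have "\<dots> = l2_inner M (op_adjoint M S (onb M n)) (kernel_op M (adjoint_kernel K) (onb M n))"
      by (rule kernel_op_adjoint[OF K(1) adj(1) en])
    also have "\<dots> = l2_inner M (kernel_op M (adjoint_kernel L) (onb M n)) (kernel_op M (adjoint_kernel K) (onb M n))"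
      using adj en K L by (intro l2_inner_cong_AE) (auto intro!: kernel_op_L2 adjoint_kernel_L2)
    finally show ?thesis .
  qed
  then show ?thesis
    using kernel_op_inner_sums[OF adjoint_kernel_L2[OF L(1)] adjoint_kernel_L2[OF K(1)] e]
    by (simp add: op_trace_def sums_iff l2_inner_adjoint_kernel K L)
qed

lemma bounded_op_limit:
  assumes T: "bounded_op M T" and f: "f \<in> L2 M" "\<And>n. g n \<in> L2 M"
    and lim: "(\<lambda>n. l2_norm M (\<lambda>x. f x - g n x)) \<longlonglongrightarrow> 0"
  shows "(\<lambda>n. l2_norm M (\<lambda>x. T f x - T (g n) x)) \<longlonglongrightarrow> 0"
proof -
  obtain C where C: "\<And>f. f \<in> L2 M \<Longrightarrow> l2_norm M (T f) \<le> C * l2_norm M f"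
    using T unfolding bounded_op_def by blast
  have TL: "T f \<in> L2 M" if "f \<in> L2 M" for f
    using T that by (auto simp: bounded_op_def)
  have add: "AE x in M. T (\<lambda>y. f y + g y) x = T f x + T g x" if "f \<in> L2 M" "g \<in> L2 M" for f g
    using T that by (simp add: bounded_op_def)
  have le: "norm (l2_norm M (\<lambda>x. T f x - T (g n) x)) \<le> C * l2_norm M (\<lambda>x. f x - g n x)" for n
  proof -
    have d: "(\<lambda>x. f x - g n x) \<in> L2 M" using f by auto
    have "AE x in M. T (\<lambda>y. (f y - g n y) + g n y) x = T (\<lambda>y. f y - g n y) x + T (g n) x"
      by (rule add[OF d f(2)])
    then have "l2_norm M (\<lambda>x. T f x - T (g n) x) = l2_norm M (T (\<lambda>y. f y - g n y))"
      using L2_diff[OF TL[OF f(1)] TL[OF f(2)[of n]]] TL[OF d]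
      by (intro l2_norm_cong_AE L2_measurable) auto
    then show ?thesis using C[OF d] by simp
  qed
  have lim0: "(\<lambda>n. C * l2_norm M (\<lambda>x. f x - g n x)) \<longlonglongrightarrow> 0"
    using tendsto_mult_left[OF lim, of C] by simp
  show ?thesis
    by (rule Lim_null_comparison[OF always_eventually lim0]) (rule allI, rule le)
qed

text \<open>Bounded operators are determined by their values on a dense set. Used for the domain of the
  Duflo-Moore operator, where the transform is given by an integral, and for the span of a basis.\<close>

lemma has_kernel_dense:
  assumes T: "bounded_op M T" and K: "K \<in> L2 (M \<Otimes>\<^sub>M M)"
    and dense: "\<And>f. f \<in> L2 M \<Longrightarrow> \<exists>g. (\<forall>n. g n \<in> L2 M \<and> (AE x in M. T (g n) x = kernel_op M K (g n) x)) \<and>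
      (\<lambda>n. l2_norm M (\<lambda>x. f x - g n x)) \<longlonglongrightarrow> 0"
  shows "has_kernel M T K"
  unfolding has_kernel_def
proof (intro ballI conjI)
  fix f assume f: "f \<in> L2 M"
  have TL: "T f \<in> L2 M" if "f \<in> L2 M" for f
    using T that by (auto simp: bounded_op_def)
  then show "T f \<in> L2 M" using f .
  obtain g where g: "\<And>n. g n \<in> L2 M" "\<And>n. AE x in M. T (g n) x = kernel_op M K (g n) x"
    and lim: "(\<lambda>n. l2_norm M (\<lambda>x. f x - g n x)) \<longlonglongrightarrow> 0"
    using dense[OF f] by blast
  have "(\<lambda>n. l2_norm M (\<lambda>x. T f x - T (g n) x) + l2_norm M (\<lambda>x. kernel_op M K f x - kernel_op M K (g n) x)) \<longlonglongrightarrow> 0 + 0"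
    by (rule tendsto_add[OF bounded_op_limit[OF T f g(1) lim] bounded_op_limit[OF bounded_op_kernel[OF K] f g(1) lim]])
  moreover have "l2_norm M (\<lambda>x. T f x - kernel_op M K f x) \<le>
      l2_norm M (\<lambda>x. T f x - T (g n) x) + l2_norm M (\<lambda>x. kernel_op M K f x - kernel_op M K (g n) x)" for n
  proof -
    have "l2_norm M (\<lambda>x. T (g n) x - kernel_op M K f x) = l2_norm M (\<lambda>x. kernel_op M K (g n) x - kernel_op M K f x)"
      using g(2)[of n] L2_diff[OF TL[OF g(1)[of n]] kernel_op_L2(1)[OF K f]]
        L2_diff[OF kernel_op_L2(1)[OF K g(1)[of n]] kernel_op_L2(1)[OF K f]]
      by (intro l2_norm_cong_AE L2_measurable) auto
    then show ?thesis
      using l2_norm_triangle_diff[OF TL[OF f] TL[OF g(1)[of n]] kernel_op_L2(1)[OF K f]]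
        l2_norm_minus_commute[of M "kernel_op M K (g n)" "kernel_op M K f"] by simp
  qed
  ultimately have "l2_norm M (\<lambda>x. T f x - kernel_op M K f x) \<le> 0"
    by (intro LIMSEQ_le_const) auto
  then have "l2_norm M (\<lambda>x. T f x - kernel_op M K f x) = 0"
    using l2_norm_nonneg[of M] by (intro antisym) auto
  then show "AE x in M. T f x = kernel_op M K f x"
    using L2_diff[OF TL[OF f] kernel_op_L2(1)[OF K f]] by (simp add: l2_norm_eq_0_iff)
qed

end

lemma hs_op_has_kernel:
  assumes sf: "sigma_finite_measure M" and K: "K \<in> L2 (M \<Otimes>\<^sub>M M)" and T: "has_kernel M T K"
    and e: "is_onb M (onb M)"
  shows "hs_op M T"
proof -
  let ?k = "kernel_op M K"
  have kb: "bounded_op M ?k" by (rule bounded_op_kernel[OF sf K])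
  have T1: "T f \<in> L2 M" and T2: "AE x in M. T f x = ?k f x" if "f \<in> L2 M" for f
    using T that by (auto simp: has_kernel_def)
  have n: "l2_norm M (T f) = l2_norm M (?k f)" if "f \<in> L2 M" for f
    by (intro l2_norm_cong_AE T2 L2_measurable T1 kernel_op_L2(1)[OF sf K] that)
  have "bounded_op M T"
    unfolding bounded_op_def
  proof (intro conjI ballI allI T1)
    fix f g assume fg: "f \<in> L2 M" "g \<in> L2 M"
    have "AE x in M. ?k (\<lambda>y. f y + g y) x = ?k f x + ?k g x"
      using kb fg by (simp add: bounded_op_def)
    with T2[OF fg(1)] T2[OF fg(2)] T2[OF L2_add[OF fg]]
    show "AE x in M. T (\<lambda>y. f y + g y) x = T f x + T g x"
      by eventually_elim simp
  next
    fix c f assume f: "f \<in> L2 M"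
    have "AE x in M. ?k (\<lambda>y. c * f y) x = c * ?k f x"
      using kb f by (simp add: bounded_op_def)
    with T2[OF f] T2[OF L2_cmult[OF f, of c]]
    show "AE x in M. T (\<lambda>y. c * f y) x = c * T f x"
      by eventually_elim simp
  next
    show "\<exists>C. \<forall>f\<in>L2 M. l2_norm M (T f) \<le> C * l2_norm M f"
      using kernel_op_L2(2)[OF sf K] n by (intro exI[of _ "l2_norm (M \<Otimes>\<^sub>M M) K"]) simp
  qed
  moreover have "summable (\<lambda>m. (l2_norm M (T (onb M m)))\<^sup>2)"
    using sums_summable[OF kernel_op_onb_sums[OF sf K e]] n[OF is_onb_L2[OF e]] by simp
  ultimately show ?thesis by (simp add: hs_op_def)
qed

section \<open>Bases of L2 of an open set\<close>

text \<open>Continuous approximations of the indicator of \<open>U\<close> from below. The distance to the empty set is 0,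
  so for \<open>U = UNIV\<close> they vanish; convergence to the indicator needs \<open>U \<noteq> UNIV\<close>.\<close>

definition bump :: "'a::metric_space set \<Rightarrow> nat \<Rightarrow> 'a \<Rightarrow> complex" where
  "bump U k x = complex_of_real (min 1 (real k * infdist x (- U)))"

lemma continuous_bump: "continuous_on A (bump U k)"
  unfolding bump_def[abs_def] by (intro continuous_intros)

lemma norm_bump_le: "cmod (bump U k x) \<le> indicator U x"
  by (auto simp: bump_def infdist_nonneg indicator_def)

lemma bump_tendsto_indicator:
  assumes "open U" "U \<noteq> UNIV"
  shows "(\<lambda>k. bump U k x) \<longlonglongrightarrow> indicator U x"
proof (cases "x \<in> U")
  case True
  have d: "infdist x (- U) > 0"
    using assms True by (intro infdist_pos_not_in_closed) auto
  obtain K :: nat where K: "1 / infdist x (- U) < real K"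
    using reals_Archimedean2 by blast
  have "bump U k x = 1" if "k \<ge> K" for k
  proof -
    have "1 / infdist x (- U) < real k" using K that by linarith
    then have "real k * infdist x (- U) \<ge> 1" using d by (simp add: field_simps)
    then show ?thesis by (simp add: bump_def)
  qed
  then show ?thesis
    using True by (intro tendsto_eventually eventually_sequentiallyI[of K]) auto
next
  case False
  then show ?thesis by (simp add: bump_def)
qed

text \<open>Finite intersections of a countable basis. Countability is what Gram-Schmidt needs, stability
  under intersections is what Dynkin's argument needs.\<close>

lemma countable_Int_stable_basis:
  "\<exists>B :: 'a::second_countable_topology set set. countable B \<and> Int_stable B \<and> UNIV \<in> B \<and>
    (\<forall>U\<in>B. open U) \<and> sets borel = sigma_sets UNIV B"
proof -
  obtain B :: "'a set set" where B: "countable B" "topological_basis B"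
    using ex_countable_basis by blast
  define B' where "B' = Inter ` {F. finite F \<and> F \<subseteq> B}"
  have c: "countable B'"
    unfolding B'_def using B(1) by (intro countable_image countable_Collect_finite_subset)
  have o: "open U" if "U \<in> B'" for U
    using that topological_basis_open[OF B(2)] by (auto simp: B'_def intro!: open_Inter)
  have "B \<subseteq> B'"
  proof
    fix U assume "U \<in> B"
    then show "U \<in> B'" unfolding B'_def by (intro image_eqI[of _ _ "{U}"]) auto
  qed
  then have "topological_basis B'"
    using B(2) o unfolding topological_basis_def by (meson subset_trans)
  then have "sets borel = sigma_sets UNIV B'"
    using borel_eq_countable_basis[OF c] by (metis Pow_UNIV sets_measure_of subset_UNIV)
  moreover have "Int_stable B'"
  proof (rule Int_stableI)
    fix U V assume "U \<in> B'" "V \<in> B'"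
    then obtain F G where "U = \<Inter>F" "V = \<Inter>G" "finite F" "finite G" "F \<subseteq> B" "G \<subseteq> B"
      by (auto simp: B'_def)
    then show "U \<inter> V \<in> B'" unfolding B'_def by (intro image_eqI[of _ _ "F \<union> G"]) auto
  qed
  moreover have "UNIV \<in> B'" unfolding B'_def by (intro image_eqI[of _ _ "{}"]) auto
  ultimately show ?thesis using c o by blast
qed

text \<open>Dynkin's argument extends the vanishing of set integrals from the generator to all Borel sets.\<close>

lemma AE_zero_of_generator:
  fixes g :: "'a::euclidean_space \<Rightarrow> complex"
  assumes g: "integrable lborel g"
    and B: "Int_stable B" "UNIV \<in> B" "sets borel = sigma_sets UNIV B"
    and zero: "\<And>U. U \<in> B \<Longrightarrow> set_lebesgue_integral lborel U g = 0"
  shows "AE x in lborel. g x = 0"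
proof (rule sigma_finite_measure.density_zero[OF sigma_finite_lborel g])
  have si: "set_integrable lborel A g" if "A \<in> sets borel" for A
    unfolding set_integrable_def using integrable_mult_indicator[OF _ g, of A] that by simp
  have "B \<subseteq> Pow UNIV" by simp
  fix A :: "'a set" assume "A \<in> sets lborel"
  then have "A \<in> sigma_sets UNIV B" using B by simp
  with B(1) \<open>B \<subseteq> Pow UNIV\<close> show "set_lebesgue_integral lborel A g = 0"
  proof (induction rule: sigma_sets_induct_disjoint)
    case (compl A)
    then have A: "A \<in> sets borel" using B(3) by simp
    have "set_lebesgue_integral lborel (A \<union> (UNIV - A)) g =
        set_lebesgue_integral lborel A g + set_lebesgue_integral lborel (UNIV - A) g"
      using A by (intro set_integral_Un si) auto
    then show ?case using zero[OF B(2)] compl by simp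
  next
    case (union A)
    then have A: "A i \<in> sets borel" for i using B(3) by auto
    have "set_lebesgue_integral lborel (\<Union>i. A i) g = (\<Sum>i. set_lebesgue_integral lborel (A i) g)"
      using union(1) A by (intro lebesgue_integral_countable_add si) (auto simp: disjoint_family_on_def)
    then show ?case using union by simp
  qed (simp_all add: zero, simp add: set_lebesgue_integral_def)
qed

text \<open>The functions \<open>bump\<close>, for the bounded pieces of the sets of a countable generator, are total: their
  limits are the indicators of these pieces. The infinite orthonormal sequence that Gram-Schmidt asks for
  consists of normalised indicators of disjoint shells.\<close>

theorem onb_exists_open:
  fixes S :: "'a::euclidean_space set"
  defines "M \<equiv> restrict_space lborel S"
  assumes S: "open S" "S \<noteq> {}"
    and V: "V \<subseteq> L2 M" "\<And>f g. f \<in> V \<Longrightarrow> g \<in> V \<Longrightarrow> (\<lambda>x. f x + g x) \<in> V"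
      "\<And>c f. f \<in> V \<Longrightarrow> (\<lambda>x. c * f x) \<in> V"
    and VC: "\<And>U k. open U \<Longrightarrow> bounded U \<Longrightarrow> bump U k \<in> V"
  shows "\<exists>e. is_onb M e \<and> (\<forall>n. e n \<in> V)"
proof -
  have [measurable]: "S \<in> sets borel" using S by simp
  obtain B :: "'a set set" where B: "countable B" "Int_stable B" "UNIV \<in> B" "\<And>U. U \<in> B \<Longrightarrow> open U"
      "sets borel = sigma_sets UNIV B"
    using countable_Int_stable_basis by metis
  define v where "v n = (case prod_decode n of (i, n') \<Rightarrow> case prod_decode n' of (m, k) \<Rightarrow>
      bump (from_nat_into B i \<inter> ball 0 (real m)) k)" for n
  have Bi: "from_nat_into B i \<in> B" for i
    using B(3) by (intro from_nat_into) auto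
  have vV: "v n \<in> V" for n
    using B(4)[OF Bi] by (auto simp: v_def split: prod.split intro!: VC open_Int bounded_Int)
  obtain x0 r where r: "r > 0" "ball x0 r \<subseteq> S"
    using S by (meson all_not_in_conv open_contains_ball)
  \<comment> \<open>Shells in a ball inside \<open>S\<close>; they have positive measure because they are open and nonempty.\<close>
  define A where "A n = ball x0 (r / real (n + 1)) - cball x0 (r / real (n + 2))" for n :: nat
  have A_sub: "A n \<subseteq> ball x0 r" for n
  proof -
    have "r / real (n + 1) \<le> r" using r(1) by (simp add: field_simps)
    then show ?thesis by (auto simp: A_def)
  qed
  have [measurable]: "A n \<in> sets borel" for n by (simp add: A_def)
  have oA: "open (A n)" for n by (auto simp: A_def)
  have neA: "A n \<noteq> {}" for n
  proof -
    have lt: "r / real (n + 2) < r / real (n + 1)" using r(1) by (intro divide_strict_left_mono) auto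
    obtain b :: 'a where b: "b \<in> Basis" using nonempty_Basis by blast
    have mid: "(p + q) / 2 < q \<and> p < (p + q) / 2" if "p < q" for p q :: real
      using that by simp
    \<comment> \<open>The middle of the shell in a coordinate direction.\<close>
    let ?t = "(r / real (n + 2) + r / real (n + 1)) / 2"
    have "?t > 0" using r(1) by (simp add: add_pos_pos)
    then have "dist x0 (x0 + ?t *\<^sub>R b) = ?t" using b by (simp add: dist_norm)
    moreover have "?t < r / real (n + 1)" "r / real (n + 2) < ?t"
      using mid[OF lt] by blast+
    ultimately have "x0 + ?t *\<^sub>R b \<in> A n"
      unfolding A_def Diff_iff mem_ball mem_cball by (simp only: not_le)
    then show ?thesis by blast
  qed
  have finA: "emeasure lborel (A n) < \<infinity>" for n
    by (rule le_less_trans[OF emeasure_mono[OF A_sub]]) (use emeasure_bounded_finite[OF bounded_ball[of x0 r]] in auto)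
  define a where "a n = measure lborel (A n)" for n
  have a: "a n > 0" for n
  proof -
    have "emeasure lborel (A n) \<noteq> 0"
    proof
      assume "emeasure lborel (A n) = 0"
      then have "A n \<in> null_sets lborel" by (auto simp: null_sets_def)
      then have "negligible (A n)"
        by (simp add: negligible_iff_null_sets null_sets_completionI)
      with open_not_negligible[OF oA neA] show False by blast
    qed
    then show ?thesis
      using finA[of n] by (simp add: a_def measure_def enn2real_positive_iff less_top zero_less_iff_neq_zero)
  qed
  have disj: "A m \<inter> A n = {}" if "m < n" for m n
  proof -
    have "r / real (n + 1) \<le> r / real (m + 2)" using r(1) that by (intro divide_left_mono) auto
    then show ?thesis by (auto simp: A_def)
  qed
  define b where "b n x = complex_of_real (1 / sqrt (a n)) * indicator (A n) x" for n x
  have SA: "S \<inter> A n = A n" for n using A_sub r(2) by auto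
  show ?thesis
  proof (rule onb_exists[where v = v and b = b, OF V vV])
    fix f assume f: "f \<in> L2 M" and orth: "\<And>n. l2_inner M f (v n) = 0"
    have fm: "(\<lambda>x. indicator S x *\<^sub>R f x) \<in> borel_measurable lborel"
      using L2_measurable[OF f] unfolding M_def by (subst (asm) borel_measurable_restrict_space_iff) auto
    have f2: "integrable lborel (\<lambda>x. indicator S x * (cmod (f x))\<^sup>2)"
      using L2_square_integrable[OF f] unfolding M_def
      by (subst (asm) integrable_restrict_space) (auto simp: set_integrable_def)
    have "AE x in lborel. x \<in> ball 0 (real m) \<longrightarrow> x \<in> S \<longrightarrow> f x = 0" for m :: nat
    proof -
      define g where "g x = indicator (ball 0 (real m)) x *\<^sub>R (indicator S x *\<^sub>R f x)" for x
      have gm [measurable]: "g \<in> borel_measurable borel"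
        unfolding g_def[abs_def] by (rule borel_measurable_scaleR) (use fm in \<open>auto intro: borel_measurable_indicator\<close>)
      have gi: "integrable lborel g"
      proof (rule Bochner_Integration.integrable_bound)
        show "integrable lborel (\<lambda>x. indicator S x * (cmod (f x))\<^sup>2 + indicator (ball 0 (real m)) x)"
          by (intro Bochner_Integration.integrable_add f2 integrable_real_indicator)
            (use emeasure_bounded_finite[OF bounded_ball[of "0::'a" "real m"]] in auto)
        have "a \<le> a\<^sup>2 + 1" for a :: real
          using sum_squares_bound[of a 1, simplified] zero_le_power2[of a] by linarith
        then show "AE x in lborel. norm (g x) \<le> norm (indicator S x * (cmod (f x))\<^sup>2 + indicator (ball 0 (real m)) x)"
          by (auto simp: g_def indicator_def)
      qed simp
      have "AE x in lborel. g x = 0"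
      proof (rule AE_zero_of_generator[OF gi B(2,3,5)])
        fix U assume U: "U \<in> B"
        then obtain i where i: "U = from_nat_into B i"
          using B(1) from_nat_into_surj by metis
        let ?W = "U \<inter> ball 0 (real m)"
        have ne: "ball 0 (real m) \<noteq> (UNIV :: 'a set)"
          by (metis bounded_ball not_bounded_UNIV)
        have W: "open ?W" "?W \<noteq> UNIV"
          using B(4)[OF U] ne by auto
        have [measurable]: "U \<in> sets borel" "?W \<in> sets borel" using B(4)[OF U] by auto
        have bm [measurable]: "bump ?W k \<in> borel_measurable borel" for k
          by (intro borel_measurable_continuous_onI continuous_bump)
        have "(\<lambda>k. LINT x|lborel. bump ?W k x * g x) \<longlonglongrightarrow> (LINT x|lborel. indicator ?W x * g x)"
        proof (rule integral_dominated_convergence[where w = "\<lambda>x. cmod (g x)"])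
          show "AE x in lborel. (\<lambda>k. bump ?W k x * g x) \<longlonglongrightarrow> indicator ?W x * g x"
            by (intro AE_I2 tendsto_intros bump_tendsto_indicator W)
          fix k
          have "cmod (bump ?W k x) \<le> 1" for x
            by (auto simp: bump_def infdist_nonneg)
          then show "AE x in lborel. norm (bump ?W k x * g x) \<le> cmod (g x)"
            by (simp add: norm_mult mult_left_le_one_le)
        qed (use gi in auto)
        moreover have "(LINT x|lborel. bump ?W k x * g x) = 0" for k
        proof -
          have "(LINT x|lborel. bump ?W k x * g x) = (LINT x|lborel. indicator S x *\<^sub>R (f x * cnj (bump ?W k x)))"
          proof (intro Bochner_Integration.integral_cong refl)
            fix x
            show "bump ?W k x * g x = indicator S x *\<^sub>R (f x * cnj (bump ?W k x))"
              using norm_bump_le[of ?W k x]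
              by (auto simp: g_def indicator_def bump_def split: if_splits)
          qed
          also have "\<dots> = l2_inner M f (bump ?W k)"
            unfolding l2_inner_def M_def by (subst integral_restrict_space) (auto simp: set_lebesgue_integral_def)
          also have "\<dots> = l2_inner M f (v (prod_encode (i, prod_encode (m, k))))"
            by (simp add: v_def i)
          finally show ?thesis by (simp add: orth)
        qed
        ultimately have "(LINT x|lborel. indicator ?W x * g x) = 0"
          by (simp add: LIMSEQ_const_iff)
        also have "(\<lambda>x. indicator ?W x * g x) = (\<lambda>x. indicator U x *\<^sub>R g x)"
          by (auto simp: g_def indicator_def fun_eq_iff)
        finally show "set_lebesgue_integral lborel U g = 0"
          by (simp add: set_lebesgue_integral_def)
      qed
      then show ?thesis
        by eventually_elim (auto simp: g_def indicator_def)
    qed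
    then have "AE x in lborel. \<forall>m::nat. x \<in> ball 0 (real m) \<longrightarrow> x \<in> S \<longrightarrow> f x = 0"
      by (intro AE_all_countable[THEN iffD2] allI)
    then have "AE x in lborel. x \<in> S \<longrightarrow> f x = 0"
    proof eventually_elim
      case (elim x)
      then show ?case using reals_Archimedean2[of "norm x"] by auto
    qed
    then show "AE x in M. f x = 0"
      unfolding M_def by (subst AE_restrict_space_iff) auto
  next
    show "b n \<in> L2 M" for n
    proof -
      have "(\<lambda>x. indicator (A n) x :: complex) \<in> L2 M"
      proof -
        have "integrable lborel (\<lambda>x. indicator (S \<inter> A n) x :: real)"
          using finA[of n] by (intro integrable_real_indicator) (auto simp: SA)
        moreover have "indicator S x *\<^sub>R (cmod (indicator (A n) x))\<^sup>2 = (indicator (S \<inter> A n) x :: real)" for x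
          by (auto simp: indicator_def)
        ultimately have "integrable M (\<lambda>x. (cmod (indicator (A n) x))\<^sup>2)"
          unfolding M_def by (subst integrable_restrict_space) (auto simp: set_integrable_def)
        moreover have "(\<lambda>x. indicator (A n) x :: complex) \<in> borel_measurable M"
          unfolding M_def by (intro measurable_restrict_space1) simp
        ultimately show ?thesis by (simp add: L2_def)
      qed
      then show ?thesis unfolding b_def[abs_def] by (rule L2_cmult)
    qed
    show "l2_inner M (b m) (b n) = (if m = n then 1 else 0)" for m n
    proof -
      have i: "l2_inner M (indicator (A m)) (indicator (A n)) = complex_of_real (measure lborel (A m \<inter> A n))"
      proof -
        have "l2_inner M (indicator (A m)) (indicator (A n)) =
            (LINT x|lborel. indicator S x *\<^sub>R (indicator (A m) x * cnj (indicator (A n) x)))"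
          unfolding l2_inner_def M_def by (subst integral_restrict_space) (auto simp: set_lebesgue_integral_def)
        also have "\<dots> = (LINT x|lborel. complex_of_real (indicator (A m \<inter> A n) x))"
          using SA by (intro Bochner_Integration.integral_cong) (auto simp: indicator_def)
        also have "\<dots> = complex_of_real (LINT x|lborel. indicator (A m \<inter> A n) x)"
          by (rule integral_complex_of_real)
        finally show ?thesis by simp
      qed
      have "l2_inner M (b m) (b n) =
          complex_of_real (1 / sqrt (a m) * (1 / sqrt (a n)) * measure lborel (A m \<inter> A n))"
        unfolding b_def[abs_def] l2_inner_cmult_left l2_inner_cmult_right i by simp
      also have "1 / sqrt (a m) * (1 / sqrt (a n)) * measure lborel (A m \<inter> A n) = (if m = n then 1 else 0)"
      proof (cases "m = n")
        case True
        then show ?thesis using a[of n] by (simp add: real_sqrt_mult_self flip: a_def)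
      next
        case False
        then have "A m \<inter> A n = {}" using disj[of m n] disj[of n m] by (cases "m < n") auto
        with False show ?thesis by simp
      qed
      finally show ?thesis by simp
    qed
  qed
qed

section \<open>The Plancherel theorem in the plane\<close>

definition vec2 :: "real \<times> real \<Rightarrow> real^2" where
  "vec2 z = vector [fst z, snd z]"

lemma vec2_nth [simp]: "vec2 z $ 1 = fst z" "vec2 z $ 2 = snd z"
  by (simp_all add: vec2_def)

lemma continuous_vec2: "continuous_on A vec2"
proof -
  have "vec2 z = fst z *\<^sub>R axis 1 1 + snd z *\<^sub>R axis 2 1" for z
    by (simp add: vec_eq_iff forall_2 axis_def)
  then show ?thesis by (simp add: continuous_intros)
qed

lemma borel_measurable_vec2 [measurable]: "vec2 \<in> borel_measurable borel"
  by (intro borel_measurable_continuous_onI continuous_vec2)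

lemma norm_real2: "(norm (x :: real^2))\<^sup>2 = (x $ 1)\<^sup>2 + (x $ 2)\<^sup>2"
  by (simp add: norm_vec_def L2_set_def sum_2)

lemma Basis_real2: "(Basis :: (real^2) set) = {axis 1 1, axis 2 1}"
  by (auto simp: Basis_vec_def UNIV_2)

lemma lborel_vec2: "(lborel :: (real^2) measure) = distr (lborel \<Otimes>\<^sub>M lborel) borel vec2"
proof (rule lborel_eqI)
  fix l u :: "real^2" assume *: "\<And>b. b \<in> Basis \<Longrightarrow> l \<bullet> b \<le> u \<bullet> b"
  have lu: "l $ 1 \<le> u $ 1" "l $ 2 \<le> u $ 2"
    using *[of "axis 1 1"] *[of "axis 2 1"] by (simp_all add: Basis_real2 inner_axis)
  have [measurable]: "vec2 \<in> borel_measurable (lborel \<Otimes>\<^sub>M lborel)"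
    by (simp add: lborel_prod)
  have "vec2 -` box l u = {l $ 1<..<u $ 1} \<times> {l $ 2<..<u $ 2}"
    by (auto simp: mem_box_cart forall_2)
  then have "emeasure (distr (lborel \<Otimes>\<^sub>M lborel) borel vec2) (box l u) =
      emeasure lborel {l $ 1<..<u $ 1} * emeasure lborel {l $ 2<..<u $ 2}"
    by (subst emeasure_distr) (auto simp: space_pair_measure lborel.emeasure_pair_measure_Times)
  also have "\<dots> = ennreal ((u $ 1 - l $ 1) * (u $ 2 - l $ 2))"
    using lu by (simp add: ennreal_mult)
  also have "(u $ 1 - l $ 1) * (u $ 2 - l $ 2) = (\<Prod>b\<in>Basis. (u - l) \<bullet> b)"
    by (simp add: Basis_real2 inner_axis axis_eq_axis)
  finally show "emeasure (distr (lborel \<Otimes>\<^sub>M lborel) borel vec2) (box l u) = (\<Prod>b\<in>Basis. (u - l) \<bullet> b)" .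
qed simp

lemma nn_integral_vec2:
  assumes [measurable]: "f \<in> borel_measurable borel"
  shows "(\<integral>\<^sup>+x. f x \<partial>(lborel :: (real^2) measure)) = (\<integral>\<^sup>+u. \<integral>\<^sup>+v. f (vec2 (u, v)) \<partial>lborel \<partial>lborel)"
proof -
  have [measurable]: "vec2 \<in> borel_measurable (lborel \<Otimes>\<^sub>M lborel)"
    by (simp add: lborel_prod)
  show ?thesis
    by (subst lborel_vec2, subst nn_integral_distr) (auto simp: lborel.nn_integral_fst[symmetric])
qed

lemma integral_affine_euclidean:
  fixes f :: "'a::euclidean_space \<Rightarrow> 'b::{banach, second_countable_topology}"
  assumes [measurable]: "f \<in> borel_measurable borel" and c: "c \<noteq> 0"
  shows "(LINT x|lborel. f x) = \<bar>c\<bar> ^ DIM('a) *\<^sub>R (LINT x|lborel. f (t + c *\<^sub>R x))"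
  by (subst lborel_affine[OF c, of t])
     (simp add: integral_density integral_distr)

lemma integrable_affine_euclidean:
  fixes f :: "'a::euclidean_space \<Rightarrow> 'b::{banach, second_countable_topology}"
  assumes f: "integrable lborel f" and c: "c \<noteq> 0"
  shows "integrable lborel (\<lambda>x. f (t + c *\<^sub>R x))"
proof -
  have [measurable]: "f \<in> borel_measurable borel" using f by (auto dest: borel_measurable_integrable)
  from f have "integrable (density (distr lborel borel (\<lambda>x. t + c *\<^sub>R x)) (\<lambda>_. \<bar>c\<bar> ^ DIM('a))) f"
    by (subst (asm) lborel_affine[OF c, of t])
  then have "integrable lborel (\<lambda>x. \<bar>c\<bar> ^ DIM('a) *\<^sub>R f (t + c *\<^sub>R x))"
    by (subst (asm) integrable_density) (auto simp: integrable_distr_eq)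
  from integrable_scaleR_right[OF this, of "1 / \<bar>c\<bar> ^ DIM('a)"] show ?thesis
    using c by simp
qed

text \<open>A rescaling of the characteristic function of the standard normal distribution.\<close>

lemma gaussian_integral_real:
  assumes s: "s > (0::real)"
  shows "integrable lborel (\<lambda>x. exp (- (s * x)\<^sup>2 / 2))"
    and "(LINT x|lborel. exp (\<i> * of_real (t * x)) * of_real (exp (- (s * x)\<^sup>2 / 2))) =
      of_real (sqrt (2 * pi) / s * exp (- (t / s)\<^sup>2 / 2))"
proof -
  have i: "integrable lborel (\<lambda>x. exp (- x\<^sup>2 / 2) :: real)"
    using integrable_mult_right[OF integrable_normal_density[of 1 0], of "sqrt (2 * pi)"]
    by (simp add: std_normal_density_def)
  then show "integrable lborel (\<lambda>x. exp (- (s * x)\<^sup>2 / 2))"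
    using integrable_affine_euclidean[OF i, of s 0] s by simp
  have "complex_of_real (exp (- (r\<^sup>2) / 2)) = (LINT x|lborel. std_normal_density x *\<^sub>R exp (\<i> * of_real (r * x)))" for r
    using char_std_normal_distribution[THEN fun_cong, of r]
    by (simp add: char_def integral_density)
  also have "(LINT x|lborel. std_normal_density x *\<^sub>R exp (\<i> * of_real (r * x))) =
      (LINT x|lborel. of_real (1 / sqrt (2 * pi)) * (exp (\<i> * of_real (r * x)) * of_real (exp (- x\<^sup>2 / 2))))" for r
    by (intro Bochner_Integration.integral_cong) (simp_all add: std_normal_density_def scaleR_conv_of_real)
  also have "\<dots> r = of_real (1 / sqrt (2 * pi)) * (LINT x|lborel. exp (\<i> * of_real (r * x)) * of_real (exp (- x\<^sup>2 / 2)))" for r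
    by (rule integral_mult_right_zero)
  finally have e: "complex_of_real (exp (- (r\<^sup>2) / 2)) =
      of_real (1 / sqrt (2 * pi)) * (LINT x|lborel. exp (\<i> * of_real (r * x)) * of_real (exp (- x\<^sup>2 / 2)))" for r .
  have std: "(LINT x|lborel. exp (\<i> * of_real (r * x)) * of_real (exp (- x\<^sup>2 / 2))) =
      of_real (sqrt (2 * pi)) * complex_of_real (exp (- (r\<^sup>2) / 2))" for r
    unfolding e[of r] mult.assoc[symmetric] of_real_mult[symmetric] by simp
  have "(LINT x|lborel. exp (\<i> * of_real (t * x)) * of_real (exp (- (s * x)\<^sup>2 / 2))) =
      (1 / s) *\<^sub>R (LINT x|lborel. exp (\<i> * of_real ((t / s) * x)) * of_real (exp (- x\<^sup>2 / 2)))"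
    using s by (subst lborel_integral_real_affine[where c = "1 / s" and t = 0]) simp_all
  then show "(LINT x|lborel. exp (\<i> * of_real (t * x)) * of_real (exp (- (s * x)\<^sup>2 / 2))) =
      of_real (sqrt (2 * pi) / s * exp (- (t / s)\<^sup>2 / 2))"
    unfolding std scaleR_conv_of_real of_real_mult[symmetric] by simp
qed

definition gauss :: "real \<Rightarrow> real^2 \<Rightarrow> real" where
  "gauss s x = exp (- (s * norm x)\<^sup>2 / 2)"

lemma gauss_bounds: "0 < gauss s x" "gauss s x \<le> 1"
  by (simp_all add: gauss_def)

lemma borel_measurable_gauss [measurable]: "gauss s \<in> borel_measurable borel"
  unfolding gauss_def[abs_def] by measurable

lemma gauss_vec2: "gauss s (vec2 (u, v)) = exp (- (s * u)\<^sup>2 / 2) * exp (- (s * v)\<^sup>2 / 2)"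
  by (simp add: gauss_def norm_real2 power_mult_distrib flip: exp_add) (simp add: algebra_simps)

definition character :: "real^2 \<Rightarrow> real^2 \<Rightarrow> complex" where
  "character x b = exp (\<i> * complex_of_real (mink x b))"

lemma norm_character [simp]: "cmod (character x b) = 1"
  by (simp add: character_def)

lemma cnj_character: "cnj (character x b) = character x (- b)"
  by (simp add: character_def mink_def exp_cnj algebra_simps)

lemma character_add: "character x (b + c) = character x b * character x c"
  by (simp add: character_def mink_def algebra_simps flip: exp_add)

lemma borel_measurable_nth [measurable]: "(\<lambda>x. x $ i) \<in> borel_measurable (borel :: (real^'n) measure)"
  by (intro borel_measurable_continuous_onI continuous_intros)

lemma borel_measurable_mink [measurable]:
  assumes "f \<in> borel_measurable M" "g \<in> borel_measurable M"
  shows "(\<lambda>x. mink (f x) (g x)) \<in> borel_measurable M"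
proof -
  have [measurable]: "(\<lambda>x. f x $ i) \<in> borel_measurable M" "(\<lambda>x. g x $ i) \<in> borel_measurable M" for i
    using assms by (auto intro: measurable_compose[OF _ borel_measurable_nth])
  show ?thesis unfolding mink_def by measurable
qed

lemma borel_measurable_character [measurable]:
  "f \<in> borel_measurable M \<Longrightarrow> g \<in> borel_measurable M \<Longrightarrow> (\<lambda>x. character (f x) (g x)) \<in> borel_measurable M"
  unfolding character_def by measurable

text \<open>Weight and character are products of functions of the two coordinates.\<close>

lemma gaussian_integral:
  assumes s: "s > 0"
  shows "integrable lborel (gauss s)"
    and "(LINT x|lborel. character x c * of_real (gauss s x)) =
      of_real (2 * pi / s\<^sup>2 * gauss (1 / s) c)"
proof -
  have [measurable]: "vec2 \<in> borel_measurable (lborel \<Otimes>\<^sub>M lborel)"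
    by (simp add: lborel_prod)
  \<comment> \<open>The Minkowski sign enters as the frequency \<open>- c $ 2\<close> in the second coordinate.\<close>
  let ?h = "\<lambda>t x. exp (\<i> * of_real (t * x)) * of_real (exp (- (s * x)\<^sup>2 / 2))"
  have h: "integrable lborel (?h t)" for t
    by (rule Bochner_Integration.integrable_bound[OF gaussian_integral_real(1)[OF s]]) (auto simp: norm_mult)
  have split: "character (vec2 (u, v)) c * of_real (gauss s (vec2 (u, v))) = ?h (c $ 1) u * ?h (- c $ 2) v" for u v
  proof -
    have "\<i> * complex_of_real (mink (vec2 (u, v)) c) =
        \<i> * of_real (c $ 1 * u) + \<i> * of_real (- c $ 2 * v)"
      by (simp add: mink_def algebra_simps)
    then show ?thesis
      by (simp only: character_def exp_add gauss_vec2 of_real_mult mult_ac)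
  qed
  have int: "integrable (lborel \<Otimes>\<^sub>M lborel) (\<lambda>z. character (vec2 z) c * of_real (gauss s (vec2 z)))"
  proof (rule lborel_pair.Fubini_integrable)
    show "integrable lborel (\<lambda>u. LINT v|lborel. norm (character (vec2 (u, v)) c * of_real (gauss s (vec2 (u, v)))))"
      using gaussian_integral_real(1)[OF s] gauss_bounds(1)[of s]
      by (simp add: norm_mult gauss_vec2 less_imp_le)
    show "AE u in lborel. integrable lborel (\<lambda>v. character (vec2 (u, v)) c * of_real (gauss s (vec2 (u, v))))"
      unfolding split by (intro AE_I2 integrable_mult_right h)
  qed measurable
  have "integrable lborel (\<lambda>x. character x c * of_real (gauss s x))"
    by (subst lborel_vec2, subst integrable_distr_eq) (use int in auto)
  then have "integrable lborel (\<lambda>x. cmod (character x c * of_real (gauss s x)))"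
    by (rule integrable_norm)
  then show "integrable lborel (gauss s)"
    using gauss_bounds(1)[of s] by (simp add: norm_mult less_imp_le)
  have "(LINT x|lborel. character x c * of_real (gauss s x)) =
      (LINT z|(lborel \<Otimes>\<^sub>M lborel). character (vec2 z) c * of_real (gauss s (vec2 z)))"
    by (subst lborel_vec2, subst integral_distr) auto
  also have "\<dots> = (LINT u|lborel. LINT v|lborel. ?h (c $ 1) u * ?h (- c $ 2) v)"
    unfolding split[symmetric] by (rule lborel_pair.integral_fst'[OF int, symmetric])
  also have "\<dots> = (LINT u|lborel. ?h (c $ 1) u) * (LINT v|lborel. ?h (- c $ 2) v)"
    by simp
  also have "\<dots> = of_real (sqrt (2 * pi) / s * exp (- (c $ 1 / s)\<^sup>2 / 2)) *
      of_real (sqrt (2 * pi) / s * exp (- (- c $ 2 / s)\<^sup>2 / 2))"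
    unfolding gaussian_integral_real(2)[OF s] ..
  also have "\<dots> = of_real (2 * pi / s\<^sup>2 * (exp (- (c $ 1 / s)\<^sup>2 / 2) * exp (- (c $ 2 / s)\<^sup>2 / 2)))"
    by (simp add: power2_eq_square flip: of_real_mult)
  also have "exp (- (c $ 1 / s)\<^sup>2 / 2) * exp (- (c $ 2 / s)\<^sup>2 / 2) = gauss (1 / s) c"
    by (simp add: gauss_def norm_real2 power_divide flip: exp_add) (simp add: add_divide_distrib)
  finally show "(LINT x|lborel. character x c * of_real (gauss s x)) =
      of_real (2 * pi / s\<^sup>2 * gauss (1 / s) c)" .
qed

lemma integral_gauss: "(LINT z|lborel. gauss 1 z) = 2 * pi"
proof -
  have "complex_of_real (LINT z|lborel. gauss 1 z) = (LINT z|lborel. character z 0 * of_real (gauss 1 z))"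
    by (simp add: character_def mink_def)
  also have "\<dots> = of_real (2 * pi)"
    by (subst gaussian_integral) (simp_all add: gauss_def)
  finally show ?thesis by (simp only: of_real_eq_iff)
qed

text \<open>The Fourier transform of the plane with respect to the Minkowski form, without normalising
  factor.\<close>

definition ft :: "(real^2 \<Rightarrow> complex) \<Rightarrow> real^2 \<Rightarrow> complex" where
  "ft F x = (LINT b|lborel. F b * character x b)"

lemma integrable_character:
  assumes "integrable lborel F"
  shows "integrable lborel (\<lambda>b. F b * character x b)"
proof (rule Bochner_Integration.integrable_bound[OF assms])
  have [measurable]: "F \<in> borel_measurable borel"
    using assms by (auto dest: borel_measurable_integrable)
  show "(\<lambda>b. F b * character x b) \<in> borel_measurable lborel" by measurable
qed (simp add: norm_mult)

lemma ft_bound: "integrable lborel F \<Longrightarrow> cmod (ft F x) \<le> (LINT b|lborel. cmod (F b))"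
  unfolding ft_def
  by (rule order_trans[OF integral_norm_bound]) (simp add: norm_mult)

lemma ft_measurable:
  assumes "F \<in> borel_measurable borel"
  shows "ft F \<in> borel_measurable borel"
proof -
  have [measurable]: "F \<in> borel_measurable borel" by fact
  have "(\<lambda>x. LINT b|lborel. F b * character x b) \<in> borel_measurable lborel"
    by (rule lborel.borel_measurable_lebesgue_integral) measurable
  then show ?thesis by (simp add: ft_def[abs_def])
qed

lemma ft_add_cmult:
  assumes "integrable lborel F" "integrable lborel G"
  shows "ft (\<lambda>b. F b + c * G b) x = ft F x + c * ft G x"
  using integrable_character[OF assms(1), of x] integrable_character[OF assms(2), of x]
  by (simp add: ft_def ring_distribs mult.assoc)

text \<open>Up to the total mass \<open>(2 \<pi>)\<^sup>2\<close> of the weight, the mean of \<open>G\<close> over a Gaussian cloud of width \<open>s\<close>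
  around \<open>b\<close>.\<close>

definition average :: "real \<Rightarrow> (real^2 \<Rightarrow> complex) \<Rightarrow> real^2 \<Rightarrow> complex" where
  "average s G b = (LINT z|lborel. of_real (2 * pi * gauss 1 z) * G (b + s *\<^sub>R z))"

text \<open>Fubini and the Gaussian integral produce the heat kernel of width \<open>s\<close>; the substitution
  \<open>b' = b + s z\<close> absorbs its factor \<open>1 / s\<^sup>2\<close>.\<close>

lemma weighted_inversion:
  assumes G: "integrable lborel G" and s: "s > 0"
  shows "(LINT x|lborel. ft G x * character x (- b) * of_real (gauss s x)) = average s G b"
proof -
  have Gm [measurable]: "G \<in> borel_measurable borel"
    using G by (auto dest: borel_measurable_integrable)
  let ?h = "\<lambda>x b'. G b' * character x (b' - b) * of_real (gauss s x)"
  have int: "integrable (lborel \<Otimes>\<^sub>M lborel) (\<lambda>(x, b'). ?h x b')"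
  proof (rule lborel_pair.Fubini_integrable)
    show "integrable lborel (\<lambda>x. LINT b'|lborel. norm (case (x, b') of (x, b') \<Rightarrow> ?h x b'))"
      using gaussian_integral(1)[OF s] gauss_bounds(1)[of s]
      by (simp add: norm_mult less_imp_le)
    show "AE x in lborel. integrable lborel (\<lambda>b'. case (x, b') of (x, b') \<Rightarrow> ?h x b')"
    proof (rule AE_I2)
      fix x
      have "integrable lborel (\<lambda>b'. of_real (gauss s x) * character x (- b) * (G b' * character x b'))"
        by (intro integrable_mult_right integrable_character G)
      then show "integrable lborel (\<lambda>b'. case (x, b') of (x, b') \<Rightarrow> ?h x b')"
        by (simp add: mult_ac diff_conv_add_uminus character_add del: add_uminus_conv_diff)
    qed
  qed measurable
  have "ft G x * character x (- b) * of_real (gauss s x) = (LINT b'|lborel. ?h x b')" for x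
    unfolding ft_def integral_mult_left_zero[symmetric]
    by (simp add: diff_conv_add_uminus character_add mult.assoc del: add_uminus_conv_diff)
  then have "(LINT x|lborel. ft G x * character x (- b) * of_real (gauss s x)) =
      (LINT x|lborel. LINT b'|lborel. ?h x b')"
    by (simp only:)
  also have "\<dots> = (LINT b'|lborel. LINT x|lborel. ?h x b')"
    by (rule lborel_pair.Fubini_integral[OF int, symmetric])
  also have "\<dots> = (LINT b'|lborel. G b' * of_real (2 * pi / s\<^sup>2 * gauss (1 / s) (b' - b)))"
    by (simp only: mult.assoc integral_mult_right_zero gaussian_integral(2)[OF s])
  also have "\<dots> = \<bar>s\<bar> ^ 2 *\<^sub>R (LINT z|lborel. G (b + s *\<^sub>R z) * of_real (2 * pi / s\<^sup>2 * gauss (1 / s) ((b + s *\<^sub>R z) - b)))"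
    using s by (subst integral_affine_euclidean[where c = s and t = b]) auto
  also have "\<dots> = average s G b"
    unfolding average_def integral_scaleR_right[symmetric]
  proof (intro Bochner_Integration.integral_cong refl)
    fix z
    have "gauss (1 / s) (b + s *\<^sub>R z - b) = gauss 1 z"
      using s by (simp add: gauss_def)
    then show "\<bar>s\<bar>\<^sup>2 *\<^sub>R (G (b + s *\<^sub>R z) * of_real (2 * pi / s\<^sup>2 * gauss (1 / s) (b + s *\<^sub>R z - b))) =
        of_real (2 * pi * gauss 1 z) * G (b + s *\<^sub>R z)"
      using s by (simp add: scaleR_conv_of_real)
  qed
  finally show ?thesis .
qed

lemma weighted_pairing:
  assumes F: "integrable lborel F" and G: "integrable lborel G" and s: "s > 0"
  shows "(LINT x|lborel. ft F x * cnj (ft G x) * of_real (gauss s x)) = (LINT b|lborel. F b * cnj (average s G b))"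
proof -
  have Gm [measurable]: "G \<in> borel_measurable borel" and Fm [measurable]: "F \<in> borel_measurable borel"
    using F G by (auto dest: borel_measurable_integrable)
  have [measurable]: "ft G \<in> borel_measurable borel" by (rule ft_measurable) simp
  let ?h = "\<lambda>x b. F b * (character x b * cnj (ft G x) * of_real (gauss s x))"
  let ?C = "LINT b|lborel. cmod (G b)"
  have w: "integrable lborel (\<lambda>x. cnj (ft G x) * of_real (gauss s x))"
  proof (rule Bochner_Integration.integrable_bound)
    show "integrable lborel (\<lambda>x. ?C * gauss s x)"
      using gaussian_integral(1)[OF s] by simp
    show "AE x in lborel. norm (cnj (ft G x) * of_real (gauss s x)) \<le> norm (?C * gauss s x)"
      using ft_bound[OF G] gauss_bounds(1)[of s]
      by (auto simp: norm_mult less_imp_le abs_mult intro!: mult_right_mono)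
  qed measurable
  have int: "integrable (lborel \<Otimes>\<^sub>M lborel) (\<lambda>(x, b). ?h x b)"
  proof (rule lborel_pair.Fubini_integrable)
    show "integrable lborel (\<lambda>x. LINT b|lborel. norm (case (x, b) of (x, b) \<Rightarrow> ?h x b))"
      using integrable_mult_right[OF integrable_norm[OF w], of "LINT b|lborel. cmod (F b)"]
      by (simp add: norm_mult)
    show "AE x in lborel. integrable lborel (\<lambda>b. case (x, b) of (x, b) \<Rightarrow> ?h x b)"
    proof (rule AE_I2)
      fix x
      have "integrable lborel (\<lambda>b. F b * character x b * (cnj (ft G x) * of_real (gauss s x)))"
        by (intro integrable_mult_left integrable_character F)
      then show "integrable lborel (\<lambda>b. case (x, b) of (x, b) \<Rightarrow> ?h x b)"
        by (simp add: mult.assoc)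
    qed
  qed measurable
  have "ft F x * cnj (ft G x) * of_real (gauss s x) = (LINT b|lborel. ?h x b)" for x
    unfolding ft_def[of F] integral_mult_left_zero[symmetric] by (simp add: mult.assoc)
  then have "(LINT x|lborel. ft F x * cnj (ft G x) * of_real (gauss s x)) = (LINT x|lborel. LINT b|lborel. ?h x b)"
    by (simp only:)
  also have "\<dots> = (LINT b|lborel. LINT x|lborel. ?h x b)"
    by (rule lborel_pair.Fubini_integral[OF int, symmetric])
  also have "\<dots> = (LINT b|lborel. F b * cnj (LINT x|lborel. ft G x * character x (- b) * of_real (gauss s x)))"
    unfolding Bochner_Integration.integral_cnj[symmetric]
    by (simp add: cnj_character mult_ac)
  also have "\<dots> = (LINT b|lborel. F b * cnj (average s G b))"
    by (simp only: weighted_inversion[OF G s])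
  finally show ?thesis .
qed


text \<open>The product of \<open>|F|\<close> at \<open>b\<close> and at \<open>b + s z\<close> is at most half the sum of the squares, and
  both squares have the same integral over \<open>b\<close> by translation invariance.\<close>

lemma average_pairing_bound:
  assumes F: "integrable lborel F" "F \<in> L2 lborel" and s: "s > 0"
  shows "cmod (LINT b|lborel. F b * cnj (average s F b)) \<le> (2 * pi * l2_norm lborel F)\<^sup>2"
proof -
  have Fm [measurable]: "F \<in> borel_measurable borel"
    using F by (auto dest: borel_measurable_integrable)
  let ?N = "ennreal ((l2_norm lborel F)\<^sup>2)"
  have shift: "(\<integral>\<^sup>+b. ennreal ((cmod (F (b + s *\<^sub>R z)))\<^sup>2) \<partial>lborel) = ?N" for z
  proof -
    have "(\<integral>\<^sup>+b. ennreal ((cmod (F (b + s *\<^sub>R z)))\<^sup>2) \<partial>lborel) =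
        (\<integral>\<^sup>+b. ennreal ((cmod (F b))\<^sup>2) \<partial>distr lborel borel (\<lambda>b. s *\<^sub>R z + 1 *\<^sub>R b))"
      by (subst nn_integral_distr) (auto simp: add.commute)
    also have "distr lborel borel (\<lambda>b. s *\<^sub>R z + 1 *\<^sub>R b) = lborel"
      using lborel_affine[of 1 "s *\<^sub>R z"] by (simp add: density_1)
    finally show ?thesis using F by (simp add: nn_integral_square_L2)
  qed
  have g: "(\<integral>\<^sup>+z. ennreal (2 * pi * gauss 1 z) \<partial>lborel) = ennreal ((2 * pi)\<^sup>2)"
    by (subst nn_integral_eq_integral)
      (auto simp: gaussian_integral integral_gauss less_imp_le[OF gauss_bounds(1)] power2_eq_square)
  have "ennreal (cmod (LINT b|lborel. F b * cnj (average s F b))) \<le>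
      (\<integral>\<^sup>+b. ennreal (cmod (F b * cnj (average s F b))) \<partial>lborel)"
  proof (cases "integrable lborel (\<lambda>b. F b * cnj (average s F b))")
    case True
    then show ?thesis by (rule integral_norm_bound_ennreal)
  next
    case False
    then show ?thesis by (simp add: not_integrable_integral_eq)
  qed
  also have "\<dots> \<le> (\<integral>\<^sup>+b. \<integral>\<^sup>+z. ennreal (2 * pi * gauss 1 z) * ennreal (cmod (F b) * cmod (F (b + s *\<^sub>R z))) \<partial>lborel \<partial>lborel)"
  proof (rule nn_integral_mono)
    fix b
    let ?h = "\<lambda>z. F b * (of_real (2 * pi * gauss 1 z) * F (b + s *\<^sub>R z))"
    have "integrable lborel (\<lambda>z. F (b + s *\<^sub>R z))"
      using s by (intro integrable_affine_euclidean F) auto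
    then have "integrable lborel (\<lambda>z. of_real (gauss 1 z) * F (b + s *\<^sub>R z))"
      by (rule Bochner_Integration.integrable_bound)
        (use gauss_bounds[of 1] in \<open>auto simp: norm_mult less_imp_le intro!: mult_left_le_one_le AE_I2\<close>)
    then have "integrable lborel (\<lambda>z. F b * (of_real (2 * pi) * (of_real (gauss 1 z) * F (b + s *\<^sub>R z))))"
      by (intro integrable_mult_right)
    then have "integrable lborel ?h"
      by (simp add: mult_ac)
    then have "ennreal (cmod (LINT z|lborel. ?h z)) \<le> (\<integral>\<^sup>+z. ennreal (cmod (?h z)) \<partial>lborel)"
      by (rule integral_norm_bound_ennreal)
    moreover have "cmod (LINT z|lborel. ?h z) = cmod (F b * cnj (average s F b))"
      by (simp add: average_def norm_mult)
    moreover have "ennreal (cmod (?h z)) = ennreal (2 * pi * gauss 1 z) * ennreal (cmod (F b) * cmod (F (b + s *\<^sub>R z)))" for z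
      using gauss_bounds(1)[of 1 z] by (simp add: norm_mult mult_ac less_imp_le flip: ennreal_mult)
    ultimately show "ennreal (cmod (F b * cnj (average s F b))) \<le>
        (\<integral>\<^sup>+z. ennreal (2 * pi * gauss 1 z) * ennreal (cmod (F b) * cmod (F (b + s *\<^sub>R z))) \<partial>lborel)"
      by simp
  qed
  also have "\<dots> = (\<integral>\<^sup>+z. \<integral>\<^sup>+b. ennreal (2 * pi * gauss 1 z) * ennreal (cmod (F b) * cmod (F (b + s *\<^sub>R z))) \<partial>lborel \<partial>lborel)"
    by (rule lborel_pair.Fubini') measurable
  also have "\<dots> \<le> (\<integral>\<^sup>+z. ennreal (2 * pi * gauss 1 z) * ?N \<partial>lborel)"
  proof (rule nn_integral_mono)
    fix z
    have "(\<integral>\<^sup>+b. ennreal (cmod (F b) * cmod (F (b + s *\<^sub>R z))) \<partial>lborel) \<le>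
       (\<integral>\<^sup>+b. ennreal (1 / 2) * (ennreal ((cmod (F b))\<^sup>2) + ennreal ((cmod (F (b + s *\<^sub>R z)))\<^sup>2)) \<partial>lborel)"
    proof (rule nn_integral_mono)
      fix b
      have "cmod (F b) * cmod (F (b + s *\<^sub>R z)) \<le> 1 / 2 * ((cmod (F b))\<^sup>2 + (cmod (F (b + s *\<^sub>R z)))\<^sup>2)"
        using sum_squares_bound[of "cmod (F b)" "cmod (F (b + s *\<^sub>R z))"] by simp
      then show "ennreal (cmod (F b) * cmod (F (b + s *\<^sub>R z))) \<le>
          ennreal (1 / 2) * (ennreal ((cmod (F b))\<^sup>2) + ennreal ((cmod (F (b + s *\<^sub>R z)))\<^sup>2))"
        by (subst ennreal_plus[symmetric], simp, simp, subst ennreal_mult[symmetric]) (auto intro: ennreal_leI)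
    qed
    also have "\<dots> = ennreal (1 / 2) * (?N + ?N)"
      using F shift[of z] by (simp add: nn_integral_cmult nn_integral_add nn_integral_square_L2)
    also have "?N + ?N = ennreal (2 * (l2_norm lborel F)\<^sup>2)"
      by (simp flip: ennreal_plus)
    also have "ennreal (1 / 2) * \<dots> = ennreal (1 / 2 * (2 * (l2_norm lborel F)\<^sup>2))"
      by (rule ennreal_mult[symmetric]) auto
    also have "\<dots> = ?N" by simp
    finally show "(\<integral>\<^sup>+b. ennreal (2 * pi * gauss 1 z) * ennreal (cmod (F b) * cmod (F (b + s *\<^sub>R z))) \<partial>lborel) \<le>
        ennreal (2 * pi * gauss 1 z) * ?N"
      by (subst nn_integral_cmult) (auto intro: mult_left_mono)
  qed
  also have "\<dots> = ennreal ((2 * pi * l2_norm lborel F)\<^sup>2)"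
    by (subst nn_integral_multc) (auto simp: g power_mult_distrib simp flip: ennreal_mult)
  finally show ?thesis by (subst (asm) ennreal_le_iff) auto
qed

lemma gauss_tendsto: "(\<lambda>n. gauss (1 / real (Suc n)) x) \<longlonglongrightarrow> 1"
proof -
  have "(\<lambda>n. 1 / real (Suc n)) \<longlonglongrightarrow> 0" by (rule LIMSEQ_Suc[OF lim_1_over_n])
  then have "(\<lambda>n. exp (- (1 / real (Suc n) * norm x)\<^sup>2 / 2)) \<longlonglongrightarrow> exp (- (0 * norm x)\<^sup>2 / 2)"
    by (intro tendsto_intros) auto
  then show ?thesis by (simp add: gauss_def)
qed

text \<open>Fatou's lemma for Gaussian weights that increase to 1. The weighted integrals are pairings of
  \<open>F\<close> with its averages, hence bounded.\<close>

lemma ft_L2: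
  assumes F: "integrable lborel F" "F \<in> L2 lborel"
  shows "ft F \<in> L2 lborel" and "l2_norm lborel (ft F) \<le> 2 * pi * l2_norm lborel F"
proof -
  have Fm [measurable]: "F \<in> borel_measurable borel"
    using F by (auto dest: borel_measurable_integrable)
  have ftm [measurable]: "ft F \<in> borel_measurable borel" by (rule ft_measurable) simp
  let ?s = "\<lambda>n. 1 / real (Suc n)" and ?B = "ennreal ((2 * pi * l2_norm lborel F)\<^sup>2)"
  have "(\<integral>\<^sup>+x. ennreal ((cmod (ft F x))\<^sup>2) \<partial>lborel) =
      (\<integral>\<^sup>+x. liminf (\<lambda>n. ennreal ((cmod (ft F x))\<^sup>2 * gauss (?s n) x)) \<partial>lborel)"
  proof (rule nn_integral_cong)
    fix x
    have "(\<lambda>n. ennreal ((cmod (ft F x))\<^sup>2 * gauss (?s n) x)) \<longlonglongrightarrow> ennreal ((cmod (ft F x))\<^sup>2 * 1)"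
      by (intro tendsto_intros tendsto_ennrealI gauss_tendsto)
    then show "ennreal ((cmod (ft F x))\<^sup>2) = liminf (\<lambda>n. ennreal ((cmod (ft F x))\<^sup>2 * gauss (?s n) x))"
      by (intro lim_imp_Liminf[symmetric]) auto
  qed
  also have "\<dots> \<le> liminf (\<lambda>n. \<integral>\<^sup>+x. ennreal ((cmod (ft F x))\<^sup>2 * gauss (?s n) x) \<partial>lborel)"
    by (intro nn_integral_liminf) measurable
  also have "\<dots> \<le> liminf (\<lambda>n. ?B)"
  proof (intro Liminf_mono always_eventually allI)
    fix n
    have sq: "ft F x * cnj (ft F x) * of_real (gauss (?s n) x) = of_real ((cmod (ft F x))\<^sup>2 * gauss (?s n) x)" for x
      unfolding of_real_mult complex_norm_square ..
    have i: "integrable lborel (\<lambda>x. (cmod (ft F x))\<^sup>2 * gauss (?s n) x)"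
    proof (rule Bochner_Integration.integrable_bound)
      show "integrable lborel (\<lambda>x. (LINT b|lborel. cmod (F b))\<^sup>2 * gauss (?s n) x)"
        by (intro integrable_mult_right gaussian_integral) auto
      show "AE x in lborel. norm ((cmod (ft F x))\<^sup>2 * gauss (?s n) x) \<le> norm ((LINT b|lborel. cmod (F b))\<^sup>2 * gauss (?s n) x)"
        using ft_bound[OF F(1)] gauss_bounds(1)[of "?s n"]
        by (auto simp: abs_mult less_imp_le intro!: mult_right_mono power_mono)
    qed measurable
    have "(\<integral>\<^sup>+x. ennreal ((cmod (ft F x))\<^sup>2 * gauss (?s n) x) \<partial>lborel) =
        ennreal (LINT x|lborel. (cmod (ft F x))\<^sup>2 * gauss (?s n) x)"
      using gauss_bounds(1)[of "?s n"] by (intro nn_integral_eq_integral i) (auto simp: less_imp_le)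
    also have "(LINT x|lborel. (cmod (ft F x))\<^sup>2 * gauss (?s n) x) \<le>
        cmod (complex_of_real (LINT x|lborel. (cmod (ft F x))\<^sup>2 * gauss (?s n) x))"
      by simp
    also have "complex_of_real (LINT x|lborel. (cmod (ft F x))\<^sup>2 * gauss (?s n) x) =
        (LINT x|lborel. ft F x * cnj (ft F x) * of_real (gauss (?s n) x))"
      by (simp only: sq integral_complex_of_real)
    also have "\<dots> = (LINT b|lborel. F b * cnj (average (?s n) F b))"
      by (intro weighted_pairing F) auto
    also have "cmod \<dots> \<le> (2 * pi * l2_norm lborel F)\<^sup>2"
      by (intro average_pairing_bound F) auto
    finally show "(\<integral>\<^sup>+x. ennreal ((cmod (ft F x))\<^sup>2 * gauss (?s n) x) \<partial>lborel) \<le> ?B"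
      by (auto intro: ennreal_leI)
  qed
  also have "\<dots> = ?B" by (simp add: Liminf_const)
  finally have *: "(\<integral>\<^sup>+x. ennreal ((cmod (ft F x))\<^sup>2) \<partial>lborel) \<le> ?B" .
  then show L: "ft F \<in> L2 lborel"
    using ftm by (auto simp: L2_iff_nn_integral intro: le_less_trans)
  from * have "(l2_norm lborel (ft F))\<^sup>2 \<le> (2 * pi * l2_norm lborel F)\<^sup>2"
    unfolding nn_integral_square_L2[OF L] by (subst (asm) ennreal_le_iff) auto
  then show "l2_norm lborel (ft F) \<le> 2 * pi * l2_norm lborel F"
    by (rule power2_le_imp_le) simp
qed

text \<open>As the width tends to 0, the Gaussian weights on the transforms tend to 1, while the averages of
  the bounded continuous function \<open>G\<close> tend to \<open>(2 \<pi>)\<^sup>2 G\<close> pointwise; both integrals converge dominatedly.\<close>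

lemma ft_pairing_continuous:
  assumes F: "integrable lborel F" "F \<in> L2 lborel" and G: "integrable lborel G" "G \<in> L2 lborel"
    and cont: "continuous_on UNIV G" and bd: "\<And>b. cmod (G b) \<le> 1"
  shows "l2_inner lborel (ft F) (ft G) = of_real ((2 * pi)\<^sup>2) * l2_inner lborel F G"
proof -
  have Gm [measurable]: "G \<in> borel_measurable borel" and Fm [measurable]: "F \<in> borel_measurable borel"
    using F G by (auto dest: borel_measurable_integrable)
  have [measurable]: "ft G \<in> borel_measurable borel" "ft F \<in> borel_measurable borel"
    by (auto intro: ft_measurable)
  let ?s = "\<lambda>n. 1 / real (Suc n)"
  have s0: "?s \<longlonglongrightarrow> 0" by (rule LIMSEQ_Suc[OF lim_1_over_n])
  have gi: "integrable lborel (\<lambda>z. 2 * pi * gauss 1 z)"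
    by (intro integrable_mult_right gaussian_integral) auto
  have av: "(\<lambda>n. average (?s n) G b) \<longlonglongrightarrow> of_real ((2 * pi)\<^sup>2) * G b" for b
  proof -
    have "(\<lambda>n. average (?s n) G b) \<longlonglongrightarrow> (LINT z|lborel. of_real (2 * pi * gauss 1 z) * G b)"
      unfolding average_def
    proof (rule integral_dominated_convergence[where w = "\<lambda>z. 2 * pi * gauss 1 z"])
      show "AE z in lborel. (\<lambda>n. of_real (2 * pi * gauss 1 z) * G (b + ?s n *\<^sub>R z)) \<longlonglongrightarrow>
          of_real (2 * pi * gauss 1 z) * G b"
      proof (intro AE_I2 tendsto_mult tendsto_const)
        fix z
        have "(\<lambda>n. b + ?s n *\<^sub>R z) \<longlonglongrightarrow> b + 0 *\<^sub>R z" by (intro tendsto_intros s0)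
        then show "(\<lambda>n. G (b + ?s n *\<^sub>R z)) \<longlonglongrightarrow> G b"
          using continuous_on_tendsto_compose[OF cont, of _ b] by simp
      qed
      show "AE z in lborel. norm (of_real (2 * pi * gauss 1 z) * G (b + ?s n *\<^sub>R z)) \<le> 2 * pi * gauss 1 z" for n
        using bd gauss_bounds(1)[of 1] by (auto simp: norm_mult less_imp_le abs_mult intro!: mult_left_le)
    qed (use gi in measurable)
    also have "(LINT z|lborel. complex_of_real (2 * pi * gauss 1 z) * G b) =
        complex_of_real (LINT z|lborel. 2 * pi * gauss 1 z) * G b"
      unfolding integral_mult_left_zero integral_complex_of_real ..
    also have "(LINT z|lborel. 2 * pi * gauss 1 z) = (2 * pi)\<^sup>2"
      by (simp add: integral_gauss power2_eq_square)
    finally show ?thesis .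
  qed
  have avb: "cmod (average (?s n) G b) \<le> (2 * pi)\<^sup>2" for n b
  proof -
    have "cmod (average (?s n) G b) \<le> (LINT z|lborel. cmod (of_real (2 * pi * gauss 1 z) * G (b + ?s n *\<^sub>R z)))"
      unfolding average_def by (rule integral_norm_bound)
    also have "\<dots> \<le> (LINT z|lborel. 2 * pi * gauss 1 z)"
    proof (rule integral_mono_AE[OF _ gi])
      show "AE z in lborel. cmod (of_real (2 * pi * gauss 1 z) * G (b + ?s n *\<^sub>R z)) \<le> 2 * pi * gauss 1 z"
        using bd gauss_bounds(1)[of 1] by (auto simp: norm_mult less_imp_le abs_mult intro!: mult_left_le)
      then show "integrable lborel (\<lambda>z. cmod (of_real (2 * pi * gauss 1 z) * G (b + ?s n *\<^sub>R z)))"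
        by (intro Bochner_Integration.integrable_bound[OF gi]) (auto elim!: eventually_mono)
    qed
    also have "\<dots> = (2 * pi)\<^sup>2"
      by (simp add: integral_gauss power2_eq_square)
    finally show ?thesis .
  qed
  have avm [measurable]: "average (?s n) G \<in> borel_measurable borel" for n
  proof -
    have "(\<lambda>b. LINT z|lborel. of_real (2 * pi * gauss 1 z) * G (b + ?s n *\<^sub>R z)) \<in> borel_measurable lborel"
      by (rule lborel.borel_measurable_lebesgue_integral) measurable
    then show ?thesis by (simp add: average_def[abs_def])
  qed
  have "(\<lambda>n. LINT b|lborel. F b * cnj (average (?s n) G b)) \<longlonglongrightarrow>
      (LINT b|lborel. F b * cnj (of_real ((2 * pi)\<^sup>2) * G b))"
  proof (rule integral_dominated_convergence[where w = "\<lambda>b. (2 * pi)\<^sup>2 * cmod (F b)"])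
    show "AE b in lborel. (\<lambda>n. F b * cnj (average (?s n) G b)) \<longlonglongrightarrow> F b * cnj (of_real ((2 * pi)\<^sup>2) * G b)"
      by (intro AE_I2 tendsto_mult tendsto_const tendsto_cnj av)
    show "AE b in lborel. norm (F b * cnj (average (?s n) G b)) \<le> (2 * pi)\<^sup>2 * cmod (F b)" for n
    proof (rule AE_I2)
      fix b
      have "cmod (F b) * cmod (average (?s n) G b) \<le> cmod (F b) * (2 * pi)\<^sup>2"
        by (intro mult_left_mono avb) auto
      then show "norm (F b * cnj (average (?s n) G b)) \<le> (2 * pi)\<^sup>2 * cmod (F b)"
        by (simp only: norm_mult complex_mod_cnj mult.commute)
    qed
    show "integrable lborel (\<lambda>b. (2 * pi)\<^sup>2 * cmod (F b))"
      using F by auto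
  qed measurable
  moreover have "(\<lambda>n. LINT x|lborel. ft F x * cnj (ft G x) * of_real (gauss (?s n) x)) \<longlonglongrightarrow>
      (LINT x|lborel. ft F x * cnj (ft G x))"
  proof (rule integral_dominated_convergence[where w = "\<lambda>x. cmod (ft F x * cnj (ft G x))"])
    show "AE x in lborel. (\<lambda>n. ft F x * cnj (ft G x) * of_real (gauss (?s n) x)) \<longlonglongrightarrow> ft F x * cnj (ft G x)"
    proof (rule AE_I2)
      fix x
      have "(\<lambda>n. ft F x * cnj (ft G x) * of_real (gauss (?s n) x)) \<longlonglongrightarrow> ft F x * cnj (ft G x) * of_real 1"
        by (intro tendsto_mult tendsto_const tendsto_of_real gauss_tendsto)
      then show "(\<lambda>n. ft F x * cnj (ft G x) * of_real (gauss (?s n) x)) \<longlonglongrightarrow> ft F x * cnj (ft G x)" by simp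
    qed
    show "AE x in lborel. norm (ft F x * cnj (ft G x) * of_real (gauss (?s n) x)) \<le> cmod (ft F x * cnj (ft G x))" for n
      using gauss_bounds[of "?s n"] by (auto simp: norm_mult less_imp_le intro!: mult_left_le)
    show "integrable lborel (\<lambda>x. cmod (ft F x * cnj (ft G x)))"
      by (intro integrable_norm L2_inner_integrable ft_L2 F G)
  qed measurable
  ultimately have "(LINT x|lborel. ft F x * cnj (ft G x)) = (LINT b|lborel. F b * cnj (of_real ((2 * pi)\<^sup>2) * G b))"
    by (subst (asm) weighted_pairing[OF F(1) G(1)]) (auto intro: LIMSEQ_unique)
  also have "\<dots> = (LINT b|lborel. of_real ((2 * pi)\<^sup>2) * (F b * cnj (G b)))"
    by (simp add: mult_ac)
  finally show ?thesis
    unfolding l2_inner_def integral_mult_right_zero .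
qed

lemma restrict_space_lborel_UNIV: "restrict_space lborel UNIV = lborel"
  by (intro measure_eqI) (auto simp: sets_restrict_space emeasure_restrict_space)

text \<open>The functions \<open>G\<close> whose pairing with every \<open>F\<close> is preserved form a subspace \<open>V\<close> that contains all
  functions \<open>bump\<close>, hence an orthonormal basis. Expanding \<open>F\<close> in this basis and passing to the
  limit with the bound of \<open>ft_L2\<close> shows that the pairing of \<open>F\<close> with itself is preserved.\<close>

theorem plancherel:
  assumes F: "integrable lborel F" "F \<in> L2 lborel"
  shows "(l2_norm lborel (ft F))\<^sup>2 = (2 * pi * l2_norm lborel F)\<^sup>2"
proof -
  define V where "V = {G \<in> L2 lborel. integrable lborel G \<and> (\<forall>F. integrable lborel F \<and> F \<in> L2 lborel \<longrightarrow>
      l2_inner lborel (ft F) (ft G) = of_real ((2 * pi)\<^sup>2) * l2_inner lborel F G)}"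
  have comb: "(\<lambda>x. f x + c * g x) \<in> V" if f: "f \<in> V" and g: "g \<in> V" for f g c
  proof -
    from f g have L: "f \<in> L2 lborel" "g \<in> L2 lborel" and I: "integrable lborel f" "integrable lborel g"
      by (auto simp: V_def)
    have "l2_inner lborel (ft F) (ft (\<lambda>x. f x + c * g x)) = of_real ((2 * pi)\<^sup>2) * l2_inner lborel F (\<lambda>x. f x + c * g x)"
      if F: "integrable lborel F" "F \<in> L2 lborel" for F
    proof -
      have "l2_inner lborel (ft F) (ft (\<lambda>x. f x + c * g x)) = l2_inner lborel (ft F) (ft f) + cnj c * l2_inner lborel (ft F) (ft g)"
        unfolding ft_add_cmult[OF I, abs_def]
        by (subst l2_inner_add_right) (auto simp: l2_inner_cmult_right intro!: ft_L2 F L I L2_cmult)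
      also have "\<dots> = of_real ((2 * pi)\<^sup>2) * (l2_inner lborel F f + cnj c * l2_inner lborel F g)"
        using f g F by (simp add: V_def algebra_simps)
      also have "l2_inner lborel F f + cnj c * l2_inner lborel F g = l2_inner lborel F (\<lambda>x. f x + c * g x)"
        using L F by (subst l2_inner_add_right) (auto simp: l2_inner_cmult_right)
      finally show ?thesis .
    qed
    then show ?thesis using L I by (auto simp: V_def)
  qed
  have "(\<lambda>x. 0) \<in> V"
    by (simp add: V_def ft_def[abs_def])
  then have smult: "(\<lambda>x. c * g x) \<in> V" if "g \<in> V" for g c
    using comb[of "\<lambda>x. 0" g c] that by simp
  have add: "(\<lambda>x. f x + g x) \<in> V" if "f \<in> V" "g \<in> V" for f g
    using comb[of f g 1] that by simp
  have bumpV: "bump U k \<in> V" if U: "open U" "bounded U" for U k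
  proof -
    have Um: "U \<in> sets borel" using U by simp
    have bm: "bump U k \<in> borel_measurable borel"
      by (intro borel_measurable_continuous_onI continuous_bump)
    have ind: "integrable lborel (\<lambda>x. indicator U x :: real)"
      using emeasure_bounded_finite[OF U(2)] Um by (intro integrable_real_indicator) auto
    have L1: "integrable lborel (bump U k)"
      by (rule Bochner_Integration.integrable_bound[OF ind]) (use bm norm_bump_le[of U k] in auto)
    have le1: "cmod (bump U k x) \<le> 1" for x
      by (auto simp: bump_def infdist_nonneg)
    have "(cmod (bump U k x))\<^sup>2 \<le> indicator U x" for x
    proof -
      have "(cmod (bump U k x))\<^sup>2 \<le> cmod (bump U k x)"
        using le1[of x] by (simp add: power2_eq_square mult_left_le)
      then show ?thesis using norm_bump_le[of U k x] by simp
    qed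
    then have "integrable lborel (\<lambda>x. (cmod (bump U k x))\<^sup>2)"
      by (intro Bochner_Integration.integrable_bound[OF ind]) (use bm in auto)
    with bm have L2: "bump U k \<in> L2 lborel" by (simp add: L2_def)
    show ?thesis
      unfolding V_def
      using L1 L2 ft_pairing_continuous[OF _ _ L1 L2 continuous_bump le1] by blast
  qed
  have "\<exists>e. is_onb (restrict_space lborel UNIV) e \<and> (\<forall>n. e n \<in> V)"
    by (rule onb_exists_open) (auto simp: restrict_space_lborel_UNIV intro: add smult bumpV, auto simp: V_def)
  then obtain e where e: "is_onb lborel e" and eV: "\<And>n. e n \<in> V"
    by (auto simp: restrict_space_lborel_UNIV)
  let ?s = "\<lambda>N. expansion lborel e N F"
  have sV: "?s N \<in> V" for N
  proof (induction N)
    case 0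
    then show ?case using \<open>(\<lambda>x. 0) \<in> V\<close> by (simp add: expansion_def[abs_def])
  next
    case (Suc N)
    from comb[OF this eV] show ?case by (simp add: expansion_def[abs_def])
  qed
  have sL: "?s N \<in> L2 lborel" "integrable lborel (?s N)" for N
    using sV[of N] by (auto simp: V_def)
  have lim: "(\<lambda>N. l2_norm lborel (\<lambda>x. ?s N x - F x)) \<longlonglongrightarrow> 0"
    using expansion_converges[OF e F(2)] by (simp add: l2_norm_minus_commute)
  have lim_ft: "(\<lambda>N. l2_norm lborel (\<lambda>x. ft (?s N) x - ft F x)) \<longlonglongrightarrow> 0"
  proof (rule tendsto_sandwich[OF _ _ tendsto_const])
    have "(\<lambda>N. 2 * pi * l2_norm lborel (\<lambda>x. ?s N x - F x)) \<longlonglongrightarrow> 2 * pi * 0"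
      by (intro tendsto_mult tendsto_const lim)
    then show "(\<lambda>N. 2 * pi * l2_norm lborel (\<lambda>x. ?s N x - F x)) \<longlonglongrightarrow> 0" by simp
    have "l2_norm lborel (\<lambda>x. ft (?s N) x - ft F x) \<le> 2 * pi * l2_norm lborel (\<lambda>x. ?s N x - F x)" for N
    proof -
      have "ft (\<lambda>x. ?s N x - F x) = (\<lambda>x. ft (?s N) x - ft F x)"
        using ft_add_cmult[OF sL(2)[of N] F(1), of "-1"] by (auto simp: fun_eq_iff)
      with ft_L2(2)[OF Bochner_Integration.integrable_diff[OF sL(2)[of N] F(1)] L2_diff[OF sL(1)[of N] F(2)]]
      show ?thesis by simp
    qed
    then show "\<forall>\<^sub>F N in sequentially. l2_norm lborel (\<lambda>x. ft (?s N) x - ft F x) \<le> 2 * pi * l2_norm lborel (\<lambda>x. ?s N x - F x)"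
      by (rule always_eventually[OF allI])
  qed simp
  have "(\<lambda>N. l2_inner lborel (ft F) (ft (?s N))) \<longlonglongrightarrow> l2_inner lborel (ft F) (ft F)"
    by (rule tendsto_l2_inner[OF _ _ _ _ _ lim_ft]) (auto intro!: ft_L2 F sL)
  moreover have "l2_inner lborel (ft F) (ft (?s N)) = of_real ((2 * pi)\<^sup>2) * l2_inner lborel F (?s N)" for N
    using sV[of N] F by (simp add: V_def)
  moreover have "(\<lambda>N. of_real ((2 * pi)\<^sup>2) * l2_inner lborel F (?s N)) \<longlonglongrightarrow> of_real ((2 * pi)\<^sup>2) * l2_inner lborel F F"
    by (intro tendsto_mult tendsto_const tendsto_l2_inner[OF _ _ _ _ _ lim]) (auto intro!: F sL)
  ultimately have "l2_inner lborel (ft F) (ft F) = of_real ((2 * pi)\<^sup>2) * l2_inner lborel F F"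
    by (simp add: LIMSEQ_unique)
  then have "complex_of_real ((l2_norm lborel (ft F))\<^sup>2) = of_real ((2 * pi * l2_norm lborel F)\<^sup>2)"
    unfolding l2_inner_self by (simp only: power_mult_distrib of_real_mult)
  then show ?thesis by (simp only: of_real_eq_iff)
qed

section \<open>Light-cone coordinates\<close>

text \<open>The point with light-cone coordinates \<open>x\<^sub>1 + x\<^sub>2 = u\<close> and \<open>x\<^sub>1 - x\<^sub>2 = v\<close>. These coordinates
  diagonalise all boosts and turn the four cones into the four open quadrants.\<close>

definition lc :: "real \<Rightarrow> real \<Rightarrow> real^2" where
  "lc u v = vec2 ((u + v) / 2, (u - v) / 2)"

lemma lc_self: "lc (x $ 1 + x $ 2) (x $ 1 - x $ 2) = x"
  by (simp add: lc_def vec_eq_iff forall_2)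

lemma lc_cases: obtains u v where "x = lc u v"
  using lc_self[of x] by metis

lemma boost_lc: "boost t *v lc u v = lc (exp t * u) (exp (- t) * v)"
  by (simp add: lc_def boost_def vec_eq_iff forall_2 matrix_vector_mult_def sum_2 cosh_def sinh_def)
     (simp add: field_simps)

lemma scaleR_lc: "c *\<^sub>R lc u v = lc (c * u) (c * v)"
  by (simp add: lc_def vec_eq_iff forall_2 algebra_simps)

lemma lc_add: "lc u v + lc u' v' = lc (u + u') (v + v')"
  by (simp add: lc_def vec_eq_iff forall_2 field_simps)

lemma mink_lc: "mink (lc u v) (lc u v) = u * v"
  by (simp add: mink_def lc_def field_simps)

lemma borel_measurable_lc [measurable]:
  assumes [measurable]: "f \<in> borel_measurable M" "g \<in> borel_measurable M"
  shows "(\<lambda>x. lc (f x) (g x)) \<in> borel_measurable M"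
  unfolding lc_def
  by (intro measurable_compose[OF _ borel_measurable_vec2] borel_measurable_Pair
      borel_measurable_divide borel_measurable_add borel_measurable_diff borel_measurable_const assms)

lemma borel_measurable_boost [measurable]:
  assumes [measurable]: "f \<in> borel_measurable M" "g \<in> borel_measurable M"
  shows "(\<lambda>x. boost (f x) *v g x) \<in> borel_measurable M"
proof -
  have [measurable]: "(\<lambda>x. g x $ i) \<in> borel_measurable M" for i
    by (rule measurable_compose[OF _ borel_measurable_nth]) measurable
  have "boost s *v x = lc (exp s * (x $ 1 + x $ 2)) (exp (- s) * (x $ 1 - x $ 2))" for s x
    using boost_lc[of s "x $ 1 + x $ 2" "x $ 1 - x $ 2"] unfolding lc_self .
  then show ?thesis by simp
qed

text \<open>The shear \<open>y = x - v\<close>, then the substitution \<open>x = (u + v) / 2\<close> for fixed \<open>v\<close>.\<close>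

lemma nn_integral_lc:
  assumes [measurable]: "f \<in> borel_measurable borel"
  shows "(\<integral>\<^sup>+x. f x \<partial>lborel) = ennreal (1 / 2) * (\<integral>\<^sup>+u. \<integral>\<^sup>+v. f (lc u v) \<partial>lborel \<partial>lborel)"
proof -
  have "(\<integral>\<^sup>+x. f x \<partial>lborel) = (\<integral>\<^sup>+x. \<integral>\<^sup>+y. f (vec2 (x, y)) \<partial>lborel \<partial>lborel)"
    by (rule nn_integral_vec2) simp
  also have "\<dots> = (\<integral>\<^sup>+x. \<integral>\<^sup>+v. f (vec2 (x, x - v)) \<partial>lborel \<partial>lborel)"
  proof (rule nn_integral_cong)
    fix x
    show "(\<integral>\<^sup>+y. f (vec2 (x, y)) \<partial>lborel) = (\<integral>\<^sup>+v. f (vec2 (x, x - v)) \<partial>lborel)"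
      by (subst nn_integral_real_affine[where c = "-1" and t = x]) auto
  qed
  also have "\<dots> = (\<integral>\<^sup>+v. \<integral>\<^sup>+x. f (vec2 (x, x - v)) \<partial>lborel \<partial>lborel)"
    by (rule lborel_pair.Fubini') measurable
  also have "\<dots> = (\<integral>\<^sup>+v. ennreal (1 / 2) * (\<integral>\<^sup>+u. f (lc u v) \<partial>lborel) \<partial>lborel)"
  proof (rule nn_integral_cong)
    fix v
    have "(\<integral>\<^sup>+x. f (vec2 (x, x - v)) \<partial>lborel) =
        ennreal \<bar>1 / 2\<bar> * (\<integral>\<^sup>+u. f (vec2 (v / 2 + 1 / 2 * u, v / 2 + 1 / 2 * u - v)) \<partial>lborel)"
      by (rule nn_integral_real_affine) auto
    also have "(\<lambda>u. vec2 (v / 2 + 1 / 2 * u, v / 2 + 1 / 2 * u - v)) = (\<lambda>u. lc u v)"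
      by (auto simp: lc_def vec_eq_iff forall_2 field_simps)
    then have "(\<integral>\<^sup>+u. f (vec2 (v / 2 + 1 / 2 * u, v / 2 + 1 / 2 * u - v)) \<partial>lborel) = (\<integral>\<^sup>+u. f (lc u v) \<partial>lborel)"
      by (simp add: fun_eq_iff)
    finally show "(\<integral>\<^sup>+x. f (vec2 (x, x - v)) \<partial>lborel) = ennreal (1 / 2) * (\<integral>\<^sup>+u. f (lc u v) \<partial>lborel)"
      by simp
  qed
  also have "\<dots> = ennreal (1 / 2) * (\<integral>\<^sup>+v. \<integral>\<^sup>+u. f (lc u v) \<partial>lborel \<partial>lborel)"
    by (rule nn_integral_cmult) measurable
  also have "(\<integral>\<^sup>+v. \<integral>\<^sup>+u. f (lc u v) \<partial>lborel \<partial>lborel) = (\<integral>\<^sup>+u. \<integral>\<^sup>+v. f (lc u v) \<partial>lborel \<partial>lborel)"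
    by (rule lborel_pair.Fubini'[symmetric]) measurable
  finally show ?thesis .
qed

text \<open>In light-cone coordinates the two axes are scaled by \<open>a e\<^sup>t\<close> and \<open>a e\<^sup>-\<^sup>t\<close>.\<close>

lemma nn_integral_boost:
  assumes [measurable]: "f \<in> borel_measurable borel" and a: "a > 0"
  shows "(\<integral>\<^sup>+x. f x \<partial>lborel) = ennreal (a\<^sup>2) * (\<integral>\<^sup>+x. f (b + a *\<^sub>R (boost t *v x)) \<partial>lborel)"
proof -
  obtain \<beta> \<gamma> where b: "b = lc \<beta> \<gamma>" by (rule lc_cases)
  have "(\<integral>\<^sup>+x. f x \<partial>lborel) = ennreal (1 / 2) * (\<integral>\<^sup>+u. \<integral>\<^sup>+v. f (lc u v) \<partial>lborel \<partial>lborel)"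
    by (rule nn_integral_lc) simp
  also have "(\<integral>\<^sup>+u. \<integral>\<^sup>+v. f (lc u v) \<partial>lborel \<partial>lborel) =
      ennreal \<bar>a * exp t\<bar> * (\<integral>\<^sup>+u. \<integral>\<^sup>+v. f (lc (\<beta> + a * exp t * u) v) \<partial>lborel \<partial>lborel)"
    using a by (intro nn_integral_real_affine) auto
  also have "(\<integral>\<^sup>+u. \<integral>\<^sup>+v. f (lc (\<beta> + a * exp t * u) v) \<partial>lborel \<partial>lborel) =
      (\<integral>\<^sup>+u. ennreal \<bar>a * exp (- t)\<bar> * (\<integral>\<^sup>+v. f (lc (\<beta> + a * exp t * u) (\<gamma> + a * exp (- t) * v)) \<partial>lborel) \<partial>lborel)"
    using a by (intro nn_integral_cong nn_integral_real_affine) auto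
  also have "\<dots> = ennreal \<bar>a * exp (- t)\<bar> * (\<integral>\<^sup>+u. \<integral>\<^sup>+v. f (lc (\<beta> + a * exp t * u) (\<gamma> + a * exp (- t) * v)) \<partial>lborel \<partial>lborel)"
    by (rule nn_integral_cmult) measurable
  also have "ennreal (1 / 2) * (ennreal \<bar>a * exp t\<bar> * (ennreal \<bar>a * exp (- t)\<bar> *
        (\<integral>\<^sup>+u. \<integral>\<^sup>+v. f (lc (\<beta> + a * exp t * u) (\<gamma> + a * exp (- t) * v)) \<partial>lborel \<partial>lborel))) =
      (ennreal \<bar>a * exp t\<bar> * ennreal \<bar>a * exp (- t)\<bar>) * (ennreal (1 / 2) *
        (\<integral>\<^sup>+u. \<integral>\<^sup>+v. f (lc (\<beta> + a * exp t * u) (\<gamma> + a * exp (- t) * v)) \<partial>lborel \<partial>lborel))"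
    by (simp only: mult_ac)
  also have "ennreal \<bar>a * exp t\<bar> * ennreal \<bar>a * exp (- t)\<bar> = ennreal (a\<^sup>2)"
    using a by (simp add: exp_minus power2_eq_square abs_mult flip: ennreal_mult)
  also have "ennreal (1 / 2) * (\<integral>\<^sup>+u. \<integral>\<^sup>+v. f (lc (\<beta> + a * exp t * u) (\<gamma> + a * exp (- t) * v)) \<partial>lborel \<partial>lborel) =
      (\<integral>\<^sup>+x. f (b + a *\<^sub>R (boost t *v x)) \<partial>lborel)"
    by (subst nn_integral_lc) (auto simp: b boost_lc scaleR_lc lc_add mult.assoc)
  finally show ?thesis .
qed

text \<open>Substitution on the intervals from \<open>-n\<close> to \<open>n\<close>, whose images exhaust the positive half-line.\<close>

lemma nn_integral_exp:
  assumes [measurable]: "f \<in> borel_measurable borel"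
  shows "(\<integral>\<^sup>+y. f y * indicator {0<..} y \<partial>lborel) = (\<integral>\<^sup>+t. f (exp t) * ennreal (exp t) \<partial>lborel)"
proof -
  have "density lborel (indicator {0<..}) = distr (density lborel (\<lambda>t. ennreal (exp t))) borel exp"
  proof (rule measure_eqI)
    fix A :: "real set" assume "A \<in> sets (density lborel (indicator {0<..}))"
    then have [measurable]: "A \<in> sets borel" by simp
    let ?I = "\<lambda>n. {- real n..real n}" and ?J = "\<lambda>n. {exp (- real n)..exp (real n)}"
    have sub: "(\<integral>\<^sup>+y. indicator A y * indicator (?J n) y \<partial>lborel) =
        (\<integral>\<^sup>+t. indicator A (exp t) * ennreal (exp t) * indicator (?I n) t \<partial>lborel)" for n
    proof -
      have "(\<integral>\<^sup>+y. indicator A y * indicator (?J n) y \<partial>lborel) =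
          (\<integral>\<^sup>+y. ennreal (indicator A y * indicator (?J n) y) \<partial>lborel)"
        by (intro nn_integral_cong) (auto simp: indicator_def)
      also have "\<dots> = (\<integral>\<^sup>+t. ennreal (indicator A (exp t) * exp t * indicator (?I n) t) \<partial>lborel)"
        by (rule nn_integral_substitution)
          (auto simp: set_borel_measurable_def intro: DERIV_exp continuous_on_exp continuous_on_id)
      also have "\<dots> = (\<integral>\<^sup>+t. indicator A (exp t) * ennreal (exp t) * indicator (?I n) t \<partial>lborel)"
        by (intro nn_integral_cong) (auto simp: indicator_def)
      finally show ?thesis .
    qed
    have "\<exists>n. - real n \<le> ln y \<and> ln y \<le> real n" for y :: real
    proof -
      obtain n :: nat where "\<bar>ln y\<bar> \<le> real n" using real_arch_simple by blast
      then show ?thesis by (intro exI[of _ n]) auto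
    qed
    then have UJ: "(\<Union>n. ?J n) = {0<..}"
    proof (intro equalityI subsetI)
      fix y :: real assume y: "y \<in> {0<..}"
      obtain n where n: "- real n \<le> ln y" "ln y \<le> real n" using \<open>\<And>y. \<exists>n. _ y n\<close> by blast
      have "exp (- real n) \<le> y" "y \<le> exp (real n)"
        using n y by (metis exp_le_cancel_iff exp_ln greaterThan_iff)+
      then show "y \<in> (\<Union>n. ?J n)" by auto
    qed (auto intro: less_le_trans[OF exp_gt_zero])
    have UI: "(\<Union>n. ?I n) = (UNIV :: real set)"
    proof (intro equalityI subsetI)
      fix y :: real
      obtain n :: nat where "\<bar>y\<bar> \<le> real n" using real_arch_simple by blast
      then show "y \<in> (\<Union>n. ?I n)" by (auto intro!: exI[of _ n])
    qed auto
    have "emeasure (density lborel (indicator {0<..})) A = (\<integral>\<^sup>+y. indicator A y * indicator {0<..} y \<partial>lborel)"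
      by (simp add: emeasure_density mult.commute)
    also have "\<dots> = emeasure (density lborel (indicator A)) (\<Union>n. ?J n)"
      by (simp add: emeasure_density UJ)
    also have "\<dots> = (SUP n. emeasure (density lborel (indicator A)) (?J n))"
      by (intro SUP_emeasure_incseq[symmetric]) (auto simp: incseq_def)
    also have "\<dots> = (SUP n. emeasure (density lborel (\<lambda>t. indicator A (exp t) * ennreal (exp t))) (?I n))"
      by (simp add: emeasure_density sub)
    also have "\<dots> = emeasure (density lborel (\<lambda>t. indicator A (exp t) * ennreal (exp t))) (\<Union>n. ?I n)"
      by (intro SUP_emeasure_incseq) (auto simp: incseq_def)
    also have "\<dots> = emeasure (distr (density lborel (\<lambda>t. ennreal (exp t))) borel exp) A"
    proof -
      have "exp -` A \<in> sets borel" by (rule measurable_sets_borel[where M = borel]) auto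
      then show ?thesis
        unfolding UI by (subst emeasure_distr) (auto simp: emeasure_density indicator_def intro!: nn_integral_cong)
    qed
    finally show "emeasure (density lborel (indicator {0<..})) A =
        emeasure (distr (density lborel (\<lambda>t. ennreal (exp t))) borel exp) A" .
  qed simp
  then have "(\<integral>\<^sup>+y. f y \<partial>density lborel (indicator {0<..})) =
      (\<integral>\<^sup>+y. f y \<partial>distr (density lborel (\<lambda>t. ennreal (exp t))) borel exp)"
    by simp
  then show ?thesis
    by (simp add: nn_integral_density nn_integral_distr mult.commute)
qed

section \<open>Haar measure as a product\<close>

definition half_plane :: "(real \<times> real) set" where
  "half_plane = {(a, t). a > 0}"

text \<open>The factor of the Haar measure that belongs to the scale and the rapidity.\<close>

definition scale :: "(real \<times> real) measure" where
  "scale = density (restrict_space lborel half_plane) (\<lambda>(a, t). ennreal (1 / a ^ 3))"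

lemma half_plane_borel [measurable]: "half_plane \<in> sets borel"
  unfolding half_plane_def case_prod_unfold
  by (intro borel_open open_Collect_less continuous_intros)

lemma borel_measurable_weight: "(\<lambda>(a, t). ennreal (1 / a ^ 3)) \<in> borel_measurable borel"
  unfolding case_prod_unfold
  by (intro measurable_compose[OF borel_measurable_continuous_onI[of fst]] continuous_intros) measurable

lemma space_scale: "space scale = half_plane"
  by (simp add: scale_def space_restrict_space)

lemma sets_scale [measurable_cong]: "sets scale = sets (restrict_space borel half_plane)"
  by (simp add: scale_def sets_restrict_space)

lemma carrier_Poincare: "carrier Poincare = UNIV \<times> half_plane"
  by (auto simp: Poincare_def half_plane_def)

lemma open_half_plane: "open half_plane"
  unfolding half_plane_def case_prod_unfold by (intro open_Collect_less continuous_intros)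

lemma carrier_borel [measurable]: "carrier Poincare \<in> sets borel"
  unfolding carrier_Poincare by (intro borel_open open_Times open_UNIV open_half_plane)

lemma space_haar: "space haar = carrier Poincare"
  by (simp add: haar_def space_restrict_space)

lemma sets_haar: "sets haar = sets (restrict_space borel (carrier Poincare))"
  by (simp add: haar_def sets_restrict_space)

lemma nn_integral_scale:
  assumes "f \<in> borel_measurable scale"
  shows "(\<integral>\<^sup>+n. f n \<partial>scale) =
    (\<integral>\<^sup>+a. \<integral>\<^sup>+t. ennreal (1 / a ^ 3) * f (a, t) * indicator {0<..} a \<partial>lborel \<partial>lborel)"
proof -
  have f: "f \<in> borel_measurable (restrict_space lborel half_plane)"
    using assms by (simp add: scale_def)
  then have g: "(\<lambda>n. f n * indicator half_plane n) \<in> borel_measurable borel"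
    by (subst (asm) borel_measurable_restrict_space_iff_ennreal) auto
  have w: "(\<lambda>(a, t). ennreal (1 / a ^ 3)) \<in> borel_measurable (restrict_space lborel half_plane)"
    by (intro measurable_restrict_space1) (simp add: borel_measurable_weight)
  have "(\<integral>\<^sup>+n. f n \<partial>scale) =
      (\<integral>\<^sup>+n. (case n of (a, t) \<Rightarrow> ennreal (1 / a ^ 3)) * f n * indicator half_plane n \<partial>lborel)"
    unfolding scale_def using f w by (subst nn_integral_density) (auto simp: nn_integral_restrict_space)
  also have "\<dots> = (\<integral>\<^sup>+n. (case n of (a, t) \<Rightarrow> ennreal (1 / a ^ 3)) * (f n * indicator half_plane n) \<partial>(lborel \<Otimes>\<^sub>M lborel))"
    by (simp add: lborel_prod mult.assoc)
  also have "\<dots> = (\<integral>\<^sup>+a. \<integral>\<^sup>+t. ennreal (1 / a ^ 3) * (f (a, t) * indicator half_plane (a, t)) \<partial>lborel \<partial>lborel)"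
    using borel_measurable_times_ennreal[OF borel_measurable_weight g]
    by (subst lborel.nn_integral_fst[symmetric]) (simp_all add: lborel_prod)
  also have "\<dots> = (\<integral>\<^sup>+a. \<integral>\<^sup>+t. ennreal (1 / a ^ 3) * f (a, t) * indicator {0<..} a \<partial>lborel \<partial>lborel)"
    by (intro nn_integral_cong) (auto simp: half_plane_def indicator_def)
  finally show ?thesis .
qed

lemma sigma_finite_scale: "sigma_finite_measure scale"
proof -
  interpret R: sigma_finite_measure "restrict_space lborel half_plane"
    by (intro sigma_finite_measure_restrict_space sigma_finite_lborel) simp
  show ?thesis
    unfolding scale_def
    by (subst R.sigma_finite_iff_density_finite)
      (auto intro!: measurable_restrict_space1 simp: borel_measurable_weight split: prod.split)
qed

lemma haar_eq: "haar = lborel \<Otimes>\<^sub>M scale"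
proof (rule pair_measure_eqI[symmetric])
  show "sigma_finite_measure lborel" by (rule sigma_finite_lborel)
  show "sigma_finite_measure scale" by (rule sigma_finite_scale)
  show "sets (lborel \<Otimes>\<^sub>M scale) = sets haar"
  proof (rule antisym)
    show "sets (lborel \<Otimes>\<^sub>M scale) \<subseteq> sets haar"
    proof (rule sets_pair_in_sets)
      fix A B assume A: "A \<in> sets (lborel :: (real^2) measure)" and B: "B \<in> sets scale"
      then obtain B' where B': "B = half_plane \<inter> B'" "B' \<in> sets borel"
        by (auto simp: sets_scale sets_restrict_space)
      have "A \<times> B' \<in> sets borel"
        using A B' by (simp add: borel_prod[symmetric])
      moreover have "A \<times> B = carrier Poincare \<inter> (A \<times> B')"
        using B' by (auto simp: carrier_Poincare)
      ultimately show "A \<times> B \<in> sets haar"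
        by (auto simp: sets_haar sets_restrict_space)
    qed
    show "sets haar \<subseteq> sets (lborel \<Otimes>\<^sub>M scale)"
    proof
      fix A assume "A \<in> sets haar"
      then obtain A' where A': "A = carrier Poincare \<inter> A'" "A' \<in> sets borel"
        by (auto simp: sets_haar sets_restrict_space)
      have "snd \<in> measurable ((lborel :: (real^2) measure) \<Otimes>\<^sub>M scale) borel"
        by (rule measurable_compose[OF measurable_snd])
          (auto intro: measurable_restrict_space1 simp: measurable_cong_sets[OF sets_scale refl])
      then have "(\<lambda>z. (fst z, snd z)) \<in> measurable ((lborel :: (real^2) measure) \<Otimes>\<^sub>M scale) (borel \<Otimes>\<^sub>M borel)"
        by (intro measurable_Pair) auto
      then have "(\<lambda>z. z) -` A' \<inter> space (lborel \<Otimes>\<^sub>M scale) \<in> sets (lborel \<Otimes>\<^sub>M scale)"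
        using A'(2) by (intro measurable_sets[where A = borel]) (auto simp: borel_prod)
      then show "A \<in> sets (lborel \<Otimes>\<^sub>M scale)"
        using A'(1) by (simp add: space_pair_measure space_scale carrier_Poincare Int_commute)
    qed
  qed
  fix A B assume A: "A \<in> sets (lborel :: (real^2) measure)" and B: "B \<in> sets scale"
  then have AB: "A \<in> sets borel" "B \<in> sets borel" "B \<subseteq> half_plane"
    by (auto simp: sets_scale sets_restrict_space)
  have [measurable]: "A \<in> sets borel" "B \<in> sets borel" by fact+
  have w: "(\<lambda>(b, a, t). ennreal (1 / a ^ 3)) \<in> borel_measurable (borel :: poincare measure)"
    using measurable_compose[OF borel_measurable_continuous_onI[of snd] borel_measurable_weight]
    by (simp add: case_prod_unfold continuous_intros)
  have ABm: "A \<times> B \<in> sets borel" using AB by (simp add: borel_prod[symmetric])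
  have "A \<times> B = carrier Poincare \<inter> (A \<times> B)" using AB by (auto simp: carrier_Poincare)
  then have "A \<times> B \<in> sets haar" using ABm by (auto simp: sets_haar sets_restrict_space)
  then have "emeasure haar (A \<times> B) =
      (\<integral>\<^sup>+z. (case z of (b, a, t) \<Rightarrow> ennreal (1 / a ^ 3)) * indicator (A \<times> B) z \<partial>restrict_space lborel (carrier Poincare))"
    unfolding haar_def using w by (subst emeasure_density) (auto intro: measurable_restrict_space1)
  also have "\<dots> = (\<integral>\<^sup>+z. (case z of (b, a, t) \<Rightarrow> ennreal (1 / a ^ 3)) * indicator (A \<times> B) z \<partial>lborel)"
    using AB carrier_borel
    by (subst nn_integral_restrict_space) (auto intro!: nn_integral_cong simp: carrier_Poincare indicator_def)
  also have "\<dots> = (\<integral>\<^sup>+z. (case z of (b, a, t) \<Rightarrow> ennreal (1 / a ^ 3)) * indicator (A \<times> B) z \<partial>(lborel \<Otimes>\<^sub>M lborel))"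
    by (simp add: lborel_prod)
  also have "\<dots> = (\<integral>\<^sup>+b. \<integral>\<^sup>+n. indicator A b * ((case n of (a, t) \<Rightarrow> ennreal (1 / a ^ 3)) * indicator B n) \<partial>lborel \<partial>lborel)"
  proof -
    have "(\<lambda>z. (case z of (b, a, t) \<Rightarrow> ennreal (1 / a ^ 3)) * indicator (A \<times> B) z) \<in> borel_measurable borel"
      by (rule borel_measurable_times_ennreal[OF w]) (use ABm in simp)
    then show ?thesis
      by (subst lborel.nn_integral_fst[symmetric])
        (auto simp: lborel_prod indicator_times mult_ac split: prod.split intro!: nn_integral_cong)
  qed
  also have "\<dots> = emeasure lborel A * (\<integral>\<^sup>+n. (case n of (a, t) \<Rightarrow> ennreal (1 / a ^ 3)) * indicator B n \<partial>lborel)"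
  proof -
    have "(\<lambda>n. (case n of (a, t) \<Rightarrow> ennreal (1 / a ^ 3)) * indicator B n) \<in> borel_measurable borel"
      by (rule borel_measurable_times_ennreal[OF borel_measurable_weight]) simp
    then show ?thesis by (simp add: nn_integral_cmult nn_integral_multc)
  qed
  also have "(\<integral>\<^sup>+n. (case n of (a, t) \<Rightarrow> ennreal (1 / a ^ 3)) * indicator B n \<partial>lborel) =
      (\<integral>\<^sup>+n. (case n of (a, t) \<Rightarrow> ennreal (1 / a ^ 3)) * indicator B n \<partial>restrict_space lborel half_plane)"
    using AB by (subst nn_integral_restrict_space) (auto intro!: nn_integral_cong simp: indicator_def)
  also have "\<dots> = emeasure scale B"
    unfolding scale_def using B
    by (subst emeasure_density) (auto simp: scale_def borel_measurable_weight intro!: measurable_restrict_space1)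
  finally show "emeasure lborel A * emeasure scale B = emeasure haar (A \<times> B)" ..
qed

section \<open>Left invariance of the Haar measure\<close>

lemma measurable_into_scale:
  assumes "f \<in> borel_measurable M" "g \<in> borel_measurable M" "\<And>x. x \<in> space M \<Longrightarrow> f x > 0"
  shows "(\<lambda>x. (f x, g x)) \<in> measurable M scale"
proof -
  have "(\<lambda>x. (f x, g x)) \<in> measurable M (restrict_space borel half_plane)"
    using assms by (intro measurable_restrict_space2 borel_measurable_Pair) (auto simp: half_plane_def)
  then show ?thesis by (simp add: measurable_cong_sets[OF refl sets_scale])
qed

lemma borel_measurable_scale:
  "f \<in> borel_measurable borel \<Longrightarrow> f \<in> borel_measurable scale"
  by (simp add: measurable_cong_sets[OF sets_scale refl] measurable_restrict_space1)

lemma borel_measurable_fst_scale [measurable]: "fst \<in> borel_measurable scale" "snd \<in> borel_measurable scale"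
  by (auto intro!: borel_measurable_scale borel_measurable_continuous_onI continuous_intros)

lemma sigma_finite_haar: "sigma_finite_measure haar"
proof -
  interpret pair_sigma_finite lborel scale
    by (simp add: pair_sigma_finite_def sigma_finite_lborel sigma_finite_scale)
  show ?thesis unfolding haar_eq by (rule sigma_finite_measure_axioms)
qed

lemma nn_integral_haar:
  assumes "f \<in> borel_measurable haar"
  shows "(\<integral>\<^sup>+w. f w \<partial>haar) = (\<integral>\<^sup>+n. \<integral>\<^sup>+b. f (b, n) \<partial>lborel \<partial>scale)"
proof -
  interpret pair_sigma_finite lborel scale
    by (simp add: pair_sigma_finite_def sigma_finite_lborel sigma_finite_scale)
  show ?thesis using assms unfolding haar_eq by (simp add: nn_integral_snd[symmetric])
qed

text \<open>The density \<open>1 / a\<^sup>3\<close> contributes the factor \<open>c\<^sup>3\<close>, the substitution in \<open>a\<close> the factor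
  \<open>1 / c\<close>.\<close>

lemma nn_integral_scale_shift:
  assumes f: "f \<in> borel_measurable scale" and c: "c > 0"
  shows "(\<integral>\<^sup>+n. f (c * fst n, s + snd n) \<partial>scale) = ennreal (c\<^sup>2) * (\<integral>\<^sup>+n. f n \<partial>scale)"
proof -
  have g [measurable]: "(\<lambda>n. f n * indicator half_plane n) \<in> borel_measurable (borel \<Otimes>\<^sub>M borel)"
    using f borel_measurable_restrict_space_iff_ennreal[of half_plane lborel f]
    by (simp add: scale_def borel_prod)
  define g where "g a t = f (a, t) * indicator half_plane (a, t)" for a t
  have gm [measurable]: "(\<lambda>x. g (a x) (t x)) \<in> borel_measurable M"
    if [measurable]: "a \<in> borel_measurable M" "t \<in> borel_measurable M" for a t and M :: "'c measure"
    unfolding g_def by (rule measurable_compose[OF _ g]) measurable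
  have fs: "(\<lambda>n. f (c * fst n, s + snd n)) \<in> borel_measurable scale"
  proof (rule measurable_compose[OF measurable_into_scale f])
    show "0 < c * fst n" if "n \<in> space scale" for n
      using that c by (auto simp: space_scale half_plane_def)
  qed measurable
  have fg: "ennreal (1 / a ^ 3) * f (a, t) * indicator {0<..} a = ennreal (1 / a ^ 3) * g a t" for a t
    by (auto simp: g_def half_plane_def indicator_def)
  have fg': "ennreal (1 / a ^ 3) * f (c * a, s + t) * indicator {0<..} a =
      ennreal (c ^ 3) * (ennreal (1 / (c * a) ^ 3) * g (c * a) (s + t))" for a t
  proof (cases "a > 0")
    case True
    have "ennreal (c ^ 3) * ennreal (1 / (c * a) ^ 3) = ennreal (1 / a ^ 3)"
      using c True by (subst ennreal_mult[symmetric]) (auto simp: power_mult_distrib)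
    then show ?thesis using c True
      by (simp add: g_def half_plane_def mult.assoc[symmetric])
  next
    case False
    then have "\<not> c * a > 0" using c by (simp add: zero_less_mult_iff)
    with False show ?thesis by (simp add: g_def half_plane_def)
  qed
  have "(\<integral>\<^sup>+n. f (c * fst n, s + snd n) \<partial>scale) =
      (\<integral>\<^sup>+a. \<integral>\<^sup>+t. ennreal (c ^ 3) * (ennreal (1 / (c * a) ^ 3) * g (c * a) (s + t)) \<partial>lborel \<partial>lborel)"
    by (subst nn_integral_scale[OF fs]) (simp add: fg')
  also have "\<dots> = ennreal (c ^ 3) * (\<integral>\<^sup>+a. \<integral>\<^sup>+t. ennreal (1 / (c * a) ^ 3) * g (c * a) (s + t) \<partial>lborel \<partial>lborel)"
    by (simp add: nn_integral_cmult)
  also have "(\<integral>\<^sup>+a. \<integral>\<^sup>+t. ennreal (1 / (c * a) ^ 3) * g (c * a) (s + t) \<partial>lborel \<partial>lborel) =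
      (\<integral>\<^sup>+a. \<integral>\<^sup>+t. ennreal (1 / (c * a) ^ 3) * g (c * a) t \<partial>lborel \<partial>lborel)"
  proof (rule nn_integral_cong)
    fix a
    show "(\<integral>\<^sup>+t. ennreal (1 / (c * a) ^ 3) * g (c * a) (s + t) \<partial>lborel) =
        (\<integral>\<^sup>+t. ennreal (1 / (c * a) ^ 3) * g (c * a) t \<partial>lborel)"
      using nn_integral_real_affine[of "\<lambda>t. ennreal (1 / (c * a) ^ 3) * g (c * a) t" 1 s] by simp
  qed
  also have "ennreal (c ^ 3) * \<dots> = ennreal (c\<^sup>2) * (ennreal \<bar>c\<bar> * \<dots>)"
    using c by (simp add: mult.assoc[symmetric] ennreal_mult[symmetric] power3_eq_cube power2_eq_square)
  also have "ennreal \<bar>c\<bar> * (\<integral>\<^sup>+a. \<integral>\<^sup>+t. ennreal (1 / (c * a) ^ 3) * g (c * a) t \<partial>lborel \<partial>lborel) =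
      (\<integral>\<^sup>+a. \<integral>\<^sup>+t. ennreal (1 / a ^ 3) * g a t \<partial>lborel \<partial>lborel)"
    using nn_integral_real_affine[of "\<lambda>a. \<integral>\<^sup>+t. ennreal (1 / a ^ 3) * g a t \<partial>lborel" c 0] c by simp
  also have "\<dots> = (\<integral>\<^sup>+n. f n \<partial>scale)"
    by (subst nn_integral_scale[OF f]) (simp add: fg)
  finally show ?thesis .
qed

lemma mult_Poincare: "(b, n) \<otimes>\<^bsub>Poincare\<^esub> (b', n') =
    (b + fst n *\<^sub>R (boost (snd n) *v b'), fst n * fst n', snd n + snd n')"
  by (simp add: Poincare_def case_prod_unfold)

lemma haar_section:
  assumes f: "f \<in> borel_measurable haar" and n: "n \<in> half_plane"
  shows "(\<lambda>b. f (b, n)) \<in> borel_measurable borel"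
proof -
  have "(\<lambda>b. f (b, n)) \<in> borel_measurable lborel"
    by (rule measurable_compose[OF _ f[unfolded haar_eq]]) (use n in \<open>auto simp: space_scale\<close>)
  then show ?thesis by simp
qed

text \<open>Translation by an element of scale \<open>c\<close> multiplies the integral over the plane by \<open>1 / c\<^sup>2\<close> and the
  integral over scales and rapidities by \<open>c\<^sup>2\<close>.\<close>

lemma haar_left_invariant:
  assumes f: "f \<in> borel_measurable haar" and v: "v \<in> carrier Poincare"
  shows "(\<integral>\<^sup>+w. f (v \<otimes>\<^bsub>Poincare\<^esub> w) \<partial>haar) = (\<integral>\<^sup>+w. f w \<partial>haar)"
proof -
  obtain b0 c s where v': "v = (b0, c, s)" and c: "c > 0"
    using v by (auto simp: Poincare_def)
  interpret pair_sigma_finite lborel scale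
    by (simp add: pair_sigma_finite_def sigma_finite_lborel sigma_finite_scale)
  have mv: "v \<otimes>\<^bsub>Poincare\<^esub> w = (b0 + c *\<^sub>R (boost s *v fst w), c * fst (snd w), s + snd (snd w))" for w
    by (cases w) (simp add: v' mult_Poincare)
  have "(\<lambda>w. v \<otimes>\<^bsub>Poincare\<^esub> w) \<in> measurable (lborel \<Otimes>\<^sub>M scale) (lborel \<Otimes>\<^sub>M scale)"
    unfolding mv
  proof (rule measurable_Pair)
    show "(\<lambda>w. b0 + c *\<^sub>R (boost s *v fst w)) \<in> measurable (lborel \<Otimes>\<^sub>M scale) lborel"
      by measurable
    show "(\<lambda>w. (c * fst (snd w), s + snd (snd w))) \<in> measurable (lborel \<Otimes>\<^sub>M scale) scale"
      using c by (intro measurable_into_scale) (auto simp: space_pair_measure space_scale half_plane_def)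
  qed
  then have fv: "(\<lambda>w. f (v \<otimes>\<^bsub>Poincare\<^esub> w)) \<in> borel_measurable haar"
    using f unfolding haar_eq by (rule measurable_compose)
  define G where "G n = (\<integral>\<^sup>+b. f (b, n) \<partial>lborel)" for n
  have G: "G \<in> borel_measurable scale"
    unfolding G_def[abs_def] using f[unfolded haar_eq] by measurable
  have "(\<integral>\<^sup>+w. f (v \<otimes>\<^bsub>Poincare\<^esub> w) \<partial>haar) = (\<integral>\<^sup>+n. ennreal (1 / c\<^sup>2) * G (c * fst n, s + snd n) \<partial>scale)"
    unfolding nn_integral_haar[OF fv]
  proof (rule nn_integral_cong)
    fix n assume "n \<in> space scale"
    then have n: "(c * fst n, s + snd n) \<in> half_plane"
      using c by (auto simp: space_scale half_plane_def)
    have "G (c * fst n, s + snd n) =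
        ennreal (c\<^sup>2) * (\<integral>\<^sup>+b. f (b0 + c *\<^sub>R (boost s *v b), c * fst n, s + snd n) \<partial>lborel)"
      unfolding G_def by (rule nn_integral_boost[OF haar_section[OF f n] c])
    then show "(\<integral>\<^sup>+b. f (v \<otimes>\<^bsub>Poincare\<^esub> (b, n)) \<partial>lborel) = ennreal (1 / c\<^sup>2) * G (c * fst n, s + snd n)"
      using c by (simp add: mv mult.assoc[symmetric] ennreal_mult[symmetric])
  qed
  also have "\<dots> = ennreal (1 / c\<^sup>2) * (\<integral>\<^sup>+n. G (c * fst n, s + snd n) \<partial>scale)"
    using c by (intro nn_integral_cmult measurable_compose[OF measurable_into_scale G])
      (auto simp: space_scale half_plane_def)
  also have "\<dots> = (\<integral>\<^sup>+n. G n \<partial>scale)"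
    using c unfolding nn_integral_scale_shift[OF G c]
    by (simp add: mult.assoc[symmetric] ennreal_mult[symmetric])
  also have "\<dots> = (\<integral>\<^sup>+w. f w \<partial>haar)"
    unfolding nn_integral_haar[OF f] G_def ..
  finally show ?thesis .
qed

section \<open>Orbits in the cones\<close>

text \<open>The point at which the representation at \<open>(b, n)\<close> evaluates its argument.\<close>

definition orbit :: "real^2 \<Rightarrow> real \<times> real \<Rightarrow> real^2" where
  "orbit x n = fst n *\<^sub>R (boost (- snd n) *v x)"

lemma orbit_lc: "orbit (lc u v) (a, t) = lc (a * exp (- t) * u) (a * exp t * v)"
  by (simp add: orbit_def boost_lc scaleR_lc mult.assoc)

lemma lc_in_cone:
  assumes "i \<in> {1, 2}" "j \<in> {1, 2}"
  shows "lc u v \<in> cone i j \<longleftrightarrow> (if i = 1 then u > 0 else u < 0) \<and> (if i = j then v > 0 else v < 0)"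
proof -
  have d: "(lc u v $ 1)\<^sup>2 - (lc u v $ 2)\<^sup>2 = u * v"
    by (simp add: lc_def power2_eq_square field_simps)
  have *: "(lc u v $ 2)\<^sup>2 < (lc u v $ 1)\<^sup>2 \<longleftrightarrow> u * v > 0" "(lc u v $ 1)\<^sup>2 < (lc u v $ 2)\<^sup>2 \<longleftrightarrow> u * v < 0"
    using d by linarith+
  have l: "lc u v $ 1 = (u + v) / 2" "lc u v $ 2 = (u - v) / 2"
    by (simp_all add: lc_def)
  have s: "0 < u * v \<and> 0 < (u + v) / 2 \<longleftrightarrow> 0 < u \<and> 0 < v" "0 < u * v \<and> (u + v) / 2 < 0 \<longleftrightarrow> u < 0 \<and> v < 0"
    "u * v < 0 \<and> 0 < (u - v) / 2 \<longleftrightarrow> 0 < u \<and> v < 0" "u * v < 0 \<and> (u - v) / 2 < 0 \<longleftrightarrow> u < 0 \<and> 0 < v"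
    unfolding zero_less_mult_iff mult_less_0_iff by auto
  consider "i = 1" "j = 1" | "i = 2" "j = 1" | "i = 1" "j = 2" | "i = 2" "j = 2"
    using assms by auto
  then show ?thesis
    by cases (simp_all add: cone_def * l[symmetric] s[unfolded l[symmetric]])
qed

lemma orbit_in_cone_iff:
  assumes "i \<in> {1, 2}" "j \<in> {1, 2}" "n \<in> half_plane"
  shows "orbit x n \<in> cone i j \<longleftrightarrow> x \<in> cone i j"
proof -
  obtain u v where x: "x = lc u v" by (rule lc_cases)
  obtain a t where n: "n = (a, t)" "a > 0" using assms(3) by (auto simp: half_plane_def)
  have "0 < a * exp s * w \<longleftrightarrow> 0 < w" "a * exp s * w < 0 \<longleftrightarrow> w < 0" for s w
    using n(2) by (simp_all add: zero_less_mult_iff mult_less_0_iff)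
  then show ?thesis
    unfolding x n(1) orbit_lc lc_in_cone[OF assms(1,2)] by simp
qed

lemma open_cone: "open (cone i j)"
proof -
  have "open {x :: real^2. (x $ 2)\<^sup>2 < (x $ 1)\<^sup>2}" "open {x :: real^2. (x $ 1)\<^sup>2 < (x $ 2)\<^sup>2}"
    "open {x :: real^2. 0 < x $ k}" "open {x :: real^2. x $ k < 0}" for k
    by (intro open_Collect_less continuous_intros)+
  then show ?thesis
    unfolding cone_def by (cases "i = 1"; cases "j = 1") (simp_all add: Collect_conj_eq open_Int)
qed

lemma cone_borel [measurable]: "cone i j \<in> sets borel"
  by (intro borel_open open_cone)

lemma cone_nonempty:
  assumes "i \<in> {1, 2}" "j \<in> {1, 2}"
  shows "cone i j \<noteq> {}"
proof -
  have "lc (if i = 1 then 1 else -1) (if i = j then 1 else -1) \<in> cone i j"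
    by (simp add: lc_in_cone[OF assms])
  then show ?thesis by blast
qed

lemma mink_nonzero:
  assumes "i \<in> {1, 2}" "j \<in> {1, 2}" "x \<in> cone i j"
  shows "mink x x \<noteq> 0"
proof -
  obtain u v where x: "x = lc u v" by (rule lc_cases)
  show ?thesis using assms(3) unfolding x lc_in_cone[OF assms(1,2)] mink_lc by (auto split: if_splits)
qed

lemma space_cone: "space (cone_measure i j) = cone i j"
  by (simp add: space_restrict_space)

lemma borel_measurable_cone: "f \<in> borel_measurable borel \<Longrightarrow> f \<in> borel_measurable (cone_measure i j)"
  by (rule measurable_restrict_space1) simp

lemma sigma_finite_cone: "sigma_finite_measure (cone_measure i j)"
  by (intro sigma_finite_measure_restrict_space sigma_finite_lborel) simp

text \<open>Guarantees that the choice in the definition of \<open>onb\<close> yields a basis on each cone.\<close>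

lemma is_onb_onb_cone:
  assumes "i \<in> {1, 2}" "j \<in> {1, 2}"
  shows "is_onb (cone_measure i j) (onb (cone_measure i j))"
proof -
  have "bump U k \<in> L2 (cone_measure i j)" if U: "open U" "bounded U" for U k
  proof -
    have Um: "U \<in> sets borel" using U by simp
    have "integrable lborel (\<lambda>x. indicator U x :: real)"
      using emeasure_bounded_finite[OF U(2)] Um by (intro integrable_real_indicator) auto
    then have ind: "integrable (cone_measure i j) (\<lambda>x. indicator U x :: real)"
      using integrable_mult_indicator[of "cone i j" lborel "indicator U :: _ \<Rightarrow> real"]
      by (subst integrable_restrict_space) auto
    have bm: "bump U k \<in> borel_measurable (cone_measure i j)"
      by (intro borel_measurable_cone borel_measurable_continuous_onI continuous_bump)
    have "(cmod (bump U k x))\<^sup>2 \<le> indicator U x" for x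
      using norm_bump_le[of U k x] by (auto simp: indicator_def power_le_one split: if_splits)
    then have "integrable (cone_measure i j) (\<lambda>x. (cmod (bump U k x))\<^sup>2)"
      by (intro Bochner_Integration.integrable_bound[OF ind]) (use bm in auto)
    with bm show ?thesis by (simp add: L2_def)
  qed
  then have "\<exists>e. is_onb (cone_measure i j) e \<and> (\<forall>n. e n \<in> L2 (cone_measure i j))"
    by (intro onb_exists_open open_cone cone_nonempty assms) auto
  then show ?thesis unfolding onb_def by (metis someI)
qed

lemma measurable_orbit:
  assumes [measurable]: "f \<in> borel_measurable M" and g: "g \<in> measurable M scale"
  shows "(\<lambda>x. orbit (f x) (g x)) \<in> borel_measurable M"
proof -
  have [measurable]: "(\<lambda>x. fst (g x)) \<in> borel_measurable M" "(\<lambda>x. snd (g x)) \<in> borel_measurable M"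
    by (rule measurable_compose[OF g borel_measurable_fst_scale(1)]
        measurable_compose[OF g borel_measurable_fst_scale(2)])+
  show ?thesis unfolding orbit_def by measurable
qed

text \<open>In light-cone coordinates the orbit map multiplies the coordinates of \<open>x\<close> by \<open>p = a e\<^sup>-\<^sup>t\<close> and
  \<open>q = a e\<^sup>t\<close>, and it reaches every point of the quadrant of \<open>x\<close> once. Its Jacobian comes from the substitutions
  \<open>q = p e\<^sup>2\<^sup>t\<close> for fixed \<open>p\<close> and then \<open>p = a e\<^sup>-\<^sup>t\<close> for fixed \<open>t\<close>; the weight \<open>1 / a\<^sup>3\<close> of \<open>scale\<close> turns the
  resulting factor \<open>a\<close> into \<open>a\<^sup>4\<close>.\<close>

lemma nn_integral_orbit:
  assumes i: "i \<in> {1, 2}" and j: "j \<in> {1, 2}" and x: "x \<in> cone i j"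
    and \<psi>: "\<psi> \<in> borel_measurable (cone_measure i j)"
  shows "(\<integral>\<^sup>+y. \<psi> y \<partial>cone_measure i j) =
    (\<integral>\<^sup>+n. \<psi> (orbit x n) * ennreal (\<bar>mink x x\<bar> * fst n ^ 4) \<partial>scale)"
proof -
  obtain u v where xuv: "x = lc u v" by (rule lc_cases)
  have uv: "u \<noteq> 0" "v \<noteq> 0"
    using x unfolding xuv lc_in_cone[OF i j] by (auto split: if_splits)
  define \<Psi> where "\<Psi> y = \<psi> y * indicator (cone i j) y" for y
  have [measurable]: "\<Psi> \<in> borel_measurable borel"
    using \<psi> unfolding \<Psi>_def[abs_def] by (subst (asm) borel_measurable_restrict_space_iff_ennreal) auto
  define \<Phi> where "\<Phi> p q = \<Psi> (lc (u * p) (v * q))" for p q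
  have \<Phi> [measurable]: "(\<lambda>x. \<Phi> (f x) (g x)) \<in> borel_measurable M"
    if [measurable]: "f \<in> borel_measurable M" "g \<in> borel_measurable M" for f g and M :: "'c measure"
    unfolding \<Phi>_def by measurable
  \<comment> \<open>\<open>\<Phi>\<close> vanishes outside the quadrant of positive multiples, since \<open>\<Psi>\<close> vanishes outside the cone.\<close>
  have pos: "\<Phi> p q = \<Phi> p q * indicator {0<..} q * indicator {0<..} p" for p q
    using x unfolding xuv \<Phi>_def \<Psi>_def indicator_def lc_in_cone[OF i j]
    by (auto simp: zero_less_mult_iff mult_less_0_iff split: if_splits)
  have inner: "(\<integral>\<^sup>+q. \<Phi> p q * indicator {0<..} q \<partial>lborel) =
      ennreal 2 * (\<integral>\<^sup>+t. \<Phi> p (p * exp (2 * t)) * ennreal (p * exp (2 * t)) \<partial>lborel)" if p: "p > 0" for p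
  proof -
    have "(\<integral>\<^sup>+q. \<Phi> p q * indicator {0<..} q \<partial>lborel) = (\<integral>\<^sup>+s. \<Phi> p (exp s) * ennreal (exp s) \<partial>lborel)"
      by (rule nn_integral_exp) measurable
    also have "\<dots> = ennreal \<bar>2\<bar> * (\<integral>\<^sup>+t. \<Phi> p (exp (ln p + 2 * t)) * ennreal (exp (ln p + 2 * t)) \<partial>lborel)"
      by (rule nn_integral_real_affine) auto
    finally show ?thesis using p by (simp add: exp_add)
  qed
  have outer: "(\<integral>\<^sup>+p. \<Phi> p (p * exp (2 * t)) * ennreal (p * exp (2 * t)) * indicator {0<..} p \<partial>lborel) =
      (\<integral>\<^sup>+a. \<Phi> (a * exp (- t)) (a * exp t) * ennreal a * indicator {0<..} a \<partial>lborel)" for t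
  proof -
    have "(\<integral>\<^sup>+p. \<Phi> p (p * exp (2 * t)) * ennreal (p * exp (2 * t)) * indicator {0<..} p \<partial>lborel) =
        ennreal \<bar>exp (- t)\<bar> * (\<integral>\<^sup>+a. \<Phi> (0 + exp (- t) * a) ((0 + exp (- t) * a) * exp (2 * t)) *
          ennreal ((0 + exp (- t) * a) * exp (2 * t)) * indicator {0<..} (0 + exp (- t) * a) \<partial>lborel)"
      by (rule nn_integral_real_affine) auto
    also have "\<dots> = (\<integral>\<^sup>+a. ennreal (exp (- t)) * (\<Phi> (a * exp (- t)) (a * exp t) * ennreal (a * exp t) * indicator {0<..} a) \<partial>lborel)"
    proof (subst nn_integral_cmult[symmetric])
      have e: "a * exp (- t) * exp (2 * t) = a * exp t" for a
        by (simp add: mult.assoc flip: exp_add)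
      show "(\<integral>\<^sup>+a. ennreal \<bar>exp (- t)\<bar> * (\<Phi> (0 + exp (- t) * a) ((0 + exp (- t) * a) * exp (2 * t)) *
          ennreal ((0 + exp (- t) * a) * exp (2 * t)) * indicator {0<..} (0 + exp (- t) * a)) \<partial>lborel) =
        (\<integral>\<^sup>+a. ennreal (exp (- t)) * (\<Phi> (a * exp (- t)) (a * exp t) * ennreal (a * exp t) * indicator {0<..} a) \<partial>lborel)"
        by (intro nn_integral_cong) (simp add: e mult.commute[of "exp (- t)"] zero_less_mult_iff indicator_def)
    qed measurable
    also have "\<dots> = (\<integral>\<^sup>+a. \<Phi> (a * exp (- t)) (a * exp t) * ennreal a * indicator {0<..} a \<partial>lborel)"
    proof (rule nn_integral_cong)
      fix a :: real
      have "ennreal (exp (- t)) * (ennreal (a * exp t) * z) = ennreal a * z" if "a > 0" for z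
      proof -
        have "exp (- t) * (a * exp t) = a" by (simp add: exp_minus divide_simps)
        moreover have "ennreal (exp (- t)) * ennreal (a * exp t) = ennreal (exp (- t) * (a * exp t))"
          using that by (intro ennreal_mult[symmetric]) auto
        ultimately show ?thesis by (metis mult.assoc)
      qed
      note key = this
      show "ennreal (exp (- t)) * (\<Phi> (a * exp (- t)) (a * exp t) * ennreal (a * exp t) * indicator {0<..} a) =
          \<Phi> (a * exp (- t)) (a * exp t) * ennreal a * indicator {0<..} a"
      proof (cases "a > 0")
        case True
        then show ?thesis
          using key[OF True, of "\<Phi> (a * exp (- t)) (a * exp t)"] by (simp only: mult.commute indicator_simps greaterThan_iff mult_1)
      qed simp
    qed
    finally show ?thesis .
  qed
  have "(\<integral>\<^sup>+y. \<psi> y \<partial>cone_measure i j) = (\<integral>\<^sup>+y. \<Psi> y \<partial>lborel)"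
    by (simp add: nn_integral_restrict_space \<Psi>_def)
  also have "\<dots> = ennreal (1 / 2) * (\<integral>\<^sup>+u'. \<integral>\<^sup>+v'. \<Psi> (lc u' v') \<partial>lborel \<partial>lborel)"
    by (rule nn_integral_lc) simp
  also have "(\<integral>\<^sup>+u'. \<integral>\<^sup>+v'. \<Psi> (lc u' v') \<partial>lborel \<partial>lborel) =
      (\<integral>\<^sup>+u'. ennreal \<bar>v\<bar> * (\<integral>\<^sup>+q. \<Psi> (lc u' (0 + v * q)) \<partial>lborel) \<partial>lborel)"
    using uv by (intro nn_integral_cong nn_integral_real_affine) auto
  also have "\<dots> = ennreal \<bar>u\<bar> * (\<integral>\<^sup>+p. ennreal \<bar>v\<bar> * (\<integral>\<^sup>+q. \<Psi> (lc (0 + u * p) (0 + v * q)) \<partial>lborel) \<partial>lborel)"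
    using uv by (intro nn_integral_real_affine) auto
  also have "\<dots> = ennreal \<bar>u * v\<bar> * (\<integral>\<^sup>+p. \<integral>\<^sup>+q. \<Phi> p q \<partial>lborel \<partial>lborel)"
    by (simp add: nn_integral_cmult \<Phi>_def[symmetric] abs_mult ennreal_mult mult.assoc)
  also have "(\<integral>\<^sup>+p. \<integral>\<^sup>+q. \<Phi> p q \<partial>lborel \<partial>lborel) =
      (\<integral>\<^sup>+p. ennreal 2 * ((\<integral>\<^sup>+t. \<Phi> p (p * exp (2 * t)) * ennreal (p * exp (2 * t)) * indicator {0<..} p \<partial>lborel)) \<partial>lborel)"
  proof (rule nn_integral_cong)
    fix p :: real
    have m: "(\<integral>\<^sup>+t. \<Phi> p (p * exp (2 * t)) * ennreal (p * exp (2 * t)) * indicator {0<..} p \<partial>lborel) =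
        (\<integral>\<^sup>+t. \<Phi> p (p * exp (2 * t)) * ennreal (p * exp (2 * t)) \<partial>lborel) * indicator {0<..} p"
      by (rule nn_integral_multc) measurable
    have "(\<integral>\<^sup>+q. \<Phi> p q \<partial>lborel) = (\<integral>\<^sup>+q. \<Phi> p q * indicator {0<..} q \<partial>lborel) * indicator {0<..} p"
      by (subst pos, subst nn_integral_multc) auto
    also have "\<dots> = ennreal 2 * (\<integral>\<^sup>+t. \<Phi> p (p * exp (2 * t)) * ennreal (p * exp (2 * t)) \<partial>lborel) * indicator {0<..} p"
      using inner[of p] by (cases "p > 0") auto
    finally show "(\<integral>\<^sup>+q. \<Phi> p q \<partial>lborel) = ennreal 2 * ((\<integral>\<^sup>+t. \<Phi> p (p * exp (2 * t)) * ennreal (p * exp (2 * t)) * indicator {0<..} p \<partial>lborel))"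
      unfolding m by (simp only: mult.assoc)
  qed
  also have "\<dots> = ennreal 2 * (\<integral>\<^sup>+p. \<integral>\<^sup>+t. \<Phi> p (p * exp (2 * t)) * ennreal (p * exp (2 * t)) * indicator {0<..} p \<partial>lborel \<partial>lborel)"
    by (rule nn_integral_cmult) measurable
  also have "(\<integral>\<^sup>+p. \<integral>\<^sup>+t. \<Phi> p (p * exp (2 * t)) * ennreal (p * exp (2 * t)) * indicator {0<..} p \<partial>lborel \<partial>lborel) =
      (\<integral>\<^sup>+t. \<integral>\<^sup>+p. \<Phi> p (p * exp (2 * t)) * ennreal (p * exp (2 * t)) * indicator {0<..} p \<partial>lborel \<partial>lborel)"
    by (rule lborel_pair.Fubini') measurable
  also have "\<dots> = (\<integral>\<^sup>+t. \<integral>\<^sup>+a. \<Phi> (a * exp (- t)) (a * exp t) * ennreal a * indicator {0<..} a \<partial>lborel \<partial>lborel)"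
    by (simp only: outer)
  also have "\<dots> = (\<integral>\<^sup>+a. \<integral>\<^sup>+t. \<Phi> (a * exp (- t)) (a * exp t) * ennreal a * indicator {0<..} a \<partial>lborel \<partial>lborel)"
    by (rule lborel_pair.Fubini') measurable
  also have "ennreal (1 / 2) * (ennreal \<bar>u * v\<bar> * (ennreal 2 * \<dots>)) = (ennreal (1 / 2) * ennreal 2) * (ennreal \<bar>u * v\<bar> * \<dots>)"
    by (simp only: mult_ac)
  also have "ennreal (1 / 2) * ennreal 2 = 1"
    by (subst ennreal_mult[symmetric]) auto
  also have "ennreal \<bar>u * v\<bar> * (\<integral>\<^sup>+a. \<integral>\<^sup>+t. \<Phi> (a * exp (- t)) (a * exp t) * ennreal a * indicator {0<..} a \<partial>lborel \<partial>lborel) =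
      (\<integral>\<^sup>+a. \<integral>\<^sup>+t. ennreal \<bar>u * v\<bar> * (\<Phi> (a * exp (- t)) (a * exp t) * ennreal a * indicator {0<..} a) \<partial>lborel \<partial>lborel)"
    by (simp add: nn_integral_cmult)
  also have "\<dots> = (\<integral>\<^sup>+a. \<integral>\<^sup>+t. ennreal (1 / a ^ 3) * (\<psi> (orbit x (a, t)) * ennreal (\<bar>mink x x\<bar> * fst (a, t) ^ 4)) * indicator {0<..} a \<partial>lborel \<partial>lborel)"
  proof (intro nn_integral_cong)
    fix a t :: real
    show "ennreal \<bar>u * v\<bar> * (\<Phi> (a * exp (- t)) (a * exp t) * ennreal a * indicator {0<..} a) =
      ennreal (1 / a ^ 3) * (\<psi> (orbit x (a, t)) * ennreal (\<bar>mink x x\<bar> * fst (a, t) ^ 4)) * indicator {0<..} a"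
    proof (cases "a > 0")
      case True
      then have "orbit x (a, t) \<in> cone i j"
        using x orbit_in_cone_iff[OF i j, of "(a, t)" x] by (simp add: half_plane_def)
      then have "\<Phi> (a * exp (- t)) (a * exp t) = \<psi> (orbit x (a, t))"
        by (simp add: \<Phi>_def \<Psi>_def xuv orbit_lc mult_ac)
      moreover have "ennreal (1 / a ^ 3) * ennreal (\<bar>mink x x\<bar> * a ^ 4) = ennreal \<bar>u * v\<bar> * ennreal a"
        using True by (subst (1 2) ennreal_mult[symmetric]) (auto simp: xuv mink_lc field_simps power4_eq_xxxx power3_eq_cube)
      ultimately show ?thesis using True by (simp add: mult_ac)
    qed simp
  qed
  also have "\<dots> = (\<integral>\<^sup>+n. \<psi> (orbit x n) * ennreal (\<bar>mink x x\<bar> * fst n ^ 4) \<partial>scale)"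
  proof (rule nn_integral_scale[symmetric])
    have "orbit x \<in> measurable scale (cone_measure i j)"
      using x orbit_in_cone_iff[OF i j, of _ x] measurable_orbit[of "\<lambda>_. x" scale "\<lambda>n. n"]
      by (intro measurable_restrict_space2) (auto simp: space_scale)
    then have "(\<lambda>n. \<psi> (orbit x n)) \<in> borel_measurable scale"
      using \<psi> by (rule measurable_compose)
    then show "(\<lambda>n. \<psi> (orbit x n) * ennreal (\<bar>mink x x\<bar> * fst n ^ 4)) \<in> borel_measurable scale"
      by measurable
  qed
  finally show ?thesis by simp
qed

section \<open>The kernel of the Fourier transform\<close>

abbreviation (input) cone2 :: "nat \<Rightarrow> nat \<Rightarrow> ((real^2) \<times> (real^2)) measure" where
  "cone2 i j \<equiv> cone_measure i j \<Otimes>\<^sub>M cone_measure i j"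

text \<open>For \<open>x\<close> and \<open>y\<close> in the same cone, the scale and the rapidity that move \<open>x\<close> to \<open>y\<close>: the quotients of
  their light-cone coordinates are \<open>a e\<^sup>-\<^sup>t\<close> and \<open>a e\<^sup>t\<close>.\<close>

definition coord :: "real^2 \<Rightarrow> real^2 \<Rightarrow> real \<times> real" where
  "coord x y = (sqrt (mink y y / mink x x),
    ln (((y $ 1 - y $ 2) / (x $ 1 - x $ 2)) / ((y $ 1 + y $ 2) / (x $ 1 + x $ 2))) / 2)"

text \<open>The kernel of the transform of an integrable \<open>F\<close>. The denominator comes from
  dividing the factor \<open>a\<close> of the representation and the factor \<open>a \<bar>\<langle>x; x\<rangle>\<bar>\<^sup>1\<^sup>/\<^sup>2 / (2 \<pi>)\<close> of the
  Duflo-Moore operator at \<open>y = orbit x (a, t)\<close> by the Jacobian \<open>\<bar>\<langle>x; x\<rangle>\<bar> a\<^sup>4\<close>.\<close>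

definition fkernel :: "(poincare \<Rightarrow> complex) \<Rightarrow> (real^2) \<times> (real^2) \<Rightarrow> complex" where
  "fkernel F = (\<lambda>(x, y). ft (\<lambda>b. F (b, coord x y)) x /
     of_real (2 * pi * sqrt \<bar>mink x x\<bar> * (fst (coord x y))\<^sup>2))"

lemma AE_in_cones: "AE x in (lborel :: (real^2) measure). x $ 1 + x $ 2 \<noteq> 0 \<and> x $ 1 - x $ 2 \<noteq> (0::real)"
proof -
  have null: "AE x in lborel. a \<bullet> x \<noteq> 0" if a: "a \<noteq> 0" for a :: "real^2"
  proof -
    have m: "{x. a \<bullet> x = 0} \<in> sets lborel"
      by (simp add: borel_closed closed_hyperplane)
    have "{x. a \<bullet> x = 0} \<in> null_sets lebesgue"
      using negligible_hyperplane[of a 0] a by (simp add: negligible_iff_null_sets)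
    then have "{x. a \<bullet> x = 0} \<in> null_sets lborel"
      using null_sets_completion_iff[OF m] by simp
    then show ?thesis by (intro AE_I[of _ _ "{x. a \<bullet> x = 0}"]) (auto simp: null_sets_def)
  qed
  have "x $ 1 + x $ 2 = (axis 1 1 + axis 2 1) \<bullet> x" "x $ 1 - x $ 2 = (axis 1 1 - axis 2 1) \<bullet> x" for x :: "real^2"
    by (simp_all add: inner_add_left inner_diff_left inner_axis')
  moreover have "axis 1 1 + axis 2 1 \<noteq> (0 :: real^2)" "axis 1 1 - axis 2 1 \<noteq> (0 :: real^2)"
    by (simp_all add: vec_eq_iff forall_2 axis_def)
  ultimately show ?thesis using null by simp
qed

text \<open>Almost every point has nonzero light-cone coordinates and then lies in exactly one cone.\<close>

lemma nn_integral_cones: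
  assumes [measurable]: "g \<in> borel_measurable borel"
  shows "(\<Sum>i\<in>{1, 2}. \<Sum>j\<in>{1, 2}. \<integral>\<^sup>+x. g x \<partial>cone_measure i j) = (\<integral>\<^sup>+x. g x \<partial>lborel)"
proof -
  have "(\<Sum>i\<in>{1, 2}. \<Sum>j\<in>{1, 2}. \<integral>\<^sup>+x. g x \<partial>cone_measure i j) =
      (\<Sum>i\<in>{1, 2}. \<Sum>j\<in>{1, 2}. \<integral>\<^sup>+x. g x * indicator (cone i j) x \<partial>lborel)"
    by (simp add: nn_integral_restrict_space)
  also have "\<dots> = (\<Sum>i\<in>{1, 2}. \<integral>\<^sup>+x. (\<Sum>j\<in>{1, 2}. g x * indicator (cone i j) x) \<partial>lborel)"
    by (intro sum.cong refl nn_integral_sum[symmetric]) measurable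
  also have "\<dots> = (\<integral>\<^sup>+x. (\<Sum>i\<in>{1, 2}. \<Sum>j\<in>{1, 2}. g x * indicator (cone i j) x) \<partial>lborel)"
    by (intro nn_integral_sum[symmetric]) measurable
  also have "\<dots> = (\<integral>\<^sup>+x. g x \<partial>lborel)"
  proof (rule nn_integral_cong_AE, use AE_in_cones in eventually_elim)
    case (elim x)
    obtain u v where x: "x = lc u v" by (rule lc_cases)
    have uv: "u \<noteq> 0" "v \<noteq> 0" using elim by (auto simp: x lc_def)
    have "(\<Sum>i\<in>{1, 2}. \<Sum>j\<in>{1, 2}. indicator (cone i j) x) = (1 :: ennreal)"
    proof -
      have e: "(\<Sum>i\<in>{1, 2}. \<Sum>j\<in>{1, 2}. h i j) = h 1 1 + h 1 2 + (h 2 1 + h 2 2)"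
        for h :: "nat \<Rightarrow> nat \<Rightarrow> ennreal" by simp
      show ?thesis
        unfolding e using uv by (cases "u > 0"; cases "v > 0") (simp_all add: x indicator_def lc_in_cone)
    qed
    then show ?case by (simp only: sum_distrib_left[symmetric] mult_1_right)
  qed
  finally show ?thesis .
qed

lemma borel_measurable_coord:
  assumes [measurable]: "f \<in> borel_measurable M" "g \<in> borel_measurable M"
  shows "(\<lambda>x. fst (coord (f x) (g x))) \<in> borel_measurable M"
    and "(\<lambda>x. snd (coord (f x) (g x))) \<in> borel_measurable M"
proof -
  have [measurable]: "(\<lambda>x. f x $ i) \<in> borel_measurable M" "(\<lambda>x. g x $ i) \<in> borel_measurable M" for i
    using assms by (auto intro: measurable_compose[OF _ borel_measurable_nth])
  show "(\<lambda>x. fst (coord (f x) (g x))) \<in> borel_measurable M"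
    "(\<lambda>x. snd (coord (f x) (g x))) \<in> borel_measurable M"
    unfolding coord_def fst_conv snd_conv by measurable
qed

lemma borel_measurable_square_norm:
  "f \<in> borel_measurable M \<Longrightarrow> (\<lambda>x. ennreal ((cmod (f x))\<^sup>2)) \<in> borel_measurable M"
  by measurable

lemma mink_orbit: "mink (orbit x n) (orbit x n) = (fst n)\<^sup>2 * mink x x"
proof -
  obtain u v where x: "x = lc u v" by (rule lc_cases)
  obtain a t where n: "n = (a, t)" by (cases n)
  show ?thesis by (simp add: x n orbit_lc mink_lc exp_minus power2_eq_square)
qed

lemma ft_section_measurable:
  assumes F: "F \<in> borel_measurable haar"
  shows "(\<lambda>z. ft (\<lambda>b. F (b, snd z)) (fst z)) \<in> borel_measurable (lborel \<Otimes>\<^sub>M scale)"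
proof -
  have "(\<lambda>w. (snd w, snd (fst w))) \<in> measurable ((lborel \<Otimes>\<^sub>M scale) \<Otimes>\<^sub>M lborel) haar"
    unfolding haar_eq by measurable
  from measurable_compose[OF this F]
  have [measurable]: "(\<lambda>w. F (snd w, snd (fst w))) \<in> borel_measurable ((lborel \<Otimes>\<^sub>M scale) \<Otimes>\<^sub>M lborel)" .
  show ?thesis
    unfolding ft_def by (intro lborel.borel_measurable_lebesgue_integral) (simp add: case_prod_unfold)
qed

lemma AE_section_integrable:
  fixes F :: "poincare \<Rightarrow> complex"
  assumes "integrable haar F"
  shows "AE n in scale. integrable lborel (\<lambda>b. F (b, n))"
proof -
  interpret LS: pair_sigma_finite lborel scale
    by (simp add: pair_sigma_finite_def sigma_finite_lborel sigma_finite_scale)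
  show ?thesis
    using LS.AE_integrable_snd[of "\<lambda>b n. F (b, n)"] assms by (simp add: haar_eq)
qed

lemma pred_section_integrable:
  fixes F :: "poincare \<Rightarrow> complex"
  assumes F: "F \<in> borel_measurable haar"
  shows "Measurable.pred scale (\<lambda>n. integrable lborel (\<lambda>b. F (b, n)))"
proof -
  have "(\<lambda>w. (snd w, fst w)) \<in> measurable (scale \<Otimes>\<^sub>M lborel) haar"
    unfolding haar_eq by measurable
  from measurable_compose[OF this F] show ?thesis
    by (intro lborel.borel_measurable_lebesgue_integrable) (simp add: case_prod_unfold)
qed

lemma rep_eq: "rep \<xi> \<eta> x = of_real (fst (snd \<xi>)) * character x (fst \<xi>) * \<eta> (orbit x (snd \<xi>))"
  by (simp add: rep_def character_def orbit_def case_prod_unfold)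

lemma borel_measurable_cmod_square:
  "f \<in> borel_measurable M \<Longrightarrow> (\<lambda>x. (cmod (f x))\<^sup>2) \<in> borel_measurable M"
  by measurable

context
  fixes i j :: nat
  assumes i: "i \<in> {1, 2}" and j: "j \<in> {1, 2}"
begin

interpretation CC: pair_sigma_finite "cone_measure i j" "cone_measure i j"
  by (simp add: pair_sigma_finite_def sigma_finite_cone)

interpretation LS: pair_sigma_finite lborel scale
  by (simp add: pair_sigma_finite_def sigma_finite_lborel sigma_finite_scale)

interpretation HC: pair_sigma_finite haar "cone_measure i j"
  by (simp add: pair_sigma_finite_def sigma_finite_haar sigma_finite_cone)

lemma measurable_C_borel: "f \<in> measurable M (cone_measure i j) \<Longrightarrow> f \<in> borel_measurable M"
  by (rule measurable_compose[where g = "\<lambda>x. x"]) (auto intro: borel_measurable_cone)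

lemma mink_ratio_pos:
  assumes "x \<in> cone i j" "y \<in> cone i j"
  shows "mink y y / mink x x > 0"
proof -
  obtain u v where x: "x = lc u v" by (rule lc_cases)
  obtain u' v' where y: "y = lc u' v'" by (rule lc_cases)
  show ?thesis
    using assms unfolding x y lc_in_cone[OF i j] mink_lc
    by (auto simp: zero_less_divide_iff zero_less_mult_iff mult_less_0_iff split: if_splits)
qed

lemma measurable_coord:
  assumes f: "f \<in> measurable M (cone_measure i j)" and g: "g \<in> measurable M (cone_measure i j)"
  shows "(\<lambda>x. coord (f x) (g x)) \<in> measurable M scale"
proof -
  have "(\<lambda>x. (fst (coord (f x) (g x)), snd (coord (f x) (g x)))) \<in> measurable M scale"
  proof (rule measurable_into_scale)
    fix x assume "x \<in> space M"
    then have "f x \<in> cone i j" "g x \<in> cone i j"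
      using measurable_space[OF f] measurable_space[OF g] by (auto simp: space_cone)
    then show "0 < fst (coord (f x) (g x))"
      using mink_ratio_pos by (simp add: coord_def)
  qed (intro borel_measurable_coord measurable_C_borel f g)+
  then show ?thesis by simp
qed

lemma coord_orbit:
  assumes x: "x \<in> cone i j" and n: "n \<in> half_plane"
  shows "coord x (orbit x n) = n"
proof -
  obtain u v where xuv: "x = lc u v" by (rule lc_cases)
  have uv: "u \<noteq> 0" "v \<noteq> 0"
    using x unfolding xuv lc_in_cone[OF i j] by (auto split: if_splits)
  obtain a t where nat: "n = (a, t)" "a > 0" using n by (auto simp: half_plane_def)
  have l: "lc p q $ 1 + lc p q $ 2 = p" "lc p q $ 1 - lc p q $ 2 = q" for p q
    by (simp_all add: lc_def field_simps)
  have r1: "(a * exp (- t) * u) * (a * exp t * v) / (u * v) = a\<^sup>2"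
    using uv by (simp add: exp_minus power2_eq_square)
  have "a * exp t * v / v = a * exp t" "a * exp (- t) * u / u = a * exp (- t)"
    using uv by simp_all
  moreover have "(a * exp t) / (a * exp (- t)) = exp t / exp (- t)"
    using nat(2) by simp
  moreover have "exp t / exp (- t) = exp (2 * t)"
    unfolding exp_diff[symmetric] by simp
  ultimately have r2: "(a * exp t * v / v) / (a * exp (- t) * u / u) = exp (2 * t)"
    by (simp only:)
  show ?thesis
    unfolding coord_def xuv nat(1) orbit_lc mink_lc l r1 r2 using nat(2) by simp
qed

lemma measurable_orbit_C:
  assumes f: "f \<in> measurable M (cone_measure i j)" and g: "g \<in> measurable M scale"
  shows "(\<lambda>x. orbit (f x) (g x)) \<in> measurable M (cone_measure i j)"
proof (rule measurable_restrict_space2)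
  show "(\<lambda>x. orbit (f x) (g x)) \<in> space M \<rightarrow> cone i j"
    using measurable_space[OF f] measurable_space[OF g] orbit_in_cone_iff[OF i j]
    by (auto simp: space_cone space_scale)
  show "(\<lambda>x. orbit (f x) (g x)) \<in> measurable M lborel"
    using measurable_orbit[OF measurable_C_borel[OF f] g] by simp
qed

text \<open>Stated with a parameter because the Wigner transform is the transform of a family of functions
  that depends on the group element.\<close>

lemma borel_measurable_fkernel_param:
  assumes F: "(\<lambda>z. F (fst z) (snd z)) \<in> borel_measurable (Q \<Otimes>\<^sub>M haar)"
  shows "(\<lambda>z. fkernel (F (fst z)) (snd z)) \<in> borel_measurable (Q \<Otimes>\<^sub>M (cone2 i j))"
proof -
  let ?N = "Q \<Otimes>\<^sub>M (cone2 i j)"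
  have x: "(\<lambda>z. fst (snd z)) \<in> measurable ?N (cone_measure i j)" and y: "(\<lambda>z. snd (snd z)) \<in> measurable ?N (cone_measure i j)"
    by measurable
  have xb [measurable]: "(\<lambda>z. fst (snd z)) \<in> borel_measurable ?N" by (rule measurable_C_borel[OF x])
  have yb [measurable]: "(\<lambda>z. snd (snd z)) \<in> borel_measurable ?N" by (rule measurable_C_borel[OF y])
  have c [measurable]: "(\<lambda>z. coord (fst (snd z)) (snd (snd z))) \<in> measurable ?N scale"
    by (rule measurable_coord[OF x y])
  have c1 [measurable]: "(\<lambda>z. fst (coord (fst (snd z)) (snd (snd z)))) \<in> borel_measurable ?N"
    by (rule borel_measurable_coord[OF xb yb])
  have "(\<lambda>w. (fst (fst w), (snd w, coord (fst (snd (fst w))) (snd (snd (fst w))))))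
      \<in> measurable (?N \<Otimes>\<^sub>M lborel) (Q \<Otimes>\<^sub>M haar)"
    unfolding haar_eq by (intro measurable_Pair measurable_compose[OF measurable_fst c]) measurable
  from measurable_compose[OF this F]
  have Fm: "(\<lambda>w. F (fst (fst w)) (snd w, coord (fst (snd (fst w))) (snd (snd (fst w))))) \<in> borel_measurable (?N \<Otimes>\<^sub>M lborel)"
    by simp
  have ch: "(\<lambda>w. character (fst (snd (fst w))) (snd w)) \<in> borel_measurable (?N \<Otimes>\<^sub>M lborel)"
    by (intro borel_measurable_character measurable_compose[OF measurable_fst xb]) measurable
  have "(\<lambda>z. LINT b|lborel. F (fst z) (b, coord (fst (snd z)) (snd (snd z))) * character (fst (snd z)) b)
      \<in> borel_measurable ?N"
    using borel_measurable_times[OF Fm ch]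
    by (intro lborel.borel_measurable_lebesgue_integral) (simp add: case_prod_unfold)
  then show ?thesis
    unfolding fkernel_def case_prod_unfold ft_def by measurable
qed

lemma borel_measurable_fkernel:
  assumes F: "F \<in> borel_measurable haar"
  shows "fkernel F \<in> borel_measurable (cone2 i j)"
proof -
  have "(\<lambda>z. fkernel F (snd z)) \<in> borel_measurable (count_space (UNIV :: unit set) \<Otimes>\<^sub>M (cone2 i j))"
    by (rule borel_measurable_fkernel_param) (rule measurable_compose[OF measurable_snd F])
  from measurable_compose[OF measurable_Pair1' this, of "()"] show ?thesis by simp
qed

lemma fkernel_orbit:
  assumes x: "x \<in> cone i j" and n: "n \<in> half_plane"
  shows "fkernel F (x, orbit x n) = ft (\<lambda>b. F (b, n)) x / of_real (2 * pi * sqrt \<bar>mink x x\<bar> * (fst n)\<^sup>2)"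
  by (simp add: fkernel_def coord_orbit[OF x n])

text \<open>This is what the Duflo-Moore operator is for: after the substitution by the orbit map its square
  and the Jacobian cancel, and no weight remains.\<close>

lemma nn_integral_fkernel_section:
  assumes F: "F \<in> borel_measurable haar" and x: "x \<in> cone i j"
  shows "(\<integral>\<^sup>+y. ennreal ((cmod (fkernel F (x, y)))\<^sup>2) \<partial>(cone_measure i j)) =
    (\<integral>\<^sup>+n. ennreal ((cmod (ft (\<lambda>b. F (b, n)) x / (2 * pi)))\<^sup>2) \<partial>scale)"
proof -
  have "(\<lambda>y. fkernel F (x, y)) \<in> borel_measurable (cone_measure i j)"
    using x by (intro measurable_compose[OF measurable_Pair1' borel_measurable_fkernel[OF F]]) (simp add: space_cone)
  from borel_measurable_square_norm[OF this]
  have "(\<integral>\<^sup>+y. ennreal ((cmod (fkernel F (x, y)))\<^sup>2) \<partial>(cone_measure i j)) =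
      (\<integral>\<^sup>+n. ennreal ((cmod (fkernel F (x, orbit x n)))\<^sup>2) * ennreal (\<bar>mink x x\<bar> * fst n ^ 4) \<partial>scale)"
    by (rule nn_integral_orbit[OF i j x])
  also have "\<dots> = (\<integral>\<^sup>+n. ennreal ((cmod (ft (\<lambda>b. F (b, n)) x / (2 * pi)))\<^sup>2) \<partial>scale)"
  proof (rule nn_integral_cong)
    fix n assume "n \<in> space scale"
    then have n: "n \<in> half_plane" "fst n > 0" by (auto simp: space_scale half_plane_def)
    have m: "mink x x \<noteq> 0" by (rule mink_nonzero[OF i j x])
    have "(cmod (fkernel F (x, orbit x n)))\<^sup>2 * (\<bar>mink x x\<bar> * fst n ^ 4) = (cmod (ft (\<lambda>b. F (b, n)) x / (2 * pi)))\<^sup>2"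
    proof -
      have "cmod (fkernel F (x, orbit x n)) = cmod (ft (\<lambda>b. F (b, n)) x) / (2 * pi * sqrt \<bar>mink x x\<bar> * (fst n)\<^sup>2)"
        unfolding fkernel_orbit[OF x n(1)] norm_divide norm_of_real by (simp add: abs_mult)
      then show ?thesis
        using n(2) m by (simp add: norm_divide norm_mult power_divide power_mult_distrib flip: power_mult)
    qed
    then show "ennreal ((cmod (fkernel F (x, orbit x n)))\<^sup>2) * ennreal (\<bar>mink x x\<bar> * fst n ^ 4) =
        ennreal ((cmod (ft (\<lambda>b. F (b, n)) x / (2 * pi)))\<^sup>2)"
      by (simp flip: ennreal_mult)
  qed
  finally show ?thesis .
qed

lemma nn_integral_fkernel:
  assumes F: "F \<in> borel_measurable haar"
  shows "(\<integral>\<^sup>+z. ennreal ((cmod (fkernel F z))\<^sup>2) \<partial>(cone2 i j)) =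
    (\<integral>\<^sup>+x. \<integral>\<^sup>+n. ennreal ((cmod (ft (\<lambda>b. F (b, n)) x / (2 * pi)))\<^sup>2) \<partial>scale \<partial>(cone_measure i j))"
proof -
  have [measurable]: "fkernel F \<in> borel_measurable (cone2 i j)" by (rule borel_measurable_fkernel[OF F])
  show ?thesis
    by (subst nn_integral_sections[OF sigma_finite_cone, symmetric])
      (auto intro!: nn_integral_cong simp: nn_integral_fkernel_section[OF F] space_cone)
qed

text \<open>For each \<open>x\<close> the substitution by the orbit map carries null sets of scales and rapidities to null
  sets of the cone.\<close>

lemma AE_coord:
  assumes P: "AE n in scale. P n" and m [measurable]: "Measurable.pred scale P"
  shows "AE z in (cone2 i j). P (coord (fst z) (snd z))"
proof -
  have [measurable]: "(\<lambda>z. coord (fst z) (snd z)) \<in> measurable (cone2 i j) scale"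
    by (intro measurable_coord) measurable
  show ?thesis
  proof (rule CC.AE_pair_measure)
    show "{z \<in> space (cone2 i j). P (coord (fst z) (snd z))} \<in> sets (cone2 i j)"
      by measurable
    show "AE x in cone_measure i j. AE y in cone_measure i j. P (coord (fst (x, y)) (snd (x, y)))"
    proof (rule AE_I2)
      fix x assume "x \<in> space (cone_measure i j)"
      then have x: "x \<in> cone i j" by (simp add: space_cone)
      then have "(\<lambda>y. coord x y) \<in> measurable (cone_measure i j) scale"
        by (intro measurable_coord) (auto simp: space_cone)
      then have pm: "Measurable.pred (cone_measure i j) (\<lambda>y. P (coord x y))"
        by (rule measurable_compose) measurable
      let ?h = "\<lambda>y. if P (coord x y) then 0 else 1 :: ennreal"
      have h: "?h \<in> borel_measurable (cone_measure i j)"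
        by (rule measurable_If) (use predE[OF pm] in auto)
      have "(\<integral>\<^sup>+y. ?h y \<partial>(cone_measure i j)) = (\<integral>\<^sup>+n. ?h (orbit x n) * ennreal (\<bar>mink x x\<bar> * fst n ^ 4) \<partial>scale)"
        by (rule nn_integral_orbit[OF i j x h])
      also have "\<dots> = (\<integral>\<^sup>+n. 0 \<partial>scale)"
      proof (rule nn_integral_cong_AE, use P AE_space in eventually_elim)
        case (elim n)
        then show ?case using coord_orbit[OF x, of n] by (simp add: space_scale)
      qed
      finally have "AE y in cone_measure i j. ?h y = 0"
        using nn_integral_0_iff_AE[OF h] by simp
      then show "AE y in cone_measure i j. P (coord (fst (x, y)) (snd (x, y)))"
        by eventually_elim (auto split: if_splits)
    qed
  qed
qed

text \<open>Linearity holds only almost everywhere because the plane transforms of the sections exist only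
  for almost every scale and rapidity.\<close>

lemma fkernel_add_cmult:
  assumes F: "integrable haar F" and G: "integrable haar G"
  shows "AE z in (cone2 i j). fkernel (\<lambda>\<xi>. F \<xi> + c * G \<xi>) z = fkernel F z + c * fkernel G z"
proof -
  have "AE z in (cone2 i j). integrable lborel (\<lambda>b. F (b, coord (fst z) (snd z)))"
    "AE z in (cone2 i j). integrable lborel (\<lambda>b. G (b, coord (fst z) (snd z)))"
    using F G by (auto intro!: AE_coord AE_section_integrable pred_section_integrable)
  then show ?thesis
  proof eventually_elim
    case (elim z)
    then show ?case
      by (simp add: fkernel_def case_prod_unfold ft_add_cmult add_divide_distrib)
  qed
qed

text \<open>The cone is invariant, and the factor \<open>a\<close> of the representation compensates the Jacobian
  \<open>a\<^sup>2\<close> of the dilated boost.\<close>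

lemma nn_integral_rep:
  assumes \<eta>: "\<eta> \<in> borel_measurable (cone_measure i j)" and n: "n \<in> half_plane"
  shows "(\<integral>\<^sup>+x. ennreal ((cmod (rep (b, n) \<eta> x))\<^sup>2) \<partial>(cone_measure i j)) = (\<integral>\<^sup>+x. ennreal ((cmod (\<eta> x))\<^sup>2) \<partial>(cone_measure i j))"
proof -
  obtain a t where nat: "n = (a, t)" "a > 0" using n by (auto simp: half_plane_def)
  define f where "f x = ennreal ((cmod (\<eta> x))\<^sup>2) * indicator (cone i j) x" for x
  have "(\<lambda>x. ennreal ((cmod (\<eta> x))\<^sup>2)) \<in> borel_measurable (cone_measure i j)" using \<eta> by measurable
  then have f [measurable]: "f \<in> borel_measurable borel"
    unfolding f_def[abs_def] by (subst (asm) borel_measurable_restrict_space_iff_ennreal) auto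
  have "(\<integral>\<^sup>+x. ennreal ((cmod (\<eta> x))\<^sup>2) \<partial>(cone_measure i j)) = (\<integral>\<^sup>+x. f x \<partial>lborel)"
    by (simp add: nn_integral_restrict_space f_def)
  also have "\<dots> = ennreal (a\<^sup>2) * (\<integral>\<^sup>+x. f (0 + a *\<^sub>R (boost (- t) *v x)) \<partial>lborel)"
    by (rule nn_integral_boost) (use nat in auto)
  also have "\<dots> = (\<integral>\<^sup>+x. ennreal (a\<^sup>2) * f (orbit x n) \<partial>lborel)"
    by (subst nn_integral_cmult) (auto simp: orbit_def nat)
  also have "\<dots> = (\<integral>\<^sup>+x. ennreal ((cmod (rep (b, n) \<eta> x))\<^sup>2) * indicator (cone i j) x \<partial>lborel)"
  proof (rule nn_integral_cong)
    fix x
    have "cmod (rep (b, n) \<eta> x) = a * cmod (\<eta> (orbit x n))"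
      using nat by (simp add: rep_def norm_mult orbit_def)
    then show "ennreal (a\<^sup>2) * f (orbit x n) = ennreal ((cmod (rep (b, n) \<eta> x))\<^sup>2) * indicator (cone i j) x"
      using orbit_in_cone_iff[OF i j n, of x]
      by (simp add: f_def indicator_def power_mult_distrib ennreal_mult)
  qed
  finally show ?thesis by (simp add: nn_integral_restrict_space)
qed

lemma borel_measurable_rep:
  assumes \<eta>: "\<eta> \<in> borel_measurable (cone_measure i j)"
  shows "(\<lambda>z. rep (fst z) \<eta> (snd z)) \<in> borel_measurable (haar \<Otimes>\<^sub>M (cone_measure i j))"
proof -
  have x: "snd \<in> measurable (haar \<Otimes>\<^sub>M (cone_measure i j)) (cone_measure i j)" by measurable
  have s: "(\<lambda>z. snd (fst z)) \<in> measurable (haar \<Otimes>\<^sub>M (cone_measure i j)) scale"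
    unfolding haar_eq by measurable
  have b: "(\<lambda>z. fst (fst z)) \<in> borel_measurable (haar \<Otimes>\<^sub>M (cone_measure i j))"
    unfolding haar_eq by measurable
  have "(\<lambda>z. fst (snd (fst z))) \<in> borel_measurable (haar \<Otimes>\<^sub>M (cone_measure i j))"
    by (rule measurable_compose[OF s borel_measurable_fst_scale(1)])
  moreover have "(\<lambda>z. character (snd z) (fst (fst z))) \<in> borel_measurable (haar \<Otimes>\<^sub>M (cone_measure i j))"
    by (intro borel_measurable_character measurable_C_borel[OF x] b)
  moreover have "(\<lambda>z. \<eta> (orbit (snd z) (snd (fst z)))) \<in> borel_measurable (haar \<Otimes>\<^sub>M (cone_measure i j))"
    by (rule measurable_compose[OF measurable_orbit_C[OF x s] \<eta>])
  ultimately show ?thesis unfolding rep_eq by measurable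
qed

text \<open>By unitarity \<open>\<bar>F\<bar> \<bar>rep \<xi> \<eta>\<bar>\<^sup>2\<close> is integrable over the group and the cone, and \<open>r \<le> 1 + r\<^sup>2\<close>
  removes the square.\<close>

lemma AE_rep_integrable:
  assumes F: "integrable haar F" and \<eta>: "\<eta> \<in> L2 (cone_measure i j)"
  shows "AE x in cone_measure i j. integrable haar (\<lambda>\<xi>. F \<xi> * rep \<xi> \<eta> x)"
proof -
  have Fm [measurable]: "F \<in> borel_measurable haar" using F by auto
  have \<eta>m: "\<eta> \<in> borel_measurable (cone_measure i j)" using \<eta> by (rule L2_measurable)
  have rm [measurable]: "(\<lambda>z. rep (fst z) \<eta> (snd z)) \<in> borel_measurable (haar \<Otimes>\<^sub>M (cone_measure i j))"
    by (rule borel_measurable_rep[OF \<eta>m])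
  have rs [measurable]: "(\<lambda>z. rep (snd z) \<eta> (fst z)) \<in> borel_measurable ((cone_measure i j) \<Otimes>\<^sub>M haar)"
    using measurable_compose[OF measurable_pair_swap' rm] by (simp add: case_prod_unfold)
  have "(\<integral>\<^sup>+x. \<integral>\<^sup>+\<xi>. ennreal (cmod (F \<xi>)) * ennreal ((cmod (rep \<xi> \<eta> x))\<^sup>2) \<partial>haar \<partial>(cone_measure i j)) =
      (\<integral>\<^sup>+\<xi>. \<integral>\<^sup>+x. ennreal (cmod (F \<xi>)) * ennreal ((cmod (rep \<xi> \<eta> x))\<^sup>2) \<partial>(cone_measure i j) \<partial>haar)"
    by (rule HC.Fubini') (simp add: case_prod_unfold)
  also have "\<dots> = (\<integral>\<^sup>+\<xi>. ennreal (cmod (F \<xi>)) * ennreal ((l2_norm (cone_measure i j) \<eta>)\<^sup>2) \<partial>haar)"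
  proof (rule nn_integral_cong)
    fix \<xi> assume \<xi>: "\<xi> \<in> space haar"
    have "(\<lambda>x. rep \<xi> \<eta> x) \<in> borel_measurable (cone_measure i j)"
      using measurable_compose[OF measurable_Pair1'[OF \<xi>] rm] by simp
    moreover have "snd \<xi> \<in> half_plane" using \<xi> by (auto simp: space_haar carrier_Poincare)
    ultimately show "(\<integral>\<^sup>+x. ennreal (cmod (F \<xi>)) * ennreal ((cmod (rep \<xi> \<eta> x))\<^sup>2) \<partial>(cone_measure i j)) =
        ennreal (cmod (F \<xi>)) * ennreal ((l2_norm (cone_measure i j) \<eta>)\<^sup>2)"
      using nn_integral_rep[OF \<eta>m, of "snd \<xi>" "fst \<xi>"] \<eta>
      by (simp add: nn_integral_cmult nn_integral_square_L2)
  qed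
  also have "\<dots> < \<infinity>"
    using F by (simp add: nn_integral_multc integrable_iff_bounded ennreal_mult_less_top)
  finally have "AE x in cone_measure i j. (\<integral>\<^sup>+\<xi>. ennreal (cmod (F \<xi>)) * ennreal ((cmod (rep \<xi> \<eta> x))\<^sup>2) \<partial>haar) \<noteq> \<infinity>"
    by (intro nn_integral_noteq_infinite) (use rs in measurable)
  then show ?thesis
    using AE_space
  proof eventually_elim
    case (elim x)
    have rx [measurable]: "(\<lambda>\<xi>. rep \<xi> \<eta> x) \<in> borel_measurable haar"
      using measurable_compose[OF measurable_Pair2'[OF elim(2)] rm] by simp
    have "(\<integral>\<^sup>+\<xi>. ennreal (norm (F \<xi> * rep \<xi> \<eta> x)) \<partial>haar) \<le>
        (\<integral>\<^sup>+\<xi>. ennreal (cmod (F \<xi>)) + ennreal (cmod (F \<xi>)) * ennreal ((cmod (rep \<xi> \<eta> x))\<^sup>2) \<partial>haar)"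
    proof (rule nn_integral_mono)
      fix \<xi>
      have "r \<le> 1 + r\<^sup>2" for r :: real
        using sum_squares_bound[of r 1, simplified] zero_le_power2[of r] by linarith
      then have "cmod (F \<xi>) * cmod (rep \<xi> \<eta> x) \<le> cmod (F \<xi>) * (1 + (cmod (rep \<xi> \<eta> x))\<^sup>2)"
        by (intro mult_left_mono) auto
      then show "ennreal (norm (F \<xi> * rep \<xi> \<eta> x)) \<le>
          ennreal (cmod (F \<xi>)) + ennreal (cmod (F \<xi>)) * ennreal ((cmod (rep \<xi> \<eta> x))\<^sup>2)"
        by (simp add: norm_mult distrib_left ennreal_leI flip: ennreal_mult ennreal_plus)
    qed
    also have "\<dots> < \<infinity>"
      using F elim(1) by (subst nn_integral_add) (auto simp: integrable_iff_bounded less_top)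
    finally show ?case by (simp add: integrable_iff_bounded)
  qed
qed

lemma integral_orbit:
  fixes \<psi> :: "real^2 \<Rightarrow> complex"
  assumes x: "x \<in> cone i j" and \<psi>: "\<psi> \<in> borel_measurable (cone_measure i j)"
  shows "(LINT y|cone_measure i j. \<psi> y) = (LINT n|scale. (\<bar>mink x x\<bar> * fst n ^ 4) *\<^sub>R \<psi> (orbit x n))"
proof -
  have o: "orbit x \<in> measurable scale (cone_measure i j)"
    using measurable_orbit_C[of "\<lambda>_. x" scale "\<lambda>n. n"] x by (simp add: space_cone)
  let ?D = "density scale (\<lambda>n. ennreal (\<bar>mink x x\<bar> * fst n ^ 4))"
  have od: "orbit x \<in> measurable ?D (cone_measure i j)" using o by simp
  have "(cone_measure i j) = distr ?D (cone_measure i j) (orbit x)"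
  proof (rule measure_eqI)
    fix A assume A: "A \<in> sets (cone_measure i j)"
    have "emeasure (cone_measure i j) A = (\<integral>\<^sup>+n. indicator A (orbit x n) * ennreal (\<bar>mink x x\<bar> * fst n ^ 4) \<partial>scale)"
      using nn_integral_orbit[OF i j x, of "indicator A"] A by simp
    also have "\<dots> = (\<integral>\<^sup>+n. ennreal (\<bar>mink x x\<bar> * fst n ^ 4) * indicator (orbit x -` A \<inter> space scale) n \<partial>scale)"
      by (intro nn_integral_cong) (auto simp: indicator_def)
    also have "\<dots> = emeasure (distr ?D (cone_measure i j) (orbit x)) A"
      using A od measurable_sets[OF o A] by (simp add: emeasure_distr emeasure_density)
    finally show "emeasure (cone_measure i j) A = emeasure (distr ?D (cone_measure i j) (orbit x)) A" .
  qed simp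
  then have "(LINT y|cone_measure i j. \<psi> y) = (LINT y|distr ?D (cone_measure i j) (orbit x). \<psi> y)"
    by (rule arg_cong)
  also have "\<dots> = (LINT n|?D. \<psi> (orbit x n))"
    using \<psi> od by (intro integral_distr) auto
  also have "\<dots> = (LINT n|scale. (\<bar>mink x x\<bar> * fst n ^ 4) *\<^sub>R \<psi> (orbit x n))"
    using measurable_compose[OF o \<psi>] by (intro integral_density) auto
  finally show ?thesis .
qed

text \<open>Substitution of the orbit map in the integral over \<open>y\<close>, and Fubini to split off the integral
  over \<open>b\<close>, which is the plane transform.\<close>

lemma kernel_op_fkernel:
  assumes F: "integrable haar F" and \<phi>: "\<phi> \<in> borel_measurable (cone_measure i j)" and \<eta>: "duflo_moore \<phi> \<in> L2 (cone_measure i j)"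
  shows "AE x in cone_measure i j. kernel_op (cone_measure i j) (fkernel F) \<phi> x = (LINT \<xi>|haar. F \<xi> * rep \<xi> (duflo_moore \<phi>) x)"
  using AE_rep_integrable[OF F \<eta>] AE_space
proof eventually_elim
  case (elim x)
  then have x: "x \<in> cone i j" by (simp add: space_cone)
  have Fm: "F \<in> borel_measurable haar" using F by auto
  have m: "mink x x \<noteq> 0" by (rule mink_nonzero[OF i j x])
  have "(\<lambda>y. fkernel F (x, y)) \<in> borel_measurable (cone_measure i j)"
    using elim(2) by (intro measurable_compose[OF measurable_Pair1' borel_measurable_fkernel[OF Fm]])
  from borel_measurable_times[OF this \<phi>]
  have "kernel_op (cone_measure i j) (fkernel F) \<phi> x =
      (LINT n|scale. (\<bar>mink x x\<bar> * fst n ^ 4) *\<^sub>R (fkernel F (x, orbit x n) * \<phi> (orbit x n)))"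
    unfolding kernel_op_def by (rule integral_orbit[OF x])
  also have "\<dots> = (LINT n|scale. LINT b|lborel. F (b, n) * rep (b, n) (duflo_moore \<phi>) x)"
  proof (intro Bochner_Integration.integral_cong refl)
    fix n assume "n \<in> space scale"
    then have n: "n \<in> half_plane" "fst n > 0" by (auto simp: space_scale half_plane_def)
    have s: "complex_of_real (sqrt \<bar>mink x x\<bar>) * complex_of_real (sqrt \<bar>mink x x\<bar>) = complex_of_real \<bar>mink x x\<bar>"
      by (simp flip: of_real_mult)
    have s0: "complex_of_real (sqrt \<bar>mink x x\<bar>) \<noteq> 0" "complex_of_real (fst n) \<noteq> 0"
      using m n(2) by auto
    have "F (b, n) * rep (b, n) (duflo_moore \<phi>) x =
        F (b, n) * character x b * (of_real (fst n) * duflo_moore \<phi> (orbit x n))" for b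
      by (simp add: rep_eq mult_ac)
    then have "(LINT b|lborel. F (b, n) * rep (b, n) (duflo_moore \<phi>) x) =
        ft (\<lambda>b. F (b, n)) x * (of_real (fst n) * duflo_moore \<phi> (orbit x n))"
      unfolding ft_def by (simp only: integral_mult_left_zero)
    also have "duflo_moore \<phi> (orbit x n) = of_real (1 / (2 * pi) * (fst n * sqrt \<bar>mink x x\<bar>)) * \<phi> (orbit x n)"
      using n(2) by (simp add: duflo_moore_def mink_orbit abs_mult real_sqrt_mult)
    finally show "(\<bar>mink x x\<bar> * fst n ^ 4) *\<^sub>R (fkernel F (x, orbit x n) * \<phi> (orbit x n)) =
        (LINT b|lborel. F (b, n) * rep (b, n) (duflo_moore \<phi>) x)"
      unfolding fkernel_orbit[OF x n(1)] scaleR_conv_of_real of_real_mult s[symmetric]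
      using s0 by (simp add: field_simps power2_eq_square power4_eq_xxxx)
  qed
  also have "\<dots> = (LINT \<xi>|haar. F \<xi> * rep \<xi> (duflo_moore \<phi>) x)"
  proof -
    have e: "(\<lambda>(b, n). F (b, n) * rep (b, n) (duflo_moore \<phi>) x) = (\<lambda>\<xi>. F \<xi> * rep \<xi> (duflo_moore \<phi>) x)"
      by auto
    show ?thesis
      using LS.integral_snd[of "\<lambda>b n. F (b, n) * rep (b, n) (duflo_moore \<phi>) x"] elim(1)
      unfolding e haar_eq by simp
  qed
  finally show ?case .
qed

end

section \<open>The Plancherel theorem of the group\<close>

text \<open>The Plancherel theorem of the plane for almost every scale and rapidity.\<close>

lemma nn_integral_ft_sections:
  assumes F: "integrable haar F" "F \<in> L2 haar"
  shows "(\<integral>\<^sup>+n. \<integral>\<^sup>+x. ennreal ((cmod (ft (\<lambda>b. F (b, n)) x / (2 * pi)))\<^sup>2) \<partial>lborel \<partial>scale) =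
    ennreal ((l2_norm haar F)\<^sup>2)"
proof -
  have Fm [measurable]: "F \<in> borel_measurable haar" using F by auto
  have Fsq: "(\<lambda>w. ennreal ((cmod (F w))\<^sup>2)) \<in> borel_measurable haar" by measurable
  interpret LS: pair_sigma_finite lborel scale
    by (simp add: pair_sigma_finite_def sigma_finite_lborel sigma_finite_scale)
  have total: "(\<integral>\<^sup>+n. \<integral>\<^sup>+b. ennreal ((cmod (F (b, n)))\<^sup>2) \<partial>lborel \<partial>scale) = ennreal ((l2_norm haar F)\<^sup>2)"
    unfolding nn_integral_haar[OF Fsq, symmetric] by (rule nn_integral_square_L2[OF F(2)])
  have "(\<lambda>w. (snd w, fst w)) \<in> measurable (scale \<Otimes>\<^sub>M lborel) haar"
    unfolding haar_eq by measurable
  from measurable_compose[OF this Fsq]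
  have "(\<lambda>n. \<integral>\<^sup>+b. ennreal ((cmod (F (b, n)))\<^sup>2) \<partial>lborel) \<in> borel_measurable scale"
    by (intro lborel.borel_measurable_nn_integral) (simp add: case_prod_unfold)
  then have fin: "AE n in scale. (\<integral>\<^sup>+b. ennreal ((cmod (F (b, n)))\<^sup>2) \<partial>lborel) \<noteq> \<infinity>"
    by (rule nn_integral_noteq_infinite) (simp add: total)
  have sect: "(\<integral>\<^sup>+x. ennreal ((cmod (ft (\<lambda>b. F (b, n)) x / (2 * pi)))\<^sup>2) \<partial>lborel) =
      (\<integral>\<^sup>+b. ennreal ((cmod (F (b, n)))\<^sup>2) \<partial>lborel)"
    if fin: "(\<integral>\<^sup>+b. ennreal ((cmod (F (b, n)))\<^sup>2) \<partial>lborel) \<noteq> \<infinity>" and I: "integrable lborel (\<lambda>b. F (b, n))" for n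
  proof -
    let ?F = "\<lambda>b. F (b, n)"
    have Fn: "?F \<in> L2 lborel" using fin I by (auto simp: L2_iff_nn_integral less_top)
    have ftL: "ft ?F \<in> L2 lborel" by (rule ft_L2[OF I Fn])
    have ftm [measurable]: "ft ?F \<in> borel_measurable borel" using L2_measurable[OF ftL] by simp
    have "(\<integral>\<^sup>+x. ennreal ((cmod (ft ?F x / (2 * pi)))\<^sup>2) \<partial>lborel) =
        (\<integral>\<^sup>+x. ennreal (1 / (2 * pi)\<^sup>2) * ennreal ((cmod (ft ?F x))\<^sup>2) \<partial>lborel)"
      by (intro nn_integral_cong) (simp add: norm_divide norm_mult power_divide flip: ennreal_mult)
    also have "\<dots> = ennreal (1 / (2 * pi)\<^sup>2) * ennreal ((2 * pi * l2_norm lborel ?F)\<^sup>2)"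
      by (simp add: nn_integral_cmult nn_integral_square_L2[OF ftL] plancherel[OF I Fn])
    also have "\<dots> = ennreal ((l2_norm lborel ?F)\<^sup>2)"
      by (simp add: power_mult_distrib flip: ennreal_mult)
    finally show ?thesis by (simp add: nn_integral_square_L2[OF Fn])
  qed
  have "AE n in scale. (\<integral>\<^sup>+x. ennreal ((cmod (ft (\<lambda>b. F (b, n)) x / (2 * pi)))\<^sup>2) \<partial>lborel) =
      (\<integral>\<^sup>+b. ennreal ((cmod (F (b, n)))\<^sup>2) \<partial>lborel)"
    using fin AE_section_integrable[OF F(1)] by eventually_elim (rule sect)
  then show ?thesis
    unfolding total[symmetric] by (rule nn_integral_cong_AE)
qed

text \<open>Each cone accounts for the frequencies \<open>x\<close> in it, and together the cones fill the plane.\<close>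

lemma fkernel_nn_sum:
  assumes F: "integrable haar F" "F \<in> L2 haar"
  shows "(\<Sum>i\<in>{1, 2}. \<Sum>j\<in>{1, 2}. \<integral>\<^sup>+z. ennreal ((cmod (fkernel F z))\<^sup>2) \<partial>(cone2 i j)) =
    ennreal ((l2_norm haar F)\<^sup>2)"
proof -
  have Fm [measurable]: "F \<in> borel_measurable haar" using F by auto
  interpret LS: pair_sigma_finite lborel scale
    by (simp add: pair_sigma_finite_def sigma_finite_lborel sigma_finite_scale)
  let ?g = "\<lambda>x n. ennreal ((cmod (ft (\<lambda>b. F (b, n)) x / (2 * pi)))\<^sup>2)"
  have gm: "case_prod ?g \<in> borel_measurable (lborel \<Otimes>\<^sub>M scale)"
    using ft_section_measurable[OF Fm] unfolding case_prod_unfold by measurable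
  have "(\<lambda>x. \<integral>\<^sup>+n. ?g x n \<partial>scale) \<in> borel_measurable lborel"
    using LS.M2.borel_measurable_nn_integral[OF gm] .
  then have G: "(\<lambda>x. \<integral>\<^sup>+n. ?g x n \<partial>scale) \<in> borel_measurable borel" by simp
  have "(\<Sum>i\<in>{1, 2}. \<Sum>j\<in>{1, 2}. \<integral>\<^sup>+z. ennreal ((cmod (fkernel F z))\<^sup>2) \<partial>(cone2 i j)) =
      (\<Sum>i\<in>{1, 2}. \<Sum>j\<in>{1, 2}. \<integral>\<^sup>+x. \<integral>\<^sup>+n. ?g x n \<partial>scale \<partial>cone_measure i j)"
    by (intro sum.cong refl nn_integral_fkernel Fm)
  also have "\<dots> = (\<integral>\<^sup>+x. \<integral>\<^sup>+n. ?g x n \<partial>scale \<partial>lborel)"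
    by (rule nn_integral_cones[OF G])
  also have "\<dots> = (\<integral>\<^sup>+n. \<integral>\<^sup>+x. ?g x n \<partial>lborel \<partial>scale)"
    by (rule LS.Fubini'[OF gm, symmetric])
  also have "\<dots> = ennreal ((l2_norm haar F)\<^sup>2)"
    by (rule nn_integral_ft_sections[OF F])
  finally show ?thesis .
qed

lemma fkernel_L2:
  assumes F: "integrable haar F" "F \<in> L2 haar" and i: "i \<in> {1, 2}" and j: "j \<in> {1, 2}"
  shows "fkernel F \<in> L2 (cone2 i j)"
proof -
  let ?h = "\<lambda>i j. \<integral>\<^sup>+z. ennreal ((cmod (fkernel F z))\<^sup>2) \<partial>(cone2 i j)"
  have "?h i j \<le> (\<Sum>j\<in>{1, 2}. ?h i j)" using j by (intro member_le_sum) auto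
  also have "\<dots> \<le> (\<Sum>i\<in>{1, 2}. \<Sum>j\<in>{1, 2}. ?h i j)"
    using i by (intro member_le_sum[of i "{1, 2}" "\<lambda>i. \<Sum>j\<in>{1, 2}. ?h i j"]) auto
  also have "\<dots> < \<infinity>"
    unfolding fkernel_nn_sum[OF F] by simp
  finally show ?thesis
    using borel_measurable_fkernel[OF i j, of F] F by (auto simp: L2_iff_nn_integral)
qed

lemma fkernel_norm_sum:
  assumes F: "integrable haar F" "F \<in> L2 haar"
  shows "(\<Sum>i\<in>{1, 2}. \<Sum>j\<in>{1, 2}. (l2_norm (cone2 i j) (fkernel F))\<^sup>2) = (l2_norm haar F)\<^sup>2"
proof -
  have "ennreal (\<Sum>i\<in>{1, 2}. \<Sum>j\<in>{1, 2}. (l2_norm (cone2 i j) (fkernel F))\<^sup>2) =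
      (\<Sum>i\<in>{1, 2}. \<Sum>j\<in>{1, 2}. ennreal ((l2_norm (cone2 i j) (fkernel F))\<^sup>2))"
    by (simp add: ennreal_plus[symmetric] del: ennreal_plus)
  also have "\<dots> = ennreal ((l2_norm haar F)\<^sup>2)"
    unfolding fkernel_nn_sum[OF F, symmetric]
    by (intro sum.cong refl nn_integral_square_L2[symmetric] fkernel_L2 F)
  finally show ?thesis by (subst (asm) ennreal_inj) (auto intro!: sum_nonneg)
qed

lemma fkernel_norm_le:
  assumes F: "integrable haar F" "F \<in> L2 haar" and i: "i \<in> {1, 2}" and j: "j \<in> {1, 2}"
  shows "l2_norm (cone2 i j) (fkernel F) \<le> l2_norm haar F"
proof (rule power2_le_imp_le)
  let ?h = "\<lambda>i j. (l2_norm (cone2 i j) (fkernel F))\<^sup>2"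
  have "?h i j \<le> (\<Sum>j\<in>{1, 2}. ?h i j)" using j by (intro member_le_sum) auto
  also have "\<dots> \<le> (\<Sum>i\<in>{1, 2}. \<Sum>j\<in>{1, 2}. ?h i j)"
    using i by (intro member_le_sum[of i "{1, 2}" "\<lambda>i. \<Sum>j\<in>{1, 2}. ?h i j"]) (auto intro!: sum_nonneg)
  finally show "?h i j \<le> (l2_norm haar F)\<^sup>2" unfolding fkernel_norm_sum[OF F] .
qed simp

lemma fkernel_norm_diff_le:
  assumes F: "integrable haar F" "F \<in> L2 haar" and G: "integrable haar G" "G \<in> L2 haar"
    and i: "i \<in> {1, 2}" and j: "j \<in> {1, 2}"
  shows "l2_norm (cone2 i j) (\<lambda>z. fkernel F z - fkernel G z) \<le>
    l2_norm haar (\<lambda>\<xi>. F \<xi> - G \<xi>)"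
proof -
  let ?M = "cone2 i j"
  have D: "integrable haar (\<lambda>\<xi>. F \<xi> - G \<xi>)" "(\<lambda>\<xi>. F \<xi> - G \<xi>) \<in> L2 haar"
    using F G by auto
  have "AE z in ?M. fkernel F z - fkernel G z = fkernel (\<lambda>\<xi>. F \<xi> - G \<xi>) z"
    using fkernel_add_cmult[OF i j F(1) G(1), of "-1"] by eventually_elim simp
  then have "l2_norm ?M (\<lambda>z. fkernel F z - fkernel G z) = l2_norm ?M (fkernel (\<lambda>\<xi>. F \<xi> - G \<xi>))"
    using L2_measurable[OF L2_diff[OF fkernel_L2[OF F i j] fkernel_L2[OF G i j]]] L2_measurable[OF fkernel_L2[OF D i j]]
    by (intro l2_norm_cong_AE) auto
  then show ?thesis using fkernel_norm_le[OF D i j] by simp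
qed

lemma fkernel_inner_sum:
  assumes F: "integrable haar F" "F \<in> L2 haar" and G: "integrable haar G" "G \<in> L2 haar"
  shows "(\<Sum>i\<in>{1, 2}. \<Sum>j\<in>{1, 2}. l2_inner (cone2 i j) (fkernel F) (fkernel G)) = l2_inner haar F G"
proof -
  let ?M = "\<lambda>i j. cone_measure i j \<Otimes>\<^sub>M cone_measure i j" and ?D = "\<lambda>c \<xi>. F \<xi> + c * G \<xi>" and ?U = "{1, -1, \<i>, -\<i>}"
  have D: "integrable haar (?D c)" "?D c \<in> L2 haar" for c
    using F G by auto
  have *: "l2_inner (?M i j) (fkernel F) (fkernel G) = (\<Sum>c\<in>?U. c * of_real ((l2_norm (?M i j) (fkernel (?D c)))\<^sup>2)) / 4"
    if i: "i \<in> {1, 2}" and j: "j \<in> {1, 2}" for i j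
  proof -
    have "l2_norm (?M i j) (\<lambda>z. fkernel F z + c * fkernel G z) = l2_norm (?M i j) (fkernel (?D c))" for c
      using L2_measurable[OF L2_add[OF fkernel_L2[OF F i j] L2_cmult[OF fkernel_L2[OF G i j]]]]
        L2_measurable[OF fkernel_L2[OF D i j]] fkernel_add_cmult[OF i j F(1) G(1), of c]
      by (intro l2_norm_cong_AE) auto
    then show ?thesis
      unfolding l2_polarization[OF fkernel_L2[OF F i j] fkernel_L2[OF G i j]] by simp
  qed
  have "(\<Sum>i\<in>{1, 2}. \<Sum>j\<in>{1, 2}. l2_inner (?M i j) (fkernel F) (fkernel G)) =
      (\<Sum>i\<in>{1, 2}. \<Sum>j\<in>{1, 2}. (\<Sum>c\<in>?U. c * of_real ((l2_norm (?M i j) (fkernel (?D c)))\<^sup>2)) / 4)"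
    by (intro sum.cong refl *)
  also have "\<dots> = (\<Sum>c\<in>?U. c * of_real (\<Sum>i\<in>{1, 2}. \<Sum>j\<in>{1, 2}. (l2_norm (?M i j) (fkernel (?D c)))\<^sup>2)) / 4"
  proof -
    have swap: "(\<Sum>i\<in>{1, 2}. \<Sum>j\<in>{1, 2}. (\<Sum>c\<in>?U. c * of_real (r i j c)) / 4) =
        (\<Sum>c\<in>?U. c * of_real (\<Sum>i\<in>{1, 2}. \<Sum>j\<in>{1, 2}. r i j c)) / 4" for r :: "nat \<Rightarrow> nat \<Rightarrow> complex \<Rightarrow> real"
    proof -
      have e: "(\<Sum>i\<in>{1, 2}. \<Sum>j\<in>{1, 2}. s i j) = s 1 1 + s 1 2 + (s 2 1 + s 2 2)"
        for s :: "nat \<Rightarrow> nat \<Rightarrow> 'a::comm_monoid_add" by simp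
      show ?thesis
        unfolding e by (simp only: of_real_add distrib_left sum.distrib add_divide_distrib)
    qed
    show ?thesis by (rule swap)
  qed
  also have "\<dots> = l2_inner haar F G"
    unfolding fkernel_norm_sum[OF D] by (rule l2_polarization[OF F(2) G(2), symmetric])
  finally show ?thesis .
qed

section \<open>The Fourier transform as a kernel operator\<close>

context
  fixes i j :: nat
  assumes i: "i \<in> {1, 2}" and j: "j \<in> {1, 2}"
begin

lemma is_fourier_L1_L2_kernel:
  assumes F: "integrable haar F" "F \<in> L2 haar"
  shows "is_fourier_L1_L2 i j F (kernel_op (cone_measure i j) (fkernel F))"
  unfolding is_fourier_L1_L2_def
  using hs_op_kernel[OF sigma_finite_cone fkernel_L2[OF F i j] is_onb_onb_cone[OF i j]] kernel_op_fkernel[OF i j F(1)]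
  by (auto dest: L2_measurable)

text \<open>Restricting \<open>\<phi>\<close> to the points with \<open>\<bar>\<langle>x; x\<rangle>\<bar> \<le> n\<close> makes the Duflo-Moore operator bounded on it.\<close>

lemma duflo_moore_dense:
  assumes \<phi>: "\<phi> \<in> L2 (cone_measure i j)"
  shows "\<exists>g. (\<forall>n. g n \<in> L2 (cone_measure i j) \<and> duflo_moore (g n) \<in> L2 (cone_measure i j)) \<and> (\<lambda>n. l2_norm (cone_measure i j) (\<lambda>x. \<phi> x - g n x)) \<longlonglongrightarrow> 0"
proof -
  define g where "g n x = (if \<bar>mink x x\<bar> \<le> real n then \<phi> x else 0)" for n :: nat and x
  have \<phi>m [measurable]: "\<phi> \<in> borel_measurable (cone_measure i j)" using \<phi> by (rule L2_measurable)
  have mm: "(\<lambda>x. mink x x) \<in> borel_measurable (cone_measure i j)"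
    by (intro borel_measurable_cone) measurable
  have gm: "g n \<in> borel_measurable (cone_measure i j)" for n
    unfolding g_def[abs_def]
    by (intro measurable_If \<phi>m) (use borel_measurable_le[OF borel_measurable_abs[OF mm], of "\<lambda>_. real n"] in auto)
  have gL: "g n \<in> L2 (cone_measure i j)" for n
    by (rule L2_bound[OF \<phi> gm, of _ 1]) (auto simp: g_def)
  have dm: "duflo_moore (g n) \<in> borel_measurable (cone_measure i j)" for n
  proof -
    have "(\<lambda>x. complex_of_real (1 / (2 * pi) * sqrt \<bar>mink x x\<bar>)) \<in> borel_measurable (cone_measure i j)"
      using measurable_compose[OF mm, of "\<lambda>r. complex_of_real (1 / (2 * pi) * sqrt \<bar>r\<bar>)" borel] by simp
    then show ?thesis
      unfolding duflo_moore_def[abs_def] by (rule borel_measurable_times) (rule gm)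
  qed
  have dL: "duflo_moore (g n) \<in> L2 (cone_measure i j)" for n
  proof (rule L2_bound[OF \<phi> dm, of _ "1 / (2 * pi) * sqrt (real n)"])
    show "AE x in cone_measure i j. cmod (duflo_moore (g n) x) \<le> 1 / (2 * pi) * sqrt (real n) * cmod (\<phi> x)"
      by (intro AE_I2) (auto simp: duflo_moore_def g_def norm_mult norm_divide intro!: mult_right_mono divide_right_mono real_sqrt_le_mono)
  qed
  have "(\<lambda>n. LINT x|cone_measure i j. (cmod (\<phi> x - g n x))\<^sup>2) \<longlonglongrightarrow> (LINT x|cone_measure i j. 0)"
  proof (rule integral_dominated_convergence[where w = "\<lambda>x. (cmod (\<phi> x))\<^sup>2"])
    show "(\<lambda>x. (cmod (\<phi> x - g n x))\<^sup>2) \<in> borel_measurable (cone_measure i j)" for n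
      by (intro borel_measurable_cmod_square borel_measurable_diff \<phi>m gm)
    show "integrable (cone_measure i j) (\<lambda>x. (cmod (\<phi> x))\<^sup>2)" using \<phi> by (rule L2_square_integrable)
    show "AE x in cone_measure i j. (\<lambda>n. (cmod (\<phi> x - g n x))\<^sup>2) \<longlonglongrightarrow> 0"
    proof (rule AE_I2)
      fix x
      obtain N :: nat where N: "\<bar>mink x x\<bar> \<le> real N" using real_arch_simple by blast
      have "(cmod (\<phi> x - g n x))\<^sup>2 = 0" if "n \<ge> N" for n
      proof -
        have "\<bar>mink x x\<bar> \<le> real n" using N that by linarith
        then show ?thesis by (simp add: g_def)
      qed
      then show "(\<lambda>n. (cmod (\<phi> x - g n x))\<^sup>2) \<longlonglongrightarrow> 0"
        by (intro tendsto_eventually eventually_sequentiallyI[of N])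
    qed
    show "AE x in cone_measure i j. norm ((cmod (\<phi> x - g n x))\<^sup>2) \<le> (cmod (\<phi> x))\<^sup>2" for n
      by (auto simp: g_def)
  qed simp
  then have "(\<lambda>n. sqrt (LINT x|cone_measure i j. (cmod (\<phi> x - g n x))\<^sup>2)) \<longlonglongrightarrow> sqrt 0"
    by (intro tendsto_real_sqrt) simp
  then have "(\<lambda>n. l2_norm (cone_measure i j) (\<lambda>x. \<phi> x - g n x)) \<longlonglongrightarrow> 0"
    by (simp add: l2_norm_def)
  with gL dL show ?thesis by blast
qed

text \<open>The integral formula fixes the chosen operator on the domain of the Duflo-Moore operator, and this
  domain is dense.\<close>

lemma has_kernel_fourier_L1_L2:
  assumes F: "integrable haar F" "F \<in> L2 haar"
  shows "has_kernel (cone_measure i j) (fourier_L1_L2 i j F) (fkernel F)"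
proof -
  have T: "is_fourier_L1_L2 i j F (fourier_L1_L2 i j F)"
    unfolding fourier_L1_L2_def
    by (rule someI[of "is_fourier_L1_L2 i j F"]) (rule is_fourier_L1_L2_kernel[OF F])
  show ?thesis
  proof (rule has_kernel_dense[OF sigma_finite_cone _ fkernel_L2[OF F i j]])
    show "bounded_op (cone_measure i j) (fourier_L1_L2 i j F)"
      using T by (simp add: is_fourier_L1_L2_def hs_op_def)
    fix f assume "f \<in> L2 (cone_measure i j)"
    from duflo_moore_dense[OF this] obtain g where g: "\<And>n. g n \<in> L2 (cone_measure i j)" "\<And>n. duflo_moore (g n) \<in> L2 (cone_measure i j)"
      "(\<lambda>n. l2_norm (cone_measure i j) (\<lambda>x. f x - g n x)) \<longlonglongrightarrow> 0" by blast
    have "AE x in cone_measure i j. fourier_L1_L2 i j F (g n) x = kernel_op (cone_measure i j) (fkernel F) (g n) x" for n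
    proof -
      have "AE x in cone_measure i j. fourier_L1_L2 i j F (g n) x = (LINT \<xi>|haar. F \<xi> * rep \<xi> (duflo_moore (g n)) x)"
        using T g unfolding is_fourier_L1_L2_def by blast
      with kernel_op_fkernel[OF i j F(1) L2_measurable[OF g(1)[of n]] g(2)[of n]] show ?thesis
        by eventually_elim simp
    qed
    with g show "\<exists>g. (\<forall>n. g n \<in> L2 (cone_measure i j) \<and> (AE x in cone_measure i j. fourier_L1_L2 i j F (g n) x = kernel_op (cone_measure i j) (fkernel F) (g n) x)) \<and>
        (\<lambda>n. l2_norm (cone_measure i j) (\<lambda>x. f x - g n x)) \<longlonglongrightarrow> 0"
      by blast
  qed
qed

end

definition exhaustion :: "nat \<Rightarrow> poincare set" where
  "exhaustion = (SOME A. range A \<subseteq> sets haar \<and> (\<Union>n. A n) = space haar \<and> (\<forall>n. emeasure haar (A n) \<noteq> \<infinity>) \<and> incseq A)"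

lemma exhaustion:
  shows "exhaustion n \<in> sets haar" "(\<Union>n. exhaustion n) = space haar" "emeasure haar (exhaustion n) \<noteq> \<infinity>"
    "incseq exhaustion"
proof -
  obtain A :: "nat \<Rightarrow> poincare set" where "range A \<subseteq> sets haar" "(\<Union>n. A n) = space haar"
      "\<And>n. emeasure haar (A n) \<noteq> \<infinity>" "incseq A"
    using sigma_finite_measure.sigma_finite_incseq[OF sigma_finite_haar] by metis
  then have "\<exists>A. range A \<subseteq> sets haar \<and> (\<Union>n. A n) = space haar \<and> (\<forall>n. emeasure haar (A n) \<noteq> \<infinity>) \<and> incseq (A :: nat \<Rightarrow> poincare set)"
    by blast
  from someI_ex[OF this, folded exhaustion_def]
  show "exhaustion n \<in> sets haar" "(\<Union>n. exhaustion n) = space haar" "emeasure haar (exhaustion n) \<noteq> \<infinity>"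
    "incseq exhaustion" by auto
qed

definition truncation :: "nat \<Rightarrow> (poincare \<Rightarrow> complex) \<Rightarrow> poincare \<Rightarrow> complex" where
  "truncation n F \<xi> = indicator (exhaustion n) \<xi> * F \<xi>"

lemma truncation_L2:
  assumes F: "F \<in> L2 haar"
  shows "truncation n F \<in> L2 haar" "integrable haar (truncation n F)"
    and "(\<lambda>n. l2_norm haar (\<lambda>\<xi>. truncation n F \<xi> - F \<xi>)) \<longlonglongrightarrow> 0"
proof -
  have Fm [measurable]: "F \<in> borel_measurable haar" using F by (rule L2_measurable)
  have [measurable]: "exhaustion n \<in> sets haar" for n by (rule exhaustion)
  have tm [measurable]: "truncation n F \<in> borel_measurable haar" for n
    unfolding truncation_def[abs_def] by measurable
  show "truncation n F \<in> L2 haar" for n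
    by (rule L2_bound[OF F tm, of _ 1]) (auto simp: truncation_def norm_mult indicator_def)
  have ind: "(\<lambda>\<xi>. indicator (exhaustion n) \<xi> :: complex) \<in> L2 haar"
  proof -
    have "integrable haar (\<lambda>\<xi>. indicator (exhaustion n) \<xi> :: real)"
      using exhaustion(3)[of n] by (intro integrable_real_indicator) (auto simp: less_top)
    moreover have "(cmod (indicator (exhaustion n) \<xi>))\<^sup>2 = indicator (exhaustion n) \<xi>" for \<xi>
      by (simp add: indicator_def)
    ultimately show ?thesis by (simp add: L2_def)
  qed
  show "integrable haar (truncation n F)"
    unfolding truncation_def[abs_def] by (rule L2_mult_integrable[OF ind F])
  have "(\<lambda>n. LINT \<xi>|haar. (cmod (truncation n F \<xi> - F \<xi>))\<^sup>2) \<longlonglongrightarrow> (LINT \<xi>|haar. 0)"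
  proof (rule integral_dominated_convergence[where w = "\<lambda>\<xi>. (cmod (F \<xi>))\<^sup>2"])
    show "integrable haar (\<lambda>\<xi>. (cmod (F \<xi>))\<^sup>2)" using F by (rule L2_square_integrable)
    show "AE \<xi> in haar. (\<lambda>n. (cmod (truncation n F \<xi> - F \<xi>))\<^sup>2) \<longlonglongrightarrow> 0"
    proof (rule AE_I2)
      fix \<xi> assume "\<xi> \<in> space haar"
      then obtain N where N: "\<xi> \<in> exhaustion N" using exhaustion(2) by blast
      have "(cmod (truncation n F \<xi> - F \<xi>))\<^sup>2 = 0" if "n \<ge> N" for n
      proof -
        have "\<xi> \<in> exhaustion n" using N that exhaustion(4) by (auto simp: incseq_def)
        then show ?thesis by (simp add: truncation_def)
      qed
      then show "(\<lambda>n. (cmod (truncation n F \<xi> - F \<xi>))\<^sup>2) \<longlonglongrightarrow> 0"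
        by (intro tendsto_eventually eventually_sequentiallyI[of N])
    qed
    show "AE \<xi> in haar. norm ((cmod (truncation n F \<xi> - F \<xi>))\<^sup>2) \<le> (cmod (F \<xi>))\<^sup>2" for n
      by (auto simp: truncation_def indicator_def)
  qed auto
  then have "(\<lambda>n. sqrt (LINT \<xi>|haar. (cmod (truncation n F \<xi> - F \<xi>))\<^sup>2)) \<longlonglongrightarrow> sqrt 0"
    by (intro tendsto_real_sqrt) simp
  then show "(\<lambda>n. l2_norm haar (\<lambda>\<xi>. truncation n F \<xi> - F \<xi>)) \<longlonglongrightarrow> 0"
    by (simp add: l2_norm_def)
qed

definition is_fourier_kernel :: "nat \<Rightarrow> nat \<Rightarrow> (poincare \<Rightarrow> complex) \<Rightarrow> ((real^2) \<times> (real^2) \<Rightarrow> complex) \<Rightarrow> bool" where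
  "is_fourier_kernel i j F K \<longleftrightarrow> K \<in> L2 (cone2 i j) \<and>
     (\<lambda>n. l2_norm (cone2 i j) (\<lambda>z. fkernel (truncation n F) z - K z)) \<longlonglongrightarrow> 0"

text \<open>For square integrable \<open>F\<close> the limit of the kernels of the truncations. The value 0 otherwise
  matches the convention for \<open>fourier\<close>.\<close>

definition fourier_kernel :: "nat \<Rightarrow> nat \<Rightarrow> (poincare \<Rightarrow> complex) \<Rightarrow> (real^2) \<times> (real^2) \<Rightarrow> complex" where
  "fourier_kernel i j F = (if F \<in> L2 haar then SOME K. is_fourier_kernel i j F K else (\<lambda>z. 0))"

context
  fixes i j :: nat
  assumes i: "i \<in> {1, 2}" and j: "j \<in> {1, 2}"
begin

text \<open>On each cone the kernels of the truncations are at most as far apart as the truncations, so they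
  converge by completeness.\<close>

lemma is_fourier_kernel_fourier_kernel:
  assumes F: "F \<in> L2 haar"
  shows "is_fourier_kernel i j F (fourier_kernel i j F)"
proof -
  note t = truncation_L2[OF F]
  have fL: "fkernel (truncation n F) \<in> L2 (cone2 i j)" for n
    by (rule fkernel_L2[OF t(2) t(1) i j])
  have "\<exists>N. \<forall>m\<ge>N. \<forall>n\<ge>N. l2_norm (cone2 i j) (\<lambda>z. fkernel (truncation m F) z - fkernel (truncation n F) z) < e" if "e > 0" for e
  proof -
    have "e / 2 > 0" using that by simp
    from LIMSEQ_D[OF t(3) this]
    obtain N where "\<forall>n\<ge>N. norm (l2_norm haar (\<lambda>\<xi>. truncation n F \<xi> - F \<xi>) - 0) < e / 2" ..
    then have N: "l2_norm haar (\<lambda>\<xi>. truncation n F \<xi> - F \<xi>) < e / 2" if "n \<ge> N" for n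
      using that by simp
    have "l2_norm (cone2 i j) (\<lambda>z. fkernel (truncation m F) z - fkernel (truncation n F) z) < e" if "m \<ge> N" "n \<ge> N" for m n
    proof -
      have "l2_norm (cone2 i j) (\<lambda>z. fkernel (truncation m F) z - fkernel (truncation n F) z) \<le> l2_norm haar (\<lambda>\<xi>. truncation m F \<xi> - truncation n F \<xi>)"
        by (rule fkernel_norm_diff_le[OF t(2) t(1) t(2) t(1) i j])
      also have "\<dots> \<le> l2_norm haar (\<lambda>\<xi>. truncation m F \<xi> - F \<xi>) + l2_norm haar (\<lambda>\<xi>. F \<xi> - truncation n F \<xi>)"
        by (rule l2_norm_triangle_diff[OF t(1) F t(1)])
      also have "\<dots> < e"
        using N[OF that(1)] N[OF that(2)] l2_norm_minus_commute[of haar F "truncation n F"] by simp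
      finally show ?thesis .
    qed
    then show ?thesis by blast
  qed
  from L2_complete[OF fL this] have "\<exists>K. is_fourier_kernel i j F K"
    by (auto simp: is_fourier_kernel_def)
  from someI_ex[OF this] show ?thesis using F by (simp add: fourier_kernel_def)
qed

lemma fourier_kernel_L2: "fourier_kernel i j F \<in> L2 (cone2 i j)"
  using is_fourier_kernel_fourier_kernel[of F] by (cases "F \<in> L2 haar") (auto simp: is_fourier_kernel_def fourier_kernel_def[of i j F])

lemma fkernel_tendsto_fourier_kernel:
  assumes F: "F \<in> L2 haar" and Fs: "\<And>n::nat. integrable haar (Fs n)" "\<And>n. Fs n \<in> L2 haar"
    and lim: "(\<lambda>n. l2_norm haar (\<lambda>\<xi>. Fs n \<xi> - F \<xi>)) \<longlonglongrightarrow> 0"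
  shows "(\<lambda>n. l2_norm (cone2 i j) (\<lambda>z. fkernel (Fs n) z - fourier_kernel i j F z)) \<longlonglongrightarrow> 0"
proof (rule tendsto_sandwich[OF _ _ tendsto_const])
  note t = truncation_L2[OF F]
  let ?b = "\<lambda>n. (l2_norm haar (\<lambda>\<xi>. Fs n \<xi> - F \<xi>) + l2_norm haar (\<lambda>\<xi>. truncation n F \<xi> - F \<xi>)) +
      l2_norm (cone2 i j) (\<lambda>z. fkernel (truncation n F) z - fourier_kernel i j F z)"
  have "?b \<longlonglongrightarrow> 0 + 0 + 0"
    using is_fourier_kernel_fourier_kernel[OF F] by (intro tendsto_add lim t(3)) (simp add: is_fourier_kernel_def)
  then show "?b \<longlonglongrightarrow> 0" by simp
  have "l2_norm (cone2 i j) (\<lambda>z. fkernel (Fs n) z - fourier_kernel i j F z) \<le> ?b n" for n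
  proof -
    have "l2_norm (cone2 i j) (\<lambda>z. fkernel (Fs n) z - fkernel (truncation n F) z) \<le> l2_norm haar (\<lambda>\<xi>. Fs n \<xi> - truncation n F \<xi>)"
      by (rule fkernel_norm_diff_le[OF Fs(1) Fs(2) t(2) t(1) i j])
    also have "\<dots> \<le> l2_norm haar (\<lambda>\<xi>. Fs n \<xi> - F \<xi>) + l2_norm haar (\<lambda>\<xi>. F \<xi> - truncation n F \<xi>)"
      by (rule l2_norm_triangle_diff[OF Fs(2) F t(1)])
    finally show ?thesis
      using l2_norm_triangle_diff[OF fkernel_L2[OF Fs(1)[of n] Fs(2)[of n] i j]
          fkernel_L2[OF t(2)[of n] t(1)[of n] i j] fourier_kernel_L2[of F]]
        l2_norm_minus_commute[of haar F "truncation n F"] by simp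
  qed
  then show "\<forall>\<^sub>F n in sequentially. l2_norm (cone2 i j) (\<lambda>z. fkernel (Fs n) z - fourier_kernel i j F z) \<le> ?b n"
    by (rule always_eventually[OF allI])
qed simp

text \<open>Existence of the extension by continuity.\<close>

lemma is_fourier_kernel_op:
  assumes F: "F \<in> L2 haar"
  shows "is_fourier i j F (kernel_op (cone_measure i j) (fourier_kernel i j F))"
  unfolding is_fourier_def
proof (intro conjI allI impI)
  let ?C = "cone_measure i j"
  note sfC = sigma_finite_cone[of i j] and onbC = is_onb_onb_cone[OF i j]
  show "hs_op ?C (kernel_op ?C (fourier_kernel i j F))"
    by (rule hs_op_kernel[OF sfC fourier_kernel_L2 onbC])
  fix Fs :: "nat \<Rightarrow> poincare \<Rightarrow> complex"
  assume a: "(\<forall>n. integrable haar (Fs n) \<and> Fs n \<in> L2 haar) \<and> (\<lambda>n. l2_norm haar (\<lambda>\<xi>. Fs n \<xi> - F \<xi>)) \<longlonglongrightarrow> 0"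
  then have Fs: "integrable haar (Fs n)" "Fs n \<in> L2 haar" for n by auto
  have k: "has_kernel ?C (kernel_op ?C (fourier_kernel i j F)) (fourier_kernel i j F)"
    using kernel_op_L2(1)[OF sfC fourier_kernel_L2] by (simp add: has_kernel_def)
  have "hs_norm ?C (\<lambda>\<phi> x. fourier_L1_L2 i j (Fs n) \<phi> x - kernel_op ?C (fourier_kernel i j F) \<phi> x) =
      l2_norm (cone2 i j) (\<lambda>z. fkernel (Fs n) z - fourier_kernel i j F z)" for n
    by (intro hs_norm_has_kernel sfC onbC has_kernel_diff L2_diff fkernel_L2 Fs i j fourier_kernel_L2
        has_kernel_fourier_L1_L2 k)
  then show "(\<lambda>n. hs_norm ?C (\<lambda>\<phi> x. fourier_L1_L2 i j (Fs n) \<phi> x - kernel_op ?C (fourier_kernel i j F) \<phi> x)) \<longlonglongrightarrow> 0"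
    using fkernel_tendsto_fourier_kernel[OF F Fs] a by simp
qed

text \<open>Convergence in the Hilbert-Schmidt norm determines the value of the chosen operator on each basis
  vector; linearity and boundedness then determine it on L2.\<close>

lemma has_kernel_fourier:
  shows "has_kernel (cone_measure i j) (fourier i j F) (fourier_kernel i j F)"
proof (cases "F \<in> L2 haar")
  case False
  then show ?thesis
    by (simp add: fourier_def fourier_kernel_def has_kernel_def kernel_op_def)
next
  case F: True
  let ?C = "cone_measure i j" and ?T = "fourier i j F" and ?K = "fourier_kernel i j F"
  note sfC = sigma_finite_cone[of i j] and onbC = is_onb_onb_cone[OF i j]
  note t = truncation_L2[OF F]
  let ?e = "onb ?C" and ?S = "\<lambda>n. fourier_L1_L2 i j (truncation n F)"
  have eL: "?e m \<in> L2 ?C" for m by (rule is_onb_L2[OF onbC])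
  have T: "is_fourier i j F ?T"
    using F someI[of "is_fourier i j F", OF is_fourier_kernel_op[OF F]] by (simp add: fourier_def)
  then have Tb: "bounded_op ?C ?T" and Ts: "summable (\<lambda>m. (l2_norm ?C (?T (?e m)))\<^sup>2)"
    by (auto simp: is_fourier_def hs_op_def)
  have TL: "?T f \<in> L2 ?C" if "f \<in> L2 ?C" for f
    using Tb that by (simp add: bounded_op_def)
  have lim: "(\<lambda>n. hs_norm ?C (\<lambda>\<phi> x. ?S n \<phi> x - ?T \<phi> x)) \<longlonglongrightarrow> 0"
    using T[unfolded is_fourier_def, THEN conjunct2, rule_format, of "\<lambda>n. truncation n F"] t by simp
  have Sk: "has_kernel ?C (?S n) (fkernel (truncation n F))" for n
    by (rule has_kernel_fourier_L1_L2[OF i j t(2) t(1)])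
  have fL: "fkernel (truncation n F) \<in> L2 (cone2 i j)" for n by (rule fkernel_L2[OF t(2) t(1) i j])
  have SL: "?S n f \<in> L2 ?C" if "f \<in> L2 ?C" for f n
    using Sk[of n] that by (simp add: has_kernel_def)
  have KL: "kernel_op ?C ?K f \<in> L2 ?C" if "f \<in> L2 ?C" for f
    by (rule kernel_op_L2(1)[OF sfC fourier_kernel_L2 that])
  \<comment> \<open>The difference on a basis vector is bounded by two quantities that tend to 0 with the truncation.\<close>
  have basis: "AE x in ?C. ?T (?e m) x = kernel_op ?C ?K (?e m) x" for m
  proof -
    have "l2_norm ?C (\<lambda>x. ?T (?e m) x - kernel_op ?C ?K (?e m) x) \<le>
        hs_norm ?C (\<lambda>\<phi> x. ?S n \<phi> x - ?T \<phi> x) + l2_norm (cone2 i j) (\<lambda>z. fkernel (truncation n F) z - ?K z)" for n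
    proof -
      let ?d = "\<lambda>m. (l2_norm ?C (\<lambda>x. ?S n (?e m) x - ?T (?e m) x))\<^sup>2"
      have sd: "summable ?d"
      proof (rule summable_comparison_test')
        have "summable (\<lambda>m. (l2_norm ?C (kernel_op ?C (fkernel (truncation n F)) (?e m)))\<^sup>2)"
          using kernel_op_onb_sums[OF sfC fL onbC] by (rule sums_summable)
        moreover have "l2_norm ?C (kernel_op ?C (fkernel (truncation n F)) (?e m)) = l2_norm ?C (?S n (?e m))" for m
          using Sk[of n] eL[of m] L2_measurable[OF SL[OF eL]] L2_measurable[OF kernel_op_L2(1)[OF sfC fL eL]]
          by (intro l2_norm_cong_AE) (auto simp: has_kernel_def)
        ultimately show "summable (\<lambda>m. 2 * (l2_norm ?C (?S n (?e m)))\<^sup>2 + 2 * (l2_norm ?C (?T (?e m)))\<^sup>2)"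
          using Ts by (intro summable_add summable_mult) auto
        fix m
        have "l2_norm ?C (\<lambda>x. ?S n (?e m) x - ?T (?e m) x) \<le> l2_norm ?C (?S n (?e m)) + l2_norm ?C (?T (?e m))"
          using l2_norm_triangle[OF SL[OF eL[of m], of n] L2_cmult[OF TL[OF eL[of m]], of "-1"]]
            l2_norm_cmult[of ?C "-1" "?T (?e m)"] by simp
        then have "?d m \<le> (l2_norm ?C (?S n (?e m)) + l2_norm ?C (?T (?e m)))\<^sup>2"
          by (intro power_mono) auto
        also have "\<dots> \<le> 2 * (l2_norm ?C (?S n (?e m)))\<^sup>2 + 2 * (l2_norm ?C (?T (?e m)))\<^sup>2"
          using sum_squares_bound[of "l2_norm ?C (?S n (?e m))" "l2_norm ?C (?T (?e m))"]
          by (simp add: power2_sum)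
        finally show "norm (?d m) \<le> 2 * (l2_norm ?C (?S n (?e m)))\<^sup>2 + 2 * (l2_norm ?C (?T (?e m)))\<^sup>2"
          by simp
      qed
      then have "?d m \<le> (hs_norm ?C (\<lambda>\<phi> x. ?S n \<phi> x - ?T \<phi> x))\<^sup>2"
        using sum_le_suminf[of ?d "{m}"] suminf_nonneg[OF sd] by (simp add: hs_norm_def)
      then have 1: "l2_norm ?C (\<lambda>x. ?S n (?e m) x - ?T (?e m) x) \<le> hs_norm ?C (\<lambda>\<phi> x. ?S n \<phi> x - ?T \<phi> x)"
      proof (rule power2_le_imp_le)
        show "hs_norm ?C (\<lambda>\<phi> x. ?S n \<phi> x - ?T \<phi> x) \<ge> 0"
          unfolding hs_norm_def by (rule real_sqrt_ge_zero, rule suminf_nonneg[OF sd]) simp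
      qed
      have Dk: "has_kernel ?C (\<lambda>\<phi> x. ?S n \<phi> x - kernel_op ?C ?K \<phi> x) (\<lambda>z. fkernel (truncation n F) z - ?K z)"
        by (rule has_kernel_diff[OF sfC fL Sk fourier_kernel_L2]) (simp add: has_kernel_def KL)
      have DL: "(\<lambda>z. fkernel (truncation n F) z - ?K z) \<in> L2 (cone2 i j)"
        by (intro L2_diff fL fourier_kernel_L2)
      have "l2_norm ?C (\<lambda>x. ?S n (?e m) x - kernel_op ?C ?K (?e m) x) =
          l2_norm ?C (kernel_op ?C (\<lambda>z. fkernel (truncation n F) z - ?K z) (?e m))"
        using Dk eL[of m] L2_measurable[OF kernel_op_L2(1)[OF sfC DL eL]]
        by (intro l2_norm_cong_AE) (auto simp: has_kernel_def dest: L2_measurable)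
      also have "\<dots> \<le> l2_norm (cone2 i j) (\<lambda>z. fkernel (truncation n F) z - ?K z) * l2_norm ?C (?e m)"
        by (rule kernel_op_L2(2)[OF sfC DL eL])
      also have "l2_norm ?C (?e m) = 1"
      proof -
        have "l2_inner ?C (?e m) (?e m) = 1" using onbC by (simp add: is_onb_def)
        then have "(l2_norm ?C (?e m))\<^sup>2 = 1" unfolding l2_inner_self by (metis of_real_eq_1_iff)
        then show ?thesis by (metis l2_norm_nonneg power2_eq_1_iff one_neq_neg_one le_minus_one_simps(3))
      qed
      finally have 2: "l2_norm ?C (\<lambda>x. ?S n (?e m) x - kernel_op ?C ?K (?e m) x) \<le>
          l2_norm (cone2 i j) (\<lambda>z. fkernel (truncation n F) z - ?K z)" by simp
      show ?thesis
        using 1 2 l2_norm_triangle_diff[OF TL[OF eL[of m]] SL[OF eL[of m], of n] KL[OF eL[of m]]]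
          l2_norm_minus_commute[of ?C "?T (?e m)" "?S n (?e m)"] by linarith
    qed
    moreover have "(\<lambda>n. hs_norm ?C (\<lambda>\<phi> x. ?S n \<phi> x - ?T \<phi> x) + l2_norm (cone2 i j) (\<lambda>z. fkernel (truncation n F) z - ?K z)) \<longlonglongrightarrow> 0 + 0"
      using is_fourier_kernel_fourier_kernel[OF F] by (intro tendsto_add lim) (simp add: is_fourier_kernel_def)
    ultimately have "l2_norm ?C (\<lambda>x. ?T (?e m) x - kernel_op ?C ?K (?e m) x) \<le> 0 + 0"
      by (intro LIMSEQ_le_const) auto
    then have "l2_norm ?C (\<lambda>x. ?T (?e m) x - kernel_op ?C ?K (?e m) x) = 0"
      using l2_norm_nonneg[of ?C] by (intro antisym) auto
    then show ?thesis
      using L2_diff[OF TL[OF eL[of m]] KL[OF eL[of m]]] by (simp add: l2_norm_eq_0_iff)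
  qed
  have Kb: "bounded_op ?C (kernel_op ?C ?K)" by (rule bounded_op_kernel[OF sfC fourier_kernel_L2])
  have span: "AE x in ?C. ?T (expansion ?C ?e N f) x = kernel_op ?C ?K (expansion ?C ?e N f) x" for N f
  proof (induction N)
    case 0
    have "AE x in ?C. A (\<lambda>y. 0 * 0) x = 0 * A (\<lambda>y. 0) x" if "bounded_op ?C A" for A
    proof -
      have hom: "\<forall>c. \<forall>f\<in>L2 ?C. AE x in ?C. A (\<lambda>y. c * f y) x = c * A f x"
        using that by (simp add: bounded_op_def)
      from bspec[OF spec[OF hom, of 0] L2_zero] show ?thesis .
    qed
    from this[OF Tb] this[OF Kb] show ?case
      by eventually_elim (simp add: expansion_def[abs_def])
  next
    case (Suc N)
    let ?p = "expansion ?C ?e N f" and ?q = "\<lambda>x. l2_inner ?C f (?e N) * ?e N x"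
    have pL: "?p \<in> L2 ?C" by (intro L2_expansion eL)
    have qL: "?q \<in> L2 ?C" by (intro L2_cmult eL)
    have add: "AE x in ?C. A (\<lambda>y. ?p y + ?q y) x = A ?p x + l2_inner ?C f (?e N) * A (?e N) x" if A: "bounded_op ?C A" for A
    proof -
      have "AE x in ?C. A (\<lambda>y. ?p y + ?q y) x = A ?p x + A ?q x"
        "AE x in ?C. A ?q x = l2_inner ?C f (?e N) * A (?e N) x"
        using A pL qL eL[of N] by (simp_all add: bounded_op_def)
      then show ?thesis by eventually_elim simp
    qed
    from add[OF Tb] add[OF Kb] Suc basis[of N] have "AE x in ?C. ?T (\<lambda>y. ?p y + ?q y) x = kernel_op ?C ?K (\<lambda>y. ?p y + ?q y) x"
      by eventually_elim simp
    moreover have "(\<lambda>y. ?p y + ?q y) = expansion ?C ?e (Suc N) f"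
      by (simp add: expansion_def fun_eq_iff)
    ultimately show ?case by simp
  qed
  show ?thesis
  proof (rule has_kernel_dense[OF sfC Tb fourier_kernel_L2])
    fix f assume f: "f \<in> L2 ?C"
    show "\<exists>g. (\<forall>n. g n \<in> L2 ?C \<and> (AE x in ?C. ?T (g n) x = kernel_op ?C ?K (g n) x)) \<and>
        (\<lambda>n. l2_norm ?C (\<lambda>x. f x - g n x)) \<longlonglongrightarrow> 0"
      by (intro exI[of _ "\<lambda>n. expansion ?C ?e n f"] conjI allI span expansion_converges onbC f L2_expansion eL)
  qed
qed

end

theorem fourier_kernel_inner_sum:
  assumes F: "F \<in> L2 haar" and G: "G \<in> L2 haar"
  shows "(\<Sum>i\<in>{1, 2}. \<Sum>j\<in>{1, 2}. l2_inner (cone2 i j) (fourier_kernel i j F) (fourier_kernel i j G)) =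
    l2_inner haar F G"
proof (rule LIMSEQ_unique)
  note tF = truncation_L2[OF F] and tG = truncation_L2[OF G]
  have "l2_inner haar (truncation n F) (truncation n G) =
      (\<Sum>i\<in>{1, 2}. \<Sum>j\<in>{1, 2}. l2_inner (cone2 i j) (fkernel (truncation n F)) (fkernel (truncation n G)))" for n
    by (rule fkernel_inner_sum[OF tF(2) tF(1) tG(2) tG(1), symmetric])
  moreover have "(\<lambda>n. \<Sum>i\<in>{1, 2}. \<Sum>j\<in>{1, 2}. l2_inner (cone2 i j) (fkernel (truncation n F)) (fkernel (truncation n G)))
      \<longlonglongrightarrow> (\<Sum>i\<in>{1, 2}. \<Sum>j\<in>{1, 2}. l2_inner (cone2 i j) (fourier_kernel i j F) (fourier_kernel i j G))"
    by (intro tendsto_sum tendsto_l2_inner fkernel_L2 fourier_kernel_L2 tF tG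
        fkernel_tendsto_fourier_kernel[OF _ _ F tF(2) tF(1) tF(3)] fkernel_tendsto_fourier_kernel[OF _ _ G tG(2) tG(1) tG(3)])
  ultimately show "(\<lambda>n. l2_inner haar (truncation n F) (truncation n G)) \<longlonglongrightarrow>
      (\<Sum>i\<in>{1, 2}. \<Sum>j\<in>{1, 2}. l2_inner (cone2 i j) (fourier_kernel i j F) (fourier_kernel i j G))"
    by simp
  show "(\<lambda>n. l2_inner haar (truncation n F) (truncation n G)) \<longlonglongrightarrow> l2_inner haar F G"
    by (rule tendsto_l2_inner[OF tF(1) F tG(1) G tF(3) tG(3)])
qed

section \<open>The Wigner transform\<close>

lemma measurable_haar_components:
  assumes "f \<in> measurable M haar"
  shows "(\<lambda>x. fst (f x)) \<in> borel_measurable M" "(\<lambda>x. fst (snd (f x))) \<in> borel_measurable M"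
    "(\<lambda>x. snd (snd (f x))) \<in> borel_measurable M"
proof -
  have f: "f \<in> measurable M (lborel \<Otimes>\<^sub>M scale)" using assms by (simp add: haar_eq)
  show "(\<lambda>x. fst (f x)) \<in> borel_measurable M"
    using measurable_compose[OF f measurable_fst] by simp
  have s: "(\<lambda>x. snd (f x)) \<in> measurable M scale"
    by (rule measurable_compose[OF f measurable_snd])
  show "(\<lambda>x. fst (snd (f x))) \<in> borel_measurable M" "(\<lambda>x. snd (snd (f x))) \<in> borel_measurable M"
    by (rule measurable_compose[OF s borel_measurable_fst_scale(1)] measurable_compose[OF s borel_measurable_fst_scale(2)])+
qed

lemma measurable_into_haar:
  assumes "b \<in> borel_measurable M" "a \<in> borel_measurable M" "t \<in> borel_measurable M"
    "\<And>x. x \<in> space M \<Longrightarrow> a x > 0"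
  shows "(\<lambda>x. (b x, a x, t x)) \<in> measurable M haar"
  unfolding haar_eq using assms by (intro measurable_Pair measurable_into_scale) auto

lemma haar_space_pos: "f \<in> measurable M haar \<Longrightarrow> x \<in> space M \<Longrightarrow> fst (snd (f x)) > 0"
  using measurable_space[of f M haar x] by (auto simp: space_haar carrier_Poincare half_plane_def)

lemma measurable_mult_haar:
  assumes f: "f \<in> measurable M haar" and g: "g \<in> measurable M haar"
  shows "(\<lambda>x. f x \<otimes>\<^bsub>Poincare\<^esub> g x) \<in> measurable M haar"
proof -
  note [measurable] = measurable_haar_components[OF f] measurable_haar_components[OF g]
  have "(\<lambda>x. (fst (f x) + fst (snd (f x)) *\<^sub>R (boost (snd (snd (f x))) *v fst (g x)),
      fst (snd (f x)) * fst (snd (g x)), snd (snd (f x)) + snd (snd (g x)))) \<in> measurable M haar"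
    by (intro measurable_into_haar) (use haar_space_pos[OF f] haar_space_pos[OF g] in auto)
  then show ?thesis by (simp add: Poincare_def case_prod_unfold)
qed

lemma measurable_inv_haar:
  assumes f: "f \<in> measurable M haar"
  shows "(\<lambda>x. inv\<^bsub>Poincare\<^esub> (f x)) \<in> measurable M haar"
proof -
  note [measurable] = measurable_haar_components[OF f]
  have "(\<lambda>x. (- ((1 / fst (snd (f x))) *\<^sub>R (boost (- snd (snd (f x))) *v fst (f x))),
      1 / fst (snd (f x)), - snd (snd (f x)))) \<in> measurable M haar"
    by (intro measurable_into_haar) (use haar_space_pos[OF f] in auto)
  moreover have "inv\<^bsub>Poincare\<^esub> (f x) = (- ((1 / fst (snd (f x))) *\<^sub>R (boost (- snd (snd (f x))) *v fst (f x))),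
      1 / fst (snd (f x)), - snd (snd (f x)))" if "x \<in> space M" for x
    using inv_Poincare[OF haar_space_pos[OF f that], of "fst (f x)" "snd (snd (f x))"] by simp
  ultimately show ?thesis by (subst measurable_cong) auto
qed

lemma measurable_psqrt_haar:
  assumes f: "f \<in> measurable M haar"
  shows "(\<lambda>x. psqrt (f x)) \<in> measurable M haar"
proof -
  note [measurable] = measurable_haar_components[OF f]
  have "cosh \<in> borel_measurable (borel :: real measure)"
    by (intro borel_measurable_continuous_onI continuous_intros)
  note cosh = measurable_compose[OF _ this]
  have [measurable]: "(\<lambda>x. cosh (snd (snd (f x)) / 2)) \<in> borel_measurable M"
    by (rule cosh) measurable
  have "(\<lambda>x. ((1 / (1 + fst (snd (f x)) + 2 * sqrt (fst (snd (f x))) * cosh (snd (snd (f x)) / 2))) *\<^sub>R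
      (fst (f x) + sqrt (fst (snd (f x))) *\<^sub>R (boost (- snd (snd (f x)) / 2) *v fst (f x))),
     sqrt (fst (snd (f x))), snd (snd (f x)) / 2)) \<in> measurable M haar"
    by (intro measurable_into_haar) (use haar_space_pos[OF f] in auto)
  then show ?thesis by (simp add: psqrt_def case_prod_unfold)
qed

text \<open>The arguments of \<open>f\<close> and \<open>h\<close> in the Wigner transform at \<open>w\<close>, as functions of the pair
  \<open>(w, \<xi>)\<close>. Their product is \<open>\<xi>\<close>.\<close>

definition wigner_coords :: "poincare \<times> poincare \<Rightarrow> poincare \<times> poincare" where
  "wigner_coords z = (psqrt (snd z) \<otimes>\<^bsub>Poincare\<^esub> fst z, inv\<^bsub>Poincare\<^esub> (fst z) \<otimes>\<^bsub>Poincare\<^esub> psqrt (snd z))"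

lemma measurable_wigner_coords: "wigner_coords \<in> measurable (haar \<Otimes>\<^sub>M haar) (haar \<Otimes>\<^sub>M haar)"
  unfolding wigner_coords_def[abs_def]
  by (intro measurable_Pair measurable_mult_haar measurable_inv_haar measurable_psqrt_haar measurable_fst measurable_snd)

lemma psqrt_carrier: "\<xi> \<in> carrier Poincare \<Longrightarrow> psqrt \<xi> \<in> carrier Poincare"
  by (auto simp: psqrt_def Poincare_def)

text \<open>For fixed \<open>\<xi>\<close> the first coordinate \<open>u\<close> is a left translate of \<open>w\<close>, and the second is
  \<open>u\<^sup>-\<^sup>1 \<xi>\<close>; for fixed \<open>u\<close> the latter is a left translate of \<open>\<xi>\<close>. So left invariance is applied
  twice, and of the square root only measurability and \<open>psqrt_mult\<close> matter.\<close>

lemma nn_integral_wigner_coords: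
  assumes \<Phi>: "\<Phi> \<in> borel_measurable (haar \<Otimes>\<^sub>M haar)"
  shows "(\<integral>\<^sup>+z. \<Phi> (wigner_coords z) \<partial>(haar \<Otimes>\<^sub>M haar)) = (\<integral>\<^sup>+z. \<Phi> z \<partial>(haar \<Otimes>\<^sub>M haar))"
proof -
  interpret HH: pair_sigma_finite haar haar
    by (simp add: pair_sigma_finite_def sigma_finite_haar)
  interpret G: group Poincare by (rule group_Poincare)
  have \<Phi>w: "(\<lambda>z. \<Phi> (wigner_coords z)) \<in> borel_measurable (haar \<Otimes>\<^sub>M haar)"
    by (rule measurable_compose[OF measurable_wigner_coords \<Phi>])
  have \<Phi>u: "(\<lambda>z. \<Phi> (fst z, inv\<^bsub>Poincare\<^esub> (fst z) \<otimes>\<^bsub>Poincare\<^esub> snd z)) \<in> borel_measurable (haar \<Otimes>\<^sub>M haar)"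
    by (rule measurable_compose[OF _ \<Phi>])
      (intro measurable_Pair measurable_mult_haar measurable_inv_haar measurable_fst measurable_snd)
  have "(\<integral>\<^sup>+z. \<Phi> (wigner_coords z) \<partial>(haar \<Otimes>\<^sub>M haar)) = (\<integral>\<^sup>+\<xi>. \<integral>\<^sup>+w. \<Phi> (wigner_coords (w, \<xi>)) \<partial>haar \<partial>haar)"
    by (rule HH.nn_integral_snd[OF \<Phi>w, symmetric])
  also have "\<dots> = (\<integral>\<^sup>+\<xi>. \<integral>\<^sup>+u. \<Phi> (u, inv\<^bsub>Poincare\<^esub> u \<otimes>\<^bsub>Poincare\<^esub> \<xi>) \<partial>haar \<partial>haar)"
  proof (rule nn_integral_cong)
    fix \<xi> assume "\<xi> \<in> space haar"
    then have \<xi>: "\<xi> \<in> carrier Poincare" by (simp add: space_haar)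
    have s: "psqrt \<xi> \<in> carrier Poincare" by (rule psqrt_carrier[OF \<xi>])
    let ?g = "\<lambda>u. \<Phi> (u, inv\<^bsub>Poincare\<^esub> u \<otimes>\<^bsub>Poincare\<^esub> \<xi>)"
    have "?g \<in> borel_measurable haar"
      using measurable_compose[OF measurable_Pair2' \<Phi>u, of \<xi>] \<xi> by (simp add: space_haar)
    from haar_left_invariant[OF this s]
    have "(\<integral>\<^sup>+u. ?g u \<partial>haar) = (\<integral>\<^sup>+w. ?g (psqrt \<xi> \<otimes>\<^bsub>Poincare\<^esub> w) \<partial>haar)" ..
    also have "\<dots> = (\<integral>\<^sup>+w. \<Phi> (wigner_coords (w, \<xi>)) \<partial>haar)"
    proof (rule nn_integral_cong)
      fix w assume "w \<in> space haar"
      then have w: "w \<in> carrier Poincare" by (simp add: space_haar)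
      have "inv\<^bsub>Poincare\<^esub> (psqrt \<xi> \<otimes>\<^bsub>Poincare\<^esub> w) \<otimes>\<^bsub>Poincare\<^esub> \<xi> =
          inv\<^bsub>Poincare\<^esub> w \<otimes>\<^bsub>Poincare\<^esub> (inv\<^bsub>Poincare\<^esub> psqrt \<xi> \<otimes>\<^bsub>Poincare\<^esub> (psqrt \<xi> \<otimes>\<^bsub>Poincare\<^esub> psqrt \<xi>))"
        using s w \<xi> by (simp add: G.inv_mult_group G.m_assoc psqrt_mult)
      also have "inv\<^bsub>Poincare\<^esub> psqrt \<xi> \<otimes>\<^bsub>Poincare\<^esub> (psqrt \<xi> \<otimes>\<^bsub>Poincare\<^esub> psqrt \<xi>) = psqrt \<xi>"
        using s by (simp add: G.m_assoc[symmetric])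
      finally show "?g (psqrt \<xi> \<otimes>\<^bsub>Poincare\<^esub> w) = \<Phi> (wigner_coords (w, \<xi>))"
        by (simp add: wigner_coords_def)
    qed
    finally show "(\<integral>\<^sup>+w. \<Phi> (wigner_coords (w, \<xi>)) \<partial>haar) = (\<integral>\<^sup>+u. ?g u \<partial>haar)" ..
  qed
  also have "\<dots> = (\<integral>\<^sup>+u. \<integral>\<^sup>+\<xi>. \<Phi> (u, inv\<^bsub>Poincare\<^esub> u \<otimes>\<^bsub>Poincare\<^esub> \<xi>) \<partial>haar \<partial>haar)"
    using \<Phi>u by (intro HH.Fubini') (simp add: case_prod_unfold)
  also have "\<dots> = (\<integral>\<^sup>+u. \<integral>\<^sup>+v. \<Phi> (u, v) \<partial>haar \<partial>haar)"
  proof (rule nn_integral_cong)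
    fix u assume u: "u \<in> space haar"
    have "(\<lambda>v. \<Phi> (u, v)) \<in> borel_measurable haar"
      using measurable_compose[OF measurable_Pair1' \<Phi>] u by simp
    then show "(\<integral>\<^sup>+\<xi>. \<Phi> (u, inv\<^bsub>Poincare\<^esub> u \<otimes>\<^bsub>Poincare\<^esub> \<xi>) \<partial>haar) = (\<integral>\<^sup>+v. \<Phi> (u, v) \<partial>haar)"
      using u by (intro haar_left_invariant) (auto simp: space_haar)
  qed
  also have "\<dots> = (\<integral>\<^sup>+z. \<Phi> z \<partial>(haar \<Otimes>\<^sub>M haar))"
    by (rule sigma_finite_measure.nn_integral_fst[OF sigma_finite_haar \<Phi>])
  finally show ?thesis .
qed

lemma distr_wigner_coords: "distr (haar \<Otimes>\<^sub>M haar) (haar \<Otimes>\<^sub>M haar) wigner_coords = haar \<Otimes>\<^sub>M haar"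
proof (rule measure_eqI)
  fix A assume "A \<in> sets (distr (haar \<Otimes>\<^sub>M haar) (haar \<Otimes>\<^sub>M haar) wigner_coords)"
  then have A: "A \<in> sets (haar \<Otimes>\<^sub>M haar)" by simp
  have "emeasure (distr (haar \<Otimes>\<^sub>M haar) (haar \<Otimes>\<^sub>M haar) wigner_coords) A =
      (\<integral>\<^sup>+z. indicator A z \<partial>distr (haar \<Otimes>\<^sub>M haar) (haar \<Otimes>\<^sub>M haar) wigner_coords)"
    using A by simp
  also have "\<dots> = (\<integral>\<^sup>+z. indicator A (wigner_coords z) \<partial>(haar \<Otimes>\<^sub>M haar))"
    using A by (intro nn_integral_distr measurable_wigner_coords) auto
  also have "\<dots> = emeasure (haar \<Otimes>\<^sub>M haar) A"
    using A by (subst nn_integral_wigner_coords) auto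
  finally show "emeasure (distr (haar \<Otimes>\<^sub>M haar) (haar \<Otimes>\<^sub>M haar) wigner_coords) A = emeasure (haar \<Otimes>\<^sub>M haar) A" .
qed simp

definition wigner_integrand :: "(poincare \<Rightarrow> complex) \<Rightarrow> (poincare \<Rightarrow> complex) \<Rightarrow> poincare \<Rightarrow> poincare \<Rightarrow> complex" where
  "wigner_integrand f h w \<xi> = f (psqrt \<xi> \<otimes>\<^bsub>Poincare\<^esub> w) * cnj (h (inv\<^bsub>Poincare\<^esub> w \<otimes>\<^bsub>Poincare\<^esub> psqrt \<xi>))"

lemma wigner_eq: "wigner f h w i j = fourier i j (wigner_integrand f h w)"
  by (simp add: wigner_def wigner_integrand_def[abs_def])

lemma wigner_integrand_eq: "(\<lambda>z. wigner_integrand f h (fst z) (snd z)) = (\<lambda>z. (\<lambda>(u, v). f u * cnj (h v)) (wigner_coords z))"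
  by (simp add: wigner_integrand_def wigner_coords_def)

lemma L2_wigner_integrand:
  assumes "f \<in> L2 haar" "h \<in> L2 haar"
  shows "(\<lambda>z. wigner_integrand f h (fst z) (snd z)) \<in> L2 (haar \<Otimes>\<^sub>M haar)"
proof -
  have P: "(\<lambda>(u, v). f u * cnj (h v)) \<in> L2 (haar \<Otimes>\<^sub>M haar)"
    using L2_product[OF sigma_finite_haar assms(1) L2_cnj[OF assms(2)]] by simp
  have "integrable (distr (haar \<Otimes>\<^sub>M haar) (haar \<Otimes>\<^sub>M haar) wigner_coords) (\<lambda>z. (cmod ((\<lambda>(u, v). f u * cnj (h v)) z))\<^sup>2)"
    unfolding distr_wigner_coords by (rule L2_square_integrable[OF P])
  then show ?thesis
    unfolding wigner_integrand_eq L2_def mem_Collect_eq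
    using measurable_compose[OF measurable_wigner_coords L2_measurable[OF P]]
      integrable_distr[OF measurable_wigner_coords] by blast
qed

text \<open>In the coordinates \<open>wigner_coords\<close> the integrand is a product of a function of \<open>u\<close> and a
  function of \<open>v\<close>.\<close>

lemma l2_inner_wigner_integrand:
  assumes f: "f \<in> L2 haar" and g: "g \<in> L2 haar" and h: "h \<in> L2 haar" and k: "k \<in> L2 haar"
  shows "l2_inner (haar \<Otimes>\<^sub>M haar) (\<lambda>z. wigner_integrand f h (fst z) (snd z)) (\<lambda>z. wigner_integrand g k (fst z) (snd z)) =
    l2_inner haar f g * cnj (l2_inner haar h k)"
proof -
  interpret HH: pair_sigma_finite haar haar
    by (simp add: pair_sigma_finite_def sigma_finite_haar)
  let ?P = "\<lambda>f h. \<lambda>(u, v). f u * cnj (h v) :: complex" and ?M = "haar \<Otimes>\<^sub>M haar"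
  have P: "?P f h \<in> L2 ?M" "?P g k \<in> L2 ?M"
    using L2_product[OF sigma_finite_haar f L2_cnj[OF h]] L2_product[OF sigma_finite_haar g L2_cnj[OF k]] by simp_all
  have I: "integrable ?M (\<lambda>z. ?P f h z * cnj (?P g k z))"
    by (rule L2_inner_integrable[OF P])
  have "l2_inner ?M (\<lambda>z. wigner_integrand f h (fst z) (snd z)) (\<lambda>z. wigner_integrand g k (fst z) (snd z)) =
      (LINT z|distr ?M ?M wigner_coords. ?P f h z * cnj (?P g k z))"
    unfolding wigner_integrand_eq l2_inner_def
    by (subst integral_distr[OF measurable_wigner_coords borel_measurable_integrable[OF I]]) simp
  also have "\<dots> = (LINT u|haar. LINT v|haar. ?P f h (u, v) * cnj (?P g k (u, v)))"
    unfolding distr_wigner_coords by (rule HH.integral_fst'[OF I, symmetric])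
  also have "\<dots> = (LINT u|haar. LINT v|haar. (f u * cnj (g u)) * cnj (h v * cnj (k v)))"
    by (simp add: mult_ac)
  also have "\<dots> = l2_inner haar f g * cnj (l2_inner haar h k)"
    unfolding integral_mult_right_zero integral_mult_left_zero l2_inner_def Bochner_Integration.integral_cnj ..
  finally show ?thesis .
qed

context
  fixes i j :: nat
  assumes i: "i \<in> {1, 2}" and j: "j \<in> {1, 2}"
begin

text \<open>Approximations of \<open>fourier_kernel i j (F w)\<close> that, unlike this limit, are given by a formula and
  hence depend measurably on \<open>w\<close>.\<close>

definition fourier_kernel_approx :: "(poincare \<Rightarrow> poincare \<Rightarrow> complex) \<Rightarrow> nat \<Rightarrow> poincare \<Rightarrow> (real^2) \<times> (real^2) \<Rightarrow> complex" where
  "fourier_kernel_approx F n w z = (if F w \<in> L2 haar then fkernel (truncation n (F w)) z else 0)"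

lemma fourier_kernel_approx:
  assumes F: "(\<lambda>z. F (fst z) (snd z)) \<in> borel_measurable (haar \<Otimes>\<^sub>M haar)"
  shows "(\<lambda>z. fourier_kernel_approx F n (fst z) (snd z)) \<in> borel_measurable (haar \<Otimes>\<^sub>M (cone2 i j))"
    and "fourier_kernel_approx F n w \<in> L2 (cone2 i j)"
    and "(\<lambda>n. l2_norm (cone2 i j) (\<lambda>z. fourier_kernel_approx F n w z - fourier_kernel i j (F w) z)) \<longlonglongrightarrow> 0"
proof -
  interpret H: sigma_finite_measure haar by (rule sigma_finite_haar)
  have [measurable]: "exhaustion n \<in> sets haar" by (rule exhaustion)
  have [measurable]: "(\<lambda>z. F (fst z) (snd z)) \<in> borel_measurable (haar \<Otimes>\<^sub>M haar)" by (rule F)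
  have "(\<lambda>z. truncation n (F (fst z)) (snd z)) \<in> borel_measurable (haar \<Otimes>\<^sub>M haar)"
    unfolding truncation_def by measurable
  from borel_measurable_fkernel_param[where F = "\<lambda>w. truncation n (F w)", OF i j this]
  have fk: "(\<lambda>z. fkernel (truncation n (F (fst z))) (snd z)) \<in> borel_measurable (haar \<Otimes>\<^sub>M (cone2 i j))" .
  have sec: "F w \<in> borel_measurable haar" if "w \<in> space haar" for w
    using measurable_compose[OF measurable_Pair1'[OF that] F] by simp
  have nn: "(\<lambda>w. \<integral>\<^sup>+\<xi>. ennreal ((cmod (F w \<xi>))\<^sup>2) \<partial>haar) \<in> borel_measurable haar"
    using borel_measurable_square_norm[OF F] by (intro H.borel_measurable_nn_integral) (simp add: case_prod_unfold)
  have "{w \<in> space haar. F w \<in> L2 haar} = {w \<in> space haar. (\<integral>\<^sup>+\<xi>. ennreal ((cmod (F w \<xi>))\<^sup>2) \<partial>haar) < \<infinity>}"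
    using sec by (auto simp: L2_iff_nn_integral)
  also have "\<dots> \<in> sets haar" using nn by measurable
  finally have E: "{w \<in> space haar. F w \<in> L2 haar} \<in> sets haar" .
  have "{z \<in> space (haar \<Otimes>\<^sub>M (cone2 i j)). F (fst z) \<in> L2 haar} =
      {w \<in> space haar. F w \<in> L2 haar} \<times> space (cone2 i j)"
    by (auto simp: space_pair_measure)
  also have "\<dots> \<in> sets (haar \<Otimes>\<^sub>M (cone2 i j))"
    using E by (intro pair_measureI sets.top)
  finally show "(\<lambda>z. fourier_kernel_approx F n (fst z) (snd z)) \<in> borel_measurable (haar \<Otimes>\<^sub>M (cone2 i j))"
    unfolding fourier_kernel_approx_def by (intro measurable_If fk) auto
  show "fourier_kernel_approx F n w \<in> L2 (cone2 i j)"
    unfolding fourier_kernel_approx_def[abs_def] using fkernel_L2[OF truncation_L2(2)[of "F w" n] truncation_L2(1)[of "F w" n] i j]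
    by (cases "F w \<in> L2 haar") auto
  show "(\<lambda>n. l2_norm (cone2 i j) (\<lambda>z. fourier_kernel_approx F n w z - fourier_kernel i j (F w) z)) \<longlonglongrightarrow> 0"
    using is_fourier_kernel_fourier_kernel[OF i j, of "F w"]
    by (cases "F w \<in> L2 haar") (simp_all add: fourier_kernel_approx_def is_fourier_kernel_def fourier_kernel_def)
qed

text \<open>The chosen kernels are determined only up to null sets for each \<open>w\<close> separately, but their pairings
  are limits of the pairings of the approximations.\<close>

lemma borel_measurable_fourier_kernel_pairing:
  assumes F: "(\<lambda>z. F (fst z) (snd z)) \<in> borel_measurable (haar \<Otimes>\<^sub>M haar)"
    and Pm: "\<And>n::nat. (\<lambda>z. P n (fst z) (snd z)) \<in> borel_measurable (haar \<Otimes>\<^sub>M (cone2 i j))"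
    and PL: "\<And>n w. P n w \<in> L2 (cone2 i j)" "\<And>w. P' w \<in> L2 (cone2 i j)"
    and lim: "\<And>w. (\<lambda>n. l2_norm (cone2 i j) (\<lambda>z. P n w z - P' w z)) \<longlonglongrightarrow> 0"
  shows "(\<lambda>w. l2_inner (cone2 i j) (fourier_kernel i j (F w)) (P' w)) \<in> borel_measurable haar"
proof (rule borel_measurable_LIMSEQ_metric)
  let ?C2 = "cone2 i j"
  interpret CC: pair_sigma_finite "cone_measure i j" "cone_measure i j"
    by (simp add: pair_sigma_finite_def sigma_finite_cone)
  show "(\<lambda>w. l2_inner ?C2 (fourier_kernel_approx F n w) (P n w)) \<in> borel_measurable haar" for n
    unfolding l2_inner_def
    using borel_measurable_times[OF fourier_kernel_approx(1)[OF F, of n] borel_measurable_cnj[OF Pm[of n]]]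
    by (intro CC.borel_measurable_lebesgue_integral) (simp add: case_prod_unfold)
  show "(\<lambda>n. l2_inner ?C2 (fourier_kernel_approx F n w) (P n w)) \<longlonglongrightarrow> l2_inner ?C2 (fourier_kernel i j (F w)) (P' w)" for w
    by (intro tendsto_l2_inner fourier_kernel_approx F fourier_kernel_L2 i j PL lim)
qed

text \<open>The Hilbert-Schmidt norms are square integrable in \<open>w\<close> because the norm of the kernel on one cone is
  at most the norm of the integrand at \<open>w\<close>, whose square is integrable by Fubini.\<close>

lemma wigner_field:
  assumes f: "f \<in> L2 haar" and h: "h \<in> L2 haar"
  shows "hs_op (cone_measure i j) (wigner f h w i j)"
    and "\<phi> \<in> L2 (cone_measure i j) \<Longrightarrow> \<psi> \<in> L2 (cone_measure i j) \<Longrightarrow>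
      (\<lambda>w. l2_inner (cone_measure i j) (wigner f h w i j \<phi>) \<psi>) \<in> borel_measurable haar"
    and "integrable haar (\<lambda>w. (hs_norm (cone_measure i j) (wigner f h w i j))\<^sup>2)"
proof -
  let ?C = "cone_measure i j" and ?C2 = "cone2 i j"
  interpret HH: pair_sigma_finite haar haar
    by (simp add: pair_sigma_finite_def sigma_finite_haar)
  note sfC = sigma_finite_cone[of i j] and onbC = is_onb_onb_cone[OF i j]
  note hk = has_kernel_fourier[OF i j, of "wigner_integrand f h w" for w]
  have W: "(\<lambda>z. wigner_integrand f h (fst z) (snd z)) \<in> borel_measurable (haar \<Otimes>\<^sub>M haar)"
    using L2_wigner_integrand[OF f h] by (rule L2_measurable)
  show "hs_op ?C (wigner f h w i j)"
    unfolding wigner_eq by (rule hs_op_has_kernel[OF sfC fourier_kernel_L2[OF i j] hk onbC])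
  show "(\<lambda>w. l2_inner ?C (wigner f h w i j \<phi>) \<psi>) \<in> borel_measurable haar" if \<phi>: "\<phi> \<in> L2 ?C" and \<psi>: "\<psi> \<in> L2 ?C"
  proof -
    let ?P = "\<lambda>(x, y). \<psi> x * cnj (\<phi> y)"
    have P: "?P \<in> L2 ?C2"
      using L2_product[OF sfC \<psi> L2_cnj[OF \<phi>]] by simp
    have "l2_inner ?C (wigner f h w i j \<phi>) \<psi> = l2_inner ?C2 (fourier_kernel i j (wigner_integrand f h w)) ?P" for w
    proof -
      have "l2_inner ?C (wigner f h w i j \<phi>) \<psi> = l2_inner ?C (kernel_op ?C (fourier_kernel i j (wigner_integrand f h w)) \<phi>) \<psi>"
        using hk[of w] \<phi> \<psi> unfolding wigner_eq
        by (intro l2_inner_cong_AE) (auto simp: has_kernel_def intro!: kernel_op_L2(1)[OF sfC] fourier_kernel_L2[OF i j])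
      then show ?thesis by (simp add: l2_inner_kernel_op[OF sfC fourier_kernel_L2[OF i j] \<phi> \<psi>])
    qed
    moreover have "(\<lambda>w. l2_inner ?C2 (fourier_kernel i j (wigner_integrand f h w)) ?P) \<in> borel_measurable haar"
      by (rule borel_measurable_fourier_kernel_pairing[OF W, where P = "\<lambda>n w. ?P"])
        (use P measurable_compose[OF measurable_snd L2_measurable[OF P]] in auto)
    ultimately show ?thesis by simp
  qed
  have norm: "(hs_norm ?C (wigner f h w i j))\<^sup>2 = Re (l2_inner ?C2 (fourier_kernel i j (wigner_integrand f h w)) (fourier_kernel i j (wigner_integrand f h w)))" for w
    unfolding wigner_eq hs_norm_has_kernel[OF sfC fourier_kernel_L2[OF i j] hk onbC] l2_inner_self by simp
  have m: "(\<lambda>w. l2_inner ?C2 (fourier_kernel i j (wigner_integrand f h w)) (fourier_kernel i j (wigner_integrand f h w))) \<in> borel_measurable haar"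
    by (rule borel_measurable_fourier_kernel_pairing[where P = "fourier_kernel_approx (wigner_integrand f h)", OF W])
      (intro fourier_kernel_approx[OF W] fourier_kernel_L2[OF i j])+
  show "integrable haar (\<lambda>w. (hs_norm ?C (wigner f h w i j))\<^sup>2)"
  proof (rule Bochner_Integration.integrable_bound)
    show "integrable haar (\<lambda>w. LINT \<xi>|haar. (cmod (wigner_integrand f h w \<xi>))\<^sup>2)"
      using HH.integrable_fst'[OF L2_square_integrable[OF L2_wigner_integrand[OF f h]]] by simp
    show "(\<lambda>w. (hs_norm ?C (wigner f h w i j))\<^sup>2) \<in> borel_measurable haar"
      unfolding norm using m by measurable
    show "AE w in haar. norm ((hs_norm ?C (wigner f h w i j))\<^sup>2) \<le> norm (LINT \<xi>|haar. (cmod (wigner_integrand f h w \<xi>))\<^sup>2)"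
    proof (rule AE_I2)
      fix w
      let ?h = "\<lambda>i j. (l2_norm (cone2 i j) (fourier_kernel i j (wigner_integrand f h w)))\<^sup>2"
      have "?h i j \<le> (LINT \<xi>|haar. (cmod (wigner_integrand f h w \<xi>))\<^sup>2)"
      proof (cases "wigner_integrand f h w \<in> L2 haar")
        case True
        have "?h i j \<le> (\<Sum>j\<in>{1, 2}. ?h i j)" using j by (intro member_le_sum) auto
        also have "\<dots> \<le> (\<Sum>i\<in>{1, 2}. \<Sum>j\<in>{1, 2}. ?h i j)"
          using i by (intro member_le_sum[of i "{1, 2}" "\<lambda>i. \<Sum>j\<in>{1, 2}. ?h i j"]) (auto intro!: sum_nonneg)
        also have "complex_of_real (\<Sum>i\<in>{1, 2}. \<Sum>j\<in>{1, 2}. ?h i j) = of_real ((l2_norm haar (wigner_integrand f h w))\<^sup>2)"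
          using fourier_kernel_inner_sum[OF True True] unfolding l2_inner_self by (simp only: of_real_sum)
        then have "(\<Sum>i\<in>{1, 2}. \<Sum>j\<in>{1, 2}. ?h i j) = (l2_norm haar (wigner_integrand f h w))\<^sup>2"
          unfolding of_real_eq_iff .
        finally show ?thesis by (simp add: l2_norm_square)
      qed (simp add: fourier_kernel_def)
      then show "norm ((hs_norm ?C (wigner f h w i j))\<^sup>2) \<le> norm (LINT \<xi>|haar. (cmod (wigner_integrand f h w \<xi>))\<^sup>2)"
        unfolding norm l2_inner_self by simp
    qed
  qed
qed

lemma op_trace_wigner:
  "op_trace (cone_measure i j) (wigner f h w i j \<circ> op_adjoint (cone_measure i j) (wigner g k w i j)) =
    l2_inner (cone2 i j) (fourier_kernel i j (wigner_integrand f h w)) (fourier_kernel i j (wigner_integrand g k w))"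
  unfolding wigner_eq
  by (rule op_trace_has_kernel[OF sigma_finite_cone fourier_kernel_L2[OF i j] has_kernel_fourier[OF i j] fourier_kernel_L2[OF i j]
        has_kernel_fourier[OF i j] is_onb_onb_cone[OF i j]])

end

lemma wigner_in_L2_field:
  assumes "f \<in> L2 haar" "h \<in> L2 haar"
  shows "wigner f h \<in> L2_field"
  unfolding L2_field_def mem_Collect_eq by (intro ballI conjI wigner_field assms)

theorem theorem5p2:
  fixes f g h k :: "poincare \<Rightarrow> complex"
  assumes "f \<in> L2 haar" and "g \<in> L2 haar" and "h \<in> L2 haar" and "k \<in> L2 haar"
  shows "wigner f h \<in> L2_field \<and> wigner g k \<in> L2_field \<and>
    field_inner (wigner f h) (wigner g k) = l2_inner haar f g * cnj (l2_inner haar h k)"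
proof (intro conjI wigner_in_L2_field assms)
  interpret HH: pair_sigma_finite haar haar
    by (simp add: pair_sigma_finite_def sigma_finite_haar)
  let ?K = "\<lambda>i j w. l2_inner (cone2 i j) (fourier_kernel i j (wigner_integrand f h w)) (fourier_kernel i j (wigner_integrand g k w))"
  let ?F = "\<lambda>z. wigner_integrand f h (fst z) (snd z)" and ?G = "\<lambda>z. wigner_integrand g k (fst z) (snd z)"
  have FL: "?F \<in> L2 (haar \<Otimes>\<^sub>M haar)" and GL: "?G \<in> L2 (haar \<Otimes>\<^sub>M haar)"
    by (rule L2_wigner_integrand[OF assms(1,3)] L2_wigner_integrand[OF assms(2,4)])+
  note Fm = L2_measurable[OF FL] and Gm = L2_measurable[OF GL]
  have I: "integrable (haar \<Otimes>\<^sub>M haar) (\<lambda>z. ?F z * cnj (?G z))"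
    by (rule L2_inner_integrable[OF FL GL])
  have Km: "?K i j \<in> borel_measurable haar" if i: "i \<in> {1, 2}" and j: "j \<in> {1, 2}" for i j
    by (rule borel_measurable_fourier_kernel_pairing[where P = "fourier_kernel_approx (wigner_integrand g k)", OF i j Fm])
      (intro fourier_kernel_approx[OF i j Gm] fourier_kernel_L2[OF i j])+
  have "field_inner (wigner f h) (wigner g k) = (LINT w|haar. (\<Sum>i\<in>{1, 2}. \<Sum>j\<in>{1, 2}. ?K i j w))"
    unfolding field_inner_def by (intro Bochner_Integration.integral_cong sum.cong refl op_trace_wigner)
  also have "\<dots> = (LINT w|haar. l2_inner haar (wigner_integrand f h w) (wigner_integrand g k w))"
  proof (rule integral_cong_AE)
    show "(\<lambda>w. \<Sum>i\<in>{1, 2}. \<Sum>j\<in>{1, 2}. ?K i j w) \<in> borel_measurable haar"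
      by (intro borel_measurable_sum Km)
    show "(\<lambda>w. l2_inner haar (wigner_integrand f h w) (wigner_integrand g k w)) \<in> borel_measurable haar"
      using borel_measurable_integrable[OF HH.integrable_fst'[OF I]] by (simp add: l2_inner_def)
    show "AE w in haar. (\<Sum>i\<in>{1, 2}. \<Sum>j\<in>{1, 2}. ?K i j w) = l2_inner haar (wigner_integrand f h w) (wigner_integrand g k w)"
      using AE_section_L2[OF sigma_finite_haar FL] AE_section_L2[OF sigma_finite_haar GL]
      by eventually_elim (intro fourier_kernel_inner_sum, simp_all)
  qed
  also have "\<dots> = l2_inner (haar \<Otimes>\<^sub>M haar) ?F ?G"
    using HH.integral_fst'[OF I] by (simp add: l2_inner_def)
  also have "\<dots> = l2_inner haar f g * cnj (l2_inner haar h k)"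
    by (rule l2_inner_wigner_integrand[OF assms])
  finally show "field_inner (wigner f h) (wigner g k) = l2_inner haar f g * cnj (l2_inner haar h k)" .
qed

end
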